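(* Let $d\ge1$, $k=2[d/4]+2$ and $$\gamma_d=(2\pi)^{-d}\,\frac{\sqrt2\,\pi^{-d/4}\,k^2\,2^{3k}}{4\sqrt{\Gamma(d/2+1)\,(2k-d)}}\,(3k)^k\,k^d\,d^k.$$ Then for every $a\in\mathcal S(\mathbf R^{2d})$, $$\|a(x,D)\|\le\gamma_d\max_{\substack{|\beta|\le2[d/4]+2\\|\alpha|\le2[d/4]+2}}\|D_\xi^\beta D_x^\alpha a\|_{L^\infty},$$ and, for every $\hbar\in(0,1]$, $$\|\mathrm{Op}^W_\hbar(a)\|\le\gamma_d\max_{\substack{|\beta|\le2[d/4]+2\\|\alpha|\le2[d/4]+2}}\|D_\xi^\beta D_x^\alpha a\|_{L^\infty}.$$
   Context: $[s]$ is the integer part; $\|\cdot\|$ on the left is the operator norm on $L^2(\mathbf R^d)$; $D=-i\nabla$; $\alpha,\beta\in\mathbf N^d$ are multi-indices. The Weyl quantization $\mathrm{Op}^W_\hbar(a)$ is the operator on $L^2(\mathbf R^d)$ with integral kernel $\int_{\mathbf R^d}a(\frac{x+y}2,\xi)e^{i(x-y)\cdot\xi/\hbar}\frac{d\xi}{(2\pi\hbar)^d}$, and $a(x,D):=\mathrm{Op}^W_1(a)$. *)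

theory Defs
  imports "HOL-Probability.Essential_Supremum"
begin

definition dir_deriv :: "'a::euclidean_space \<Rightarrow> ('a \<Rightarrow> complex) \<Rightarrow> 'a \<Rightarrow> complex" where
  "dir_deriv v f = (\<lambda>z. frechet_derivative f (at z) v)"

text \<open>A list \<open>[v\<^sub>1, \<dots>, v\<^sub>m]\<close> of basis vectors stands for the mixed partial derivative
  \<open>\<partial>\<^bsub>v\<^sub>1\<^esub> \<dots> \<partial>\<^bsub>v\<^sub>m\<^esub>\<close>; every order of differentiation is covered.\<close>

definition smooth_fun :: "('a::euclidean_space \<Rightarrow> complex) \<Rightarrow> bool" where
  "smooth_fun f \<longleftrightarrow>
     (\<forall>vs. set vs \<subseteq> Basis \<longrightarrow> (\<forall>z. foldr dir_deriv vs f differentiable (at z)))"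

definition schwartz_fun :: "('a::euclidean_space \<Rightarrow> complex) \<Rightarrow> bool" where
  "schwartz_fun f \<longleftrightarrow> smooth_fun f \<and>
     (\<forall>N vs. set vs \<subseteq> Basis \<longrightarrow>
        bounded (range (\<lambda>z. (1 + norm z) ^ N *\<^sub>R foldr dir_deriv vs f z)))"

text \<open>Here \<open>D = -i\<nabla>\<close> and phase space is \<open>(real ^ 'n) \<times> (real ^ 'n)\<close> with points \<open>(x, \<xi>)\<close>; a multi-index is a
  function \<open>'n \<Rightarrow> nat\<close>. As the index type carries no order, the coordinates are enumerated
  by an arbitrary list; on smooth functions the choice is immaterial.\<close>

definition coords :: "'n::finite list" where
  "coords = (SOME is. distinct is \<and> set is = UNIV)"

definition midx_deg :: "('n::finite \<Rightarrow> nat) \<Rightarrow> nat" where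
  "midx_deg \<alpha> = (\<Sum>i\<in>UNIV. \<alpha> i)"

definition D_x :: "('n::finite \<Rightarrow> nat) \<Rightarrow> ((real ^ 'n) \<times> (real ^ 'n) \<Rightarrow> complex)
    \<Rightarrow> ((real ^ 'n) \<times> (real ^ 'n) \<Rightarrow> complex)" where
  "D_x \<alpha> a = foldr (\<lambda>i. (\<lambda>f z. - \<i> * dir_deriv (axis i 1, 0) f z) ^^ \<alpha> i) coords a"

definition D_xi :: "('n::finite \<Rightarrow> nat) \<Rightarrow> ((real ^ 'n) \<times> (real ^ 'n) \<Rightarrow> complex)
    \<Rightarrow> ((real ^ 'n) \<times> (real ^ 'n) \<Rightarrow> complex)" where
  "D_xi \<beta> a = foldr (\<lambda>i. (\<lambda>f z. - \<i> * dir_deriv (0, axis i 1) f z) ^^ \<beta> i) coords a"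

definition Linf_norm :: "('a::euclidean_space \<Rightarrow> complex) \<Rightarrow> ennreal" where
  "Linf_norm f = esssup lborel (\<lambda>z. ennreal (norm (f z)))"

text \<open>Elements of \<open>L\<^sup>2\<close> are represented by Borel functions; every class of Lebesgue measurable
  functions has such a representative.\<close>

definition L2_fun :: "('a::euclidean_space \<Rightarrow> complex) \<Rightarrow> bool" where
  "L2_fun f \<longleftrightarrow> f \<in> borel_measurable lborel \<and> integrable lborel (\<lambda>x. (norm (f x))\<^sup>2)"

definition L2_norm :: "('a::euclidean_space \<Rightarrow> complex) \<Rightarrow> real" where
  "L2_norm f = sqrt (\<integral>x. (norm (f x))\<^sup>2 \<partial>lborel)"

text \<open>The value is \<open>\<infinity>\<close> (the infimum of the empty set) unless \<open>T\<close> maps \<open>L\<^sup>2\<close> to itself boundedly,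
  so a finite upper bound includes the assertion that \<open>T\<close> is a bounded operator on \<open>L\<^sup>2\<close>.\<close>

definition L2_opnorm ::
  "(('a::euclidean_space \<Rightarrow> complex) \<Rightarrow> ('a \<Rightarrow> complex)) \<Rightarrow> ennreal" where
  "L2_opnorm T = Inf {ennreal C | C. 0 \<le> C \<and>
     (\<forall>f. L2_fun f \<longrightarrow> L2_fun (T f) \<and> L2_norm (T f) \<le> C * L2_norm f)}"

definition weyl_kernel :: "real \<Rightarrow> ((real ^ 'n::finite) \<times> (real ^ 'n) \<Rightarrow> complex)
    \<Rightarrow> real ^ 'n \<Rightarrow> real ^ 'n \<Rightarrow> complex" where
  "weyl_kernel h a x y =
     (\<integral>\<xi>. a ((x + y) /\<^sub>R 2, \<xi>) * exp (\<i> * of_real (((x - y) \<bullet> \<xi>) / h)) \<partial>lborel)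
       / of_real ((2 * pi * h) ^ CARD('n))"

definition Op_weyl :: "real \<Rightarrow> ((real ^ 'n::finite) \<times> (real ^ 'n) \<Rightarrow> complex)
    \<Rightarrow> (real ^ 'n \<Rightarrow> complex) \<Rightarrow> (real ^ 'n \<Rightarrow> complex)" where
  "Op_weyl h a f = (\<lambda>x. \<integral>y. weyl_kernel h a x y * f y \<partial>lborel)"

definition cv_order :: "nat \<Rightarrow> nat" where
  "cv_order d = 2 * (d div 4) + 2"

definition cv_gamma :: "nat \<Rightarrow> real" where
  "cv_gamma d = (let k = cv_order d in
     (2 * pi) powr (- real d)
     * ((sqrt 2 * pi powr (- (real d / 4)) * real k ^ 2 * 2 ^ (3 * k))
        / (4 * sqrt (Gamma (real d / 2 + 1) * (2 * real k - real d))))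
     * (3 * real k) ^ k * real k ^ d * real d ^ k)"

end

theory Submission
  imports Defs "HOL-Probability.Probability"
begin

text \<open>Write \<open>d\<close> for the dimension, \<open>k = 2m\<close> for the order \<open>2[d/4] + 2\<close>, and let
\<open>W(f,g)(X,\<xi>) = \<integral>f(X - t/2) cnj(g(X + t/2)) e\<^sup>i\<^sup>t\<^sup>\<xi> dt\<close> be the Wigner transform, so that pairing the Weyl operator of
\<open>a\<close> applied to \<open>f\<close> with \<open>g\<close> gives \<open>(2\<pi>)\<^sup>-\<^sup>d \<integral>\<integral> a W(f,g)\<close>.

Since \<open>k\<close> is even, \<open>b = (1 - \<Delta>\<^sub>x)\<^sup>m (1 - \<Delta>\<^sub>\<xi>)\<^sup>m a\<close> is a sum of \<open>(1 + d)\<^sup>k\<close> derivatives of the admitted orders, hence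
\<open>|b| \<le> (1 + d)\<^sup>k M\<close> with \<open>M\<close> the maximum in the theorem. Conversely \<open>(1 + s)\<^sup>-\<^sup>m\<close> is the Laplace transform of the Erlang law
\<open>\<mu>(d\<tau>) = \<tau>\<^sup>m\<^sup>-\<^sup>1 e\<^sup>-\<^sup>\<tau> d\<tau> / (m - 1)!\<close>, so \<open>(1 - \<Delta>)\<^sup>-\<^sup>m\<close> is the \<open>\<mu>\<close>-average of the heat semigroups and
\<open>a\<close> is the \<open>\<mu> \<otimes> \<mu>\<close>-average over \<open>(\<tau>, \<rho>)\<close> of the Gaussian mollifications \<open>e\<^sup>\<tau>\<^sup>\<Delta>\<^sup>x e\<^sup>\<rho>\<^sup>\<Delta>\<^sup>\<xi> b\<close>
(\<open>heat_representation\<close>, \<open>kernel_identity\<close>). It therefore suffices that the operator of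
such a mollification has norm at most \<open>(1 + 1/(16\<tau>\<rho>))\<^sup>d\<^sup>/\<^sup>4 sup|b|\<close>, because \<open>(\<tau>\<rho>)\<^sup>-\<^sup>d\<^sup>/\<^sup>4\<close> is integrable for \<open>\<mu> \<otimes> \<mu>\<close>: this is
where \<open>k > d/2\<close> enters (\<open>smoothing_constant\<close>).

By duality the operator bound is an \<open>L\<^sup>1\<close> bound on phase space for the mollified Wigner transform \<open>V\<close> (\<open>smooth_wigner_L1\<close>).
For \<open>16\<tau>\<rho> < 1\<close> it is proved by localisation. Multiply \<open>V\<close> by a Gaussian window centred at \<open>(s, \<sigma>)\<close>, average over all
centres, and use the Cauchy-Schwarz inequality inside each window. The windowed integral of \<open>|V|\<^sup>2\<close> is a quadratic form in
\<open>f \<otimes> cnj g\<close> with a Gaussian kernel, and for exactly one choice of the two window widths this kernel is a tensor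
product (\<open>window_kernel\<close>). The form is then a constant times \<open>husimi f s \<sigma> * husimi g s \<sigma>\<close>, where \<open>husimi\<close> is a Gaussian
average of the squared short-time Fourier transform; its integral over \<open>(s, \<sigma>)\<close> is controlled by
Bessel's inequality (\<open>husimi_total\<close>). Larger values of \<open>\<rho>\<close> only average \<open>V\<close> further in \<open>\<xi>\<close>
(\<open>smooth_wigner_L1_mono\<close>).

The resulting constant \<open>2\<^sup>d\<^sup>/\<^sup>4 (1 + 25/2\<^sup>d) (1 + d)\<^sup>k\<close> is at most \<open>\<gamma>\<^sub>d\<close> (\<open>constant_le_cv_gamma\<close>). The bilinear
estimate is established for \<open>f, g \<in> L\<^sup>1 \<inter> L\<^sup>2\<close> and reaches \<open>L\<^sup>2\<close> by truncation to balls and Fatou's lemma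
(\<open>weyl_L2_bound\<close>). Finally the operator with parameter \<open>h\<close> and symbol \<open>a\<close> is the operator with parameter \<open>1\<close> and symbol
\<open>a(x, h\<xi>)\<close>, whose derivatives are not larger when \<open>h \<le> 1\<close> (\<open>weyl_kernel_eq\<close>, \<open>dilate_derivs\<close>).\<close>

section \<open>Lebesgue integrals and products\<close>

lemma lborel_integral_translate:
  fixes f :: "'a::euclidean_space \<Rightarrow> 'b::{banach, second_countable_topology}"
  assumes "f \<in> borel_measurable borel"
  shows "(\<integral>x. f (c + x) \<partial>lborel) = (\<integral>x. f x \<partial>lborel)"
proof -
  have "(\<integral>x. f x \<partial>lborel) = (\<integral>x. f x \<partial>(distr lborel borel ((+) c)))"
    by (simp only: lborel_distr_plus)
  also have "\<dots> = (\<integral>x. f (c + x) \<partial>lborel)"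
    using assms by (subst integral_distr) auto
  finally show ?thesis by simp
qed

lemma lborel_nn_integral_translate:
  fixes f :: "'a::euclidean_space \<Rightarrow> ennreal"
  assumes "f \<in> borel_measurable borel"
  shows "(\<integral>\<^sup>+x. f (c + x) \<partial>lborel) = (\<integral>\<^sup>+x. f x \<partial>lborel)"
proof -
  have "(\<integral>\<^sup>+x. f x \<partial>lborel) = (\<integral>\<^sup>+x. f x \<partial>(distr lborel borel ((+) c)))"
    by (simp only: lborel_distr_plus)
  also have "\<dots> = (\<integral>\<^sup>+x. f (c + x) \<partial>lborel)"
    using assms by (subst nn_integral_distr) auto
  finally show ?thesis by simp
qed

lemma lborel_integrable_translate:
  fixes f :: "'a::euclidean_space \<Rightarrow> 'b::{banach, second_countable_topology}"
  assumes "integrable lborel f"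
  shows "integrable lborel (\<lambda>x. f (c + x))"
proof -
  have f: "f \<in> borel_measurable borel"
    using borel_measurable_integrable[OF assms] by simp
  have "integrable (distr lborel borel ((+) c)) f"
    using assms by (simp only: lborel_distr_plus)
  then show ?thesis
    using f by (subst (asm) integrable_distr_eq) auto
qed

lemma lborel_nn_integral_affine:
  fixes f :: "'a::euclidean_space \<Rightarrow> ennreal"
  assumes "f \<in> borel_measurable borel" "r \<noteq> 0"
  shows "(\<integral>\<^sup>+x. f x \<partial>lborel) = ennreal (\<bar>r\<bar> ^ DIM('a)) * (\<integral>\<^sup>+x. f (c + r *\<^sub>R x) \<partial>lborel)"
  using assms
  by (subst lborel_affine[of r c])
    (auto simp: nn_integral_density nn_integral_distr nn_integral_cmult ennreal_power)

lemma lborel_integral_affine: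
  fixes f :: "'a::euclidean_space \<Rightarrow> 'b::{banach, second_countable_topology}"
  assumes "f \<in> borel_measurable borel" "r \<noteq> 0"
  shows "(\<integral>x. f x \<partial>lborel) = (\<bar>r\<bar> ^ DIM('a)) *\<^sub>R (\<integral>x. f (c + r *\<^sub>R x) \<partial>lborel)"
  using assms
  by (subst lborel_affine[of r c])
    (auto simp: integral_density integral_distr)

lemma lborel_integrable_affine:
  fixes f :: "'a::euclidean_space \<Rightarrow> 'b::{banach, second_countable_topology}"
  assumes "integrable lborel f" "r \<noteq> 0"
  shows "integrable lborel (\<lambda>x. f (c + r *\<^sub>R x))"
proof -
  have [measurable]: "f \<in> borel_measurable borel"
    using borel_measurable_integrable[OF assms(1)] by simp
  have "(\<integral>\<^sup>+x. ennreal (norm (f x)) \<partial>lborel) < \<infinity>"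
    using assms(1) by (simp add: integrable_iff_bounded)
  moreover have "0 < \<bar>r\<bar> ^ DIM('a)" using assms(2) by simp
  ultimately have "(\<integral>\<^sup>+x. ennreal (norm (f (c + r *\<^sub>R x))) \<partial>lborel) < \<infinity>"
    using assms(2)
    by (subst (asm) lborel_nn_integral_affine[where r=r and c=c])
       (auto simp: ennreal_mult_less_top)
  then show ?thesis by (simp add: integrable_iff_bounded)
qed

lemma integrable_pair_bounded:
  fixes f :: "'a \<Rightarrow> complex" and g :: "'b \<Rightarrow> complex"
  assumes M: "sigma_finite_measure M" "sigma_finite_measure N"
    and f: "integrable M f" and g: "integrable N g"
    and [measurable]: "(\<lambda>(x,y). K x y) \<in> borel_measurable (M \<Otimes>\<^sub>M N)"
    and B: "\<And>x y. norm (K x y) \<le> B"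
  shows "integrable (M \<Otimes>\<^sub>M N) (\<lambda>(x,y). K x y * (f x * g y))"
proof -
  interpret M: sigma_finite_measure M by fact
  interpret N: sigma_finite_measure N by fact
  interpret pair_sigma_finite M N ..
  note [measurable] = borel_measurable_integrable[OF f] borel_measurable_integrable[OF g]
  have 1: "integrable (M \<Otimes>\<^sub>M N) (\<lambda>p. complex_of_real B * (f (fst p) * g (snd p)))"
    by (rule Fubini_integrable) (use f g in \<open>auto simp: norm_mult\<close>)
  have 2: "norm (case p of (x,y) \<Rightarrow> K x y * (f x * g y)) \<le> norm (complex_of_real B * (f (fst p) * g (snd p)))" for p
    using B[of "fst p" "snd p"]
    by (auto simp: norm_mult split: prod.split intro!: mult_right_mono)
  show ?thesis
    by (rule Bochner_Integration.integrable_bound[OF 1]) (use 2 in auto)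
qed

lemma lborel_prod_integral:
  fixes f :: "'a::euclidean_space \<times> 'b::euclidean_space \<Rightarrow> 'c::{banach, second_countable_topology}"
  assumes "integrable lborel f"
  shows "(\<integral>p. f p \<partial>lborel) = (\<integral>x. (\<integral>y. f (x,y) \<partial>lborel) \<partial>lborel)"
  using lborel_pair.integral_fst'[of f] assms unfolding lborel_prod by simp

lemma lborel_prod_nn_integral:
  fixes f :: "'a::euclidean_space \<times> 'b::euclidean_space \<Rightarrow> ennreal"
  assumes "f \<in> borel_measurable borel"
  shows "(\<integral>\<^sup>+p. f p \<partial>lborel) = (\<integral>\<^sup>+x. (\<integral>\<^sup>+y. f (x,y) \<partial>lborel) \<partial>lborel)"
  using lborel.nn_integral_fst[of f lborel] assms unfolding lborel_prod by simp

lemma integrable_lborel_prod_mult: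
  fixes f :: "'a::euclidean_space \<Rightarrow> complex" and g :: "'b::euclidean_space \<Rightarrow> complex"
  assumes f: "integrable lborel f" and g: "integrable lborel g"
  shows "integrable lborel (\<lambda>p. f (fst p) * g (snd p))"
    and "(\<integral>p. f (fst p) * g (snd p) \<partial>lborel) = (\<integral>x. f x \<partial>lborel) * (\<integral>x. g x \<partial>lborel)"
proof -
  show i: "integrable lborel (\<lambda>p. f (fst p) * g (snd p))"
    using integrable_pair_bounded[OF sigma_finite_lborel sigma_finite_lborel f g, of "\<lambda>_ _. 1" 1]
    by (simp add: lborel_prod case_prod_beta')
  show "(\<integral>p. f (fst p) * g (snd p) \<partial>lborel) = (\<integral>x. f x \<partial>lborel) * (\<integral>x. g x \<partial>lborel)"
    by (subst lborel_prod_integral[OF i]) simp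
qed

section \<open>Gaussian integrals\<close>

abbreviation gaussian :: "real \<Rightarrow> 'a::euclidean_space \<Rightarrow> real" where
  "gaussian a x \<equiv> exp (- a * (norm x)\<^sup>2)"

abbreviation square_integrable :: "('a::euclidean_space \<Rightarrow> complex) \<Rightarrow> bool" where
  "square_integrable f \<equiv> integrable lborel (\<lambda>x. (norm (f x))\<^sup>2)"

lemma borel_measurable_cis [measurable]: "cis \<in> borel_measurable borel"
  by (intro borel_measurable_continuous_onI continuous_intros)

text \<open>A rescaling of the characteristic function of the standard normal law.\<close>

lemma gauss_FT_real:
  fixes a p :: real
  assumes a: "0 < a"
  shows "has_bochner_integral lborel (\<lambda>x. of_real (exp (- a * x\<^sup>2)) * cis (p * x))
     (of_real (sqrt (pi / a) * exp (- p\<^sup>2 / (4 * a))))"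
proof -
  define c where "c = sqrt (2 * a)"
  have c: "c > 0" "c\<^sup>2 = 2 * a" using a by (auto simp: c_def)
  have 1: "integrable std_normal_distribution (\<lambda>x. iexp ((p / c) * x))"
  proof -
    interpret prob_space std_normal_distribution by (rule prob_space_normal_density) simp
    show ?thesis by (rule integrable_const_bound[of _ 1]) auto
  qed
  have 2: "(\<integral>x. iexp ((p / c) * x) \<partial>std_normal_distribution) = exp (- (p / c)\<^sup>2 / 2)"
    using fun_cong[OF char_std_normal_distribution, of "p / c"] by (simp add: char_def)
  have "integrable lborel (\<lambda>x. std_normal_density x *\<^sub>R iexp ((p / c) * x))"
    using 1 by (subst (asm) integrable_density) (auto simp: normal_density_nonneg)
  moreover have "(\<integral>x. std_normal_density x *\<^sub>R iexp ((p / c) * x) \<partial>lborel) = exp (- (p / c)\<^sup>2 / 2)"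
    using 2 by (subst (asm) integral_density) (auto simp: normal_density_nonneg)
  ultimately have "has_bochner_integral lborel (\<lambda>x. std_normal_density x *\<^sub>R iexp ((p / c) * x)) (exp (- (p / c)\<^sup>2 / 2))"
    by (auto simp: has_bochner_integral_iff)
  then have "has_bochner_integral lborel (\<lambda>x. std_normal_density (0 + c * x) *\<^sub>R iexp ((p / c) * (0 + c * x)))
      (complex_of_real (exp (- (p / c)\<^sup>2 / 2)) /\<^sub>R \<bar>c\<bar>)"
    using c by (subst (asm) lborel_has_bochner_integral_real_affine_iff[of c _ _ 0]) auto
  then have 3: "has_bochner_integral lborel (\<lambda>x. complex_of_real (sqrt (2 * pi)) * (std_normal_density (0 + c * x) *\<^sub>R iexp ((p / c) * (0 + c * x))))
      (complex_of_real (sqrt (2 * pi)) * (complex_of_real (exp (- (p / c)\<^sup>2 / 2)) /\<^sub>R \<bar>c\<bar>))"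
    by (rule has_bochner_integral_mult_right)
  have 4: "(p / c)\<^sup>2 / 2 = p\<^sup>2 / (4 * a)" using c by (simp add: power_divide)
  have 5: "sqrt (pi / a) = sqrt (2 * pi) / c"
    using a by (simp add: c_def real_sqrt_divide[symmetric])
  show ?thesis
  proof (rule has_bochner_integral_cong[THEN iffD1, OF _ _ _ 3])
    fix x
    have "(c * x)\<^sup>2 / 2 = a * x\<^sup>2" using c by (simp add: power_mult_distrib)
    then show "complex_of_real (sqrt (2 * pi)) * (std_normal_density (0 + c * x) *\<^sub>R iexp ((p / c) * (0 + c * x)))
      = of_real (exp (- a * x\<^sup>2)) * cis (p * x)"
      using c by (simp add: std_normal_density_def cis_conv_exp scaleR_conv_of_real)
  next
    show "complex_of_real (sqrt (2 * pi)) * (complex_of_real (exp (- (p / c)\<^sup>2 / 2)) /\<^sub>R \<bar>c\<bar>)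
      = of_real (sqrt (pi / a) * exp (- p\<^sup>2 / (4 * a)))"
    proof -
      have "complex_of_real u * (complex_of_real E /\<^sub>R \<bar>c\<bar>) = of_real (u / c * E)" for u E
        using c by (simp add: scaleR_conv_of_real divide_inverse)
      then show ?thesis unfolding 5 4 minus_divide_left[symmetric] .
    qed
  qed auto
qed

text \<open>Both the Gaussian and the character factor over an orthonormal basis.\<close>

lemma gauss_FT:
  fixes p :: "'a::euclidean_space"
  assumes a: "0 < a"
  shows "has_bochner_integral lborel (\<lambda>x. of_real (gaussian a x) * cis (p \<bullet> x))
     (of_real (sqrt (pi / a) ^ DIM('a) * exp (- (norm p)\<^sup>2 / (4 * a))))"
proof -
  interpret product_sigma_finite "\<lambda>_::'a. lborel :: real measure" ..
  define F where "F b x = of_real (exp (- a * x\<^sup>2)) * cis ((p \<bullet> b) * x)" for b x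
  have F: "integrable lborel (F b)" "integral\<^sup>L lborel (F b) = of_real (sqrt (pi / a) * exp (- (p \<bullet> b)\<^sup>2 / (4 * a)))" for b
    using gauss_FT_real[OF a, of "p \<bullet> b"] unfolding F_def has_bochner_integral_iff by auto
  have n2: "(norm x)\<^sup>2 = (\<Sum>b\<in>Basis. (x \<bullet> b)\<^sup>2)" for x :: 'a
    unfolding power2_norm_eq_inner by (subst euclidean_inner) (simp add: power2_eq_square)
  have cis_sum: "cis (\<Sum>b\<in>A. g b) = (\<Prod>b\<in>A. cis (g b))" if "finite A" for A :: "'a set" and g
    using that by (induction A) (auto simp: cis_mult[symmetric])
  have prod_F: "(\<Prod>b\<in>Basis. F b (x \<bullet> b)) = of_real (gaussian a x) * cis (p \<bullet> x)" for x :: 'a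
    by (simp add: F_def prod.distrib n2 sum_distrib_left cis_sum[symmetric] exp_sum sum_negf[symmetric]
        of_real_prod[symmetric] euclidean_inner[of p x] del: of_real_prod)
  have comp: "(\<Sum>b\<in>Basis. f b *\<^sub>R b) \<bullet> b' = f b'" if "b' \<in> Basis" for f :: "'a \<Rightarrow> real" and b'
    using that by (rule inner_sum_left_Basis)
  have meas: "(\<lambda>x::'a. \<Prod>b\<in>Basis. F b (x \<bullet> b)) \<in> borel_measurable borel"
    unfolding F_def by measurable
  have "integrable (\<Pi>\<^sub>M b\<in>(Basis::'a set). lborel) (\<lambda>x. \<Prod>b\<in>Basis. F b (x b))"
    by (rule product_integrable_prod) (auto simp: F)
  then have i: "integrable lborel (\<lambda>x::'a. \<Prod>b\<in>Basis. F b (x \<bullet> b))"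
    by (subst lborel_eq, subst integrable_distr_eq) (use meas in \<open>auto simp: comp cong: prod.cong\<close>)
  have "(\<integral>x. (\<Prod>b\<in>Basis. F b (x \<bullet> b)) \<partial>lborel) = (\<integral>x. (\<Prod>b\<in>(Basis::'a set). F b (x b)) \<partial>(\<Pi>\<^sub>M b\<in>(Basis::'a set). lborel))"
    by (subst lborel_eq, subst integral_distr) (use meas in \<open>auto simp: comp cong: prod.cong\<close>)
  also have "\<dots> = (\<Prod>b\<in>(Basis::'a set). integral\<^sup>L lborel (F b))"
    by (rule product_integral_prod) (auto simp: F)
  also have "\<dots> = of_real (sqrt (pi / a) ^ DIM('a) * exp (- (norm p)\<^sup>2 / (4 * a)))"
    by (simp add: F prod.distrib n2 sum_divide_distrib exp_sum sum_negf[symmetric]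
        of_real_prod[symmetric] del: of_real_prod)
  finally show ?thesis
    using i by (simp add: has_bochner_integral_iff prod_F)
qed

lemma gauss_integral:
  fixes c :: "'a::euclidean_space"
  assumes a: "0 < a"
  shows "integrable lborel (\<lambda>x. gaussian a (x - c))"
    and "(\<integral>x. gaussian a (x - c) \<partial>lborel) = sqrt (pi / a) ^ DIM('a)"
    and "(\<integral>\<^sup>+x. ennreal (gaussian a (x - c)) \<partial>lborel) = ennreal (sqrt (pi / a) ^ DIM('a))"
proof -
  have 0: "has_bochner_integral lborel (\<lambda>x::'a. complex_of_real (gaussian a x)) (of_real (sqrt (pi / a) ^ DIM('a)))"
    using gauss_FT[OF a, of "0::'a"] by simp
  have i0: "integrable lborel (\<lambda>x::'a. gaussian a x)"
    using 0 unfolding has_bochner_integral_iff by (subst (asm) complex_of_real_integrable_eq) auto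
  have e0: "(\<integral>x. gaussian a (x::'a) \<partial>lborel) = sqrt (pi / a) ^ DIM('a)"
  proof -
    have "complex_of_real (\<integral>x. gaussian a (x::'a) \<partial>lborel) = of_real (sqrt (pi / a) ^ DIM('a))"
      using 0 unfolding has_bochner_integral_iff integral_complex_of_real by blast
    then show ?thesis by (rule of_real_eq_iff[THEN iffD1])
  qed
  show i: "integrable lborel (\<lambda>x. gaussian a (x - c))"
    using lborel_integrable_translate[OF i0, of "-c"] by simp
  show e: "(\<integral>x. gaussian a (x - c) \<partial>lborel) = sqrt (pi / a) ^ DIM('a)"
    using lborel_integral_translate[of "\<lambda>x::'a. gaussian a x" "-c"] e0 by simp
  show "(\<integral>\<^sup>+x. ennreal (gaussian a (x - c)) \<partial>lborel) = ennreal (sqrt (pi / a) ^ DIM('a))"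
    using nn_integral_eq_integral[OF i] e by simp
qed

lemma gauss_FT_shift:
  fixes p :: "'a::euclidean_space"
  assumes a: "0 < a"
  shows "integrable lborel (\<lambda>x. of_real (gaussian a (x - c)) * cis (p \<bullet> x))"
    and "(\<integral>x. of_real (gaussian a (x - c)) * cis (p \<bullet> x) \<partial>lborel)
      = of_real (sqrt (pi / a) ^ DIM('a) * exp (- (norm p)\<^sup>2 / (4 * a))) * cis (p \<bullet> c)"
proof -
  let ?f = "\<lambda>x. of_real (gaussian a x) * cis (p \<bullet> x)"
  have eq: "of_real (gaussian a (x - c)) * cis (p \<bullet> x) = ?f (-c + x) * cis (p \<bullet> c)" for x
    by (simp add: inner_add_right inner_diff_right cis_mult mult.assoc)
  have i: "integrable lborel ?f" and e: "integral\<^sup>L lborel ?f = of_real (sqrt (pi / a) ^ DIM('a) * exp (- (norm p)\<^sup>2 / (4 * a)))"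
    using gauss_FT[OF a, of p] unfolding has_bochner_integral_iff by auto
  have m: "?f \<in> borel_measurable borel" using borel_measurable_integrable[OF i] by simp
  show "integrable lborel (\<lambda>x. of_real (gaussian a (x - c)) * cis (p \<bullet> x))"
    unfolding eq by (intro integrable_mult_left lborel_integrable_translate[OF i])
  show "(\<integral>x. of_real (gaussian a (x - c)) * cis (p \<bullet> x) \<partial>lborel)
      = of_real (sqrt (pi / a) ^ DIM('a) * exp (- (norm p)\<^sup>2 / (4 * a))) * cis (p \<bullet> c)"
    unfolding eq integral_mult_left_zero lborel_integral_translate[OF m] e ..
qed

section \<open>Gram identity, Cauchy-Schwarz and Bessel inequalities\<close>

lemma borel_measurable_cnj [measurable (raw)]:
  "f \<in> borel_measurable M \<Longrightarrow> (\<lambda>x. cnj (f x)) \<in> borel_measurable M"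
  by (rule measurable_compose[of f M borel]) (auto intro!: borel_measurable_continuous_onI continuous_intros)

lemma borel_measurable_fst_borel [measurable (raw)]:
  fixes f :: "'c \<Rightarrow> 'a::euclidean_space \<times> 'b::euclidean_space"
  shows "f \<in> borel_measurable M \<Longrightarrow> (\<lambda>x. fst (f x)) \<in> borel_measurable M"
  by (rule measurable_compose[of f M borel]) (auto intro!: borel_measurable_continuous_onI continuous_intros)

lemma borel_measurable_snd_borel [measurable (raw)]:
  fixes f :: "'c \<Rightarrow> 'a::euclidean_space \<times> 'b::euclidean_space"
  shows "f \<in> borel_measurable M \<Longrightarrow> (\<lambda>x. snd (f x)) \<in> borel_measurable M"
  by (rule measurable_compose[of f M borel]) (auto intro!: borel_measurable_continuous_onI continuous_intros)

lemma fubini_bounded: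
  fixes f :: "'a \<Rightarrow> complex" and g :: "'b \<Rightarrow> complex"
  assumes M: "sigma_finite_measure M" "sigma_finite_measure N"
    and f: "integrable M f" and g: "integrable N g"
    and K: "(\<lambda>(x,y). K x y) \<in> borel_measurable (M \<Otimes>\<^sub>M N)"
    and B: "\<And>x y. norm (K x y) \<le> B"
  shows "(\<integral>x. f x * (\<integral>y. K x y * g y \<partial>N) \<partial>M) = (\<integral>y. g y * (\<integral>x. K x y * f x \<partial>M) \<partial>N)"
proof -
  interpret M: sigma_finite_measure M by fact
  interpret N: sigma_finite_measure N by fact
  interpret pair_sigma_finite M N ..
  have "(\<integral>y. (\<integral>x. K x y * (f x * g y) \<partial>M) \<partial>N) = (\<integral>x. (\<integral>y. K x y * (f x * g y) \<partial>N) \<partial>M)"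
    by (rule Fubini_integral[OF integrable_pair_bounded[OF assms]])
  moreover have "(\<integral>x. K x y * (f x * g y) \<partial>M) = g y * (\<integral>x. K x y * f x \<partial>M)" for y
    by (subst integral_mult_right_zero[symmetric]) (simp add: mult_ac)
  moreover have "(\<integral>y. K x y * (f x * g y) \<partial>N) = f x * (\<integral>y. K x y * g y \<partial>N)" for x
    by (subst integral_mult_right_zero[symmetric]) (simp add: mult_ac)
  ultimately show ?thesis by simp
qed

text \<open>Expansion of a square followed by two applications of Fubini. With Gaussian data the inner integral is explicit,
so a weighted \<open>L\<^sup>2\<close> norm of an integral transform turns into a quadratic form with an explicit kernel. All \<open>L\<^sup>2\<close>
computations on phase space take this form.\<close>

lemma gram_identity:
  fixes \<Phi> :: "'z \<Rightarrow> 'w \<Rightarrow> complex" and H :: "'w \<Rightarrow> complex" and \<nu> :: "'z \<Rightarrow> real"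
  assumes M: "sigma_finite_measure M" and N: "sigma_finite_measure N"
    and \<nu>: "integrable M \<nu>" and H: "integrable N H"
    and K: "(\<lambda>(z,w). \<Phi> z w) \<in> borel_measurable (M \<Otimes>\<^sub>M N)"
    and B: "\<And>z w. norm (\<Phi> z w) \<le> B"
  shows "integrable M (\<lambda>z. \<nu> z * (norm (\<integral>w. \<Phi> z w * H w \<partial>N))\<^sup>2)"
    and "complex_of_real (\<integral>z. \<nu> z * (norm (\<integral>w. \<Phi> z w * H w \<partial>N))\<^sup>2 \<partial>M)
      = (\<integral>w. H w * (\<integral>w'. cnj (H w') * (\<integral>z. \<nu> z * \<Phi> z w * cnj (\<Phi> z w') \<partial>M) \<partial>N) \<partial>N)"
proof -
  interpret M: sigma_finite_measure M by fact
  interpret N: sigma_finite_measure N by fact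
  define S where "S z = (\<integral>w. \<Phi> z w * H w \<partial>N)" for z
  have Hm [measurable]: "H \<in> borel_measurable N" by (rule borel_measurable_integrable[OF H])
  have [measurable]: "\<nu> \<in> borel_measurable M" by (rule borel_measurable_integrable[OF \<nu>])
  note K [measurable]
  have K1 [measurable]: "(\<lambda>p. \<Phi> (fst p) (snd p)) \<in> borel_measurable (M \<Otimes>\<^sub>M N)"
    using K by (simp add: case_prod_beta')
  have K2 [measurable]: "(\<lambda>p. \<Phi> (snd p) (fst p)) \<in> borel_measurable (N \<Otimes>\<^sub>M M)"
  proof -
    have "(\<lambda>p. (\<lambda>q. \<Phi> (fst q) (snd q)) ((\<lambda>p. (snd p, fst p)) p)) \<in> borel_measurable (N \<Otimes>\<^sub>M M)"
      by (rule measurable_compose[OF _ K1]) measurable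
    then show ?thesis by simp
  qed
  have Kw: "(\<lambda>w. \<Phi> z w) \<in> borel_measurable N" if "z \<in> space M" for z
    using measurable_compose[OF measurable_Pair1'[OF that] K] by simp
  have Kz: "(\<lambda>z. \<Phi> z w) \<in> borel_measurable M" if "w \<in> space N" for w
    using measurable_compose[OF measurable_Pair2'[OF that] K] by simp
  have Sm [measurable]: "S \<in> borel_measurable M"
  proof -
    have "(\<lambda>(z, w). \<Phi> z w * H w) \<in> borel_measurable (M \<Otimes>\<^sub>M N)"
      unfolding case_prod_beta' by measurable
    then show ?thesis unfolding S_def by (rule N.borel_measurable_lebesgue_integral)
  qed
  have B0: "0 \<le> B" using B[of undefined undefined] norm_ge_zero order_trans by blast
  define C where "C = B * (\<integral>w. norm (H w) \<partial>N)"
  have C0: "0 \<le> C" using B0 by (simp add: C_def)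
  have Sb: "norm (S z) \<le> C" for z
  proof -
    have "norm (S z) \<le> (\<integral>w. norm (\<Phi> z w * H w) \<partial>N)"
      unfolding S_def by (rule integral_norm_bound)
    also have "\<dots> \<le> (\<integral>w. B * norm (H w) \<partial>N)"
      by (rule integral_mono') (use H B B0 in \<open>auto simp: norm_mult intro!: mult_right_mono\<close>)
    finally show ?thesis by (simp add: C_def)
  qed
  show "integrable M (\<lambda>z. \<nu> z * (norm (\<integral>w. \<Phi> z w * H w \<partial>N))\<^sup>2)"
    unfolding S_def[symmetric]
  proof (rule Bochner_Integration.integrable_bound[where f="\<lambda>z. \<nu> z * C\<^sup>2"])
    show "AE z in M. norm (\<nu> z * (norm (S z))\<^sup>2) \<le> norm (\<nu> z * C\<^sup>2)"
      using Sb by (auto simp: abs_mult intro!: mult_left_mono power_mono)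
  qed (use \<nu> in auto)
  have nu: "integrable M (\<lambda>z. complex_of_real (\<nu> z))" using \<nu> by simp
  have cH: "integrable N (\<lambda>w. cnj (H w))" using H by simp
  have sq: "complex_of_real ((norm (S z))\<^sup>2) = cnj (S z) * S z" for z
    by (simp add: complex_norm_square[symmetric] mult.commute del: of_real_power)
  have "complex_of_real (\<integral>z. \<nu> z * (norm (S z))\<^sup>2 \<partial>M) = (\<integral>z. complex_of_real (\<nu> z * (norm (S z))\<^sup>2) \<partial>M)"
    by (simp only: integral_complex_of_real)
  also have "\<dots> = (\<integral>z. of_real (\<nu> z) * (\<integral>w. (cnj (S z) * \<Phi> z w) * H w \<partial>N) \<partial>M)"
    by (simp only: of_real_mult sq mult.assoc integral_mult_right_zero S_def[symmetric])
  also have "\<dots> = (\<integral>w. H w * (\<integral>z. (cnj (S z) * \<Phi> z w) * of_real (\<nu> z) \<partial>M) \<partial>N)"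
  proof (rule fubini_bounded[OF M N nu H])
    show "norm (cnj (S z) * \<Phi> z w) \<le> C * B" for z w
      using Sb[of z] B[of z w] C0 B0 by (auto simp: norm_mult intro!: mult_mono)
    show "(\<lambda>(z, w). cnj (S z) * \<Phi> z w) \<in> borel_measurable (M \<Otimes>\<^sub>M N)"
      unfolding case_prod_beta' by measurable
  qed
  also have "\<dots> = (\<integral>w. H w * (\<integral>w'. cnj (H w') * (\<integral>z. \<nu> z * \<Phi> z w * cnj (\<Phi> z w') \<partial>M) \<partial>N) \<partial>N)"
  proof (rule Bochner_Integration.integral_cong[OF refl])
    fix w assume w: "w \<in> space N"
    have "(\<integral>z. (cnj (S z) * \<Phi> z w) * of_real (\<nu> z) \<partial>M)
        = (\<integral>z. of_real (\<nu> z) * (\<integral>w'. (\<Phi> z w * cnj (\<Phi> z w')) * cnj (H w') \<partial>N) \<partial>M)"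
      by (simp add: S_def mult_ac flip: Bochner_Integration.integral_cnj integral_mult_right_zero)
    also have "\<dots> = (\<integral>w'. cnj (H w') * (\<integral>z. (\<Phi> z w * cnj (\<Phi> z w')) * of_real (\<nu> z) \<partial>M) \<partial>N)"
    proof (rule fubini_bounded[OF M N nu cH])
      show "norm (\<Phi> z w * cnj (\<Phi> z w')) \<le> B * B" for z w'
        using B[of z w] B[of z w'] B0 by (auto simp: norm_mult intro!: mult_mono)
      show "(\<lambda>(z, w'). \<Phi> z w * cnj (\<Phi> z w')) \<in> borel_measurable (M \<Otimes>\<^sub>M N)"
        unfolding case_prod_beta' by (intro borel_measurable_times borel_measurable_cnj K1 measurable_compose[OF measurable_fst Kz[OF w]])
    qed
    finally show "H w * (\<integral>z. (cnj (S z) * \<Phi> z w) * of_real (\<nu> z) \<partial>M)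
      = H w * (\<integral>w'. cnj (H w') * (\<integral>z. \<nu> z * \<Phi> z w * cnj (\<Phi> z w') \<partial>M) \<partial>N)"
      by (simp add: mult_ac)
  qed
  finally show "complex_of_real (\<integral>z. \<nu> z * (norm (\<integral>w. \<Phi> z w * H w \<partial>N))\<^sup>2 \<partial>M)
      = (\<integral>w. H w * (\<integral>w'. cnj (H w') * (\<integral>z. \<nu> z * \<Phi> z w * cnj (\<Phi> z w') \<partial>M) \<partial>N) \<partial>N)"
    unfolding S_def .
qed

text \<open>The proof integrates \<open>2uv \<le> l u\<^sup>2 + v\<^sup>2 / l\<close> and optimises \<open>l\<close>; enlarging \<open>A\<close> and \<open>B\<close> by \<open>e > 0\<close> keeps the optimal \<open>l\<close>
finite and positive.\<close>

lemma nn_integral_Cauchy_Schwarz: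
  fixes u v :: "'a \<Rightarrow> real"
  assumes [measurable]: "u \<in> borel_measurable M" "v \<in> borel_measurable M"
    and nn: "\<And>x. 0 \<le> u x" "\<And>x. 0 \<le> v x" "0 \<le> A" "0 \<le> B"
    and A: "(\<integral>\<^sup>+x. ennreal ((u x)\<^sup>2) \<partial>M) \<le> ennreal A"
    and B: "(\<integral>\<^sup>+x. ennreal ((v x)\<^sup>2) \<partial>M) \<le> ennreal B"
  shows "(\<integral>\<^sup>+x. ennreal (u x * v x) \<partial>M) \<le> ennreal (sqrt A * sqrt B)"
proof -
  have *: "(\<integral>\<^sup>+x. ennreal (u x * v x) \<partial>M) \<le> ennreal (sqrt (A + e) * sqrt (B + e))" if e: "0 < e" for e
  proof -
    define l where "l = sqrt (B + e) / sqrt (A + e)"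
    have l: "0 < l" using e nn by (simp add: l_def)
    have pw: "u x * v x \<le> (l * (u x)\<^sup>2 + (v x)\<^sup>2 / l) / 2" for x
    proof -
      have "0 \<le> (sqrt l * u x - v x / sqrt l)\<^sup>2" by simp
      also have "\<dots> = l * (u x)\<^sup>2 + (v x)\<^sup>2 / l - 2 * (u x * v x)"
        using l by (simp add: power2_diff power_mult_distrib power_divide)
      finally show ?thesis by simp
    qed
    have "(\<integral>\<^sup>+x. ennreal (u x * v x) \<partial>M) \<le> (\<integral>\<^sup>+x. ennreal (l / 2) * ennreal ((u x)\<^sup>2) + ennreal (1 / (2 * l)) * ennreal ((v x)\<^sup>2) \<partial>M)"
    proof (rule nn_integral_mono)
      fix x
      have "ennreal (l / 2) * ennreal ((u x)\<^sup>2) + ennreal (1 / (2 * l)) * ennreal ((v x)\<^sup>2) = ennreal ((l * (u x)\<^sup>2 + (v x)\<^sup>2 / l) / 2)"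
        using l by (simp add: ennreal_mult[symmetric] ennreal_plus[symmetric] field_simps del: ennreal_plus)
      then show "ennreal (u x * v x) \<le> ennreal (l / 2) * ennreal ((u x)\<^sup>2) + ennreal (1 / (2 * l)) * ennreal ((v x)\<^sup>2)"
        using pw[of x] by (simp add: ennreal_leI)
    qed
    also have "\<dots> = ennreal (l / 2) * (\<integral>\<^sup>+x. ennreal ((u x)\<^sup>2) \<partial>M) + ennreal (1 / (2 * l)) * (\<integral>\<^sup>+x. ennreal ((v x)\<^sup>2) \<partial>M)"
      by (simp add: nn_integral_add nn_integral_cmult)
    also have "\<dots> \<le> ennreal (l / 2) * ennreal (A + e) + ennreal (1 / (2 * l)) * ennreal (B + e)"
      using A B e nn by (intro add_mono mult_left_mono) (auto intro: order_trans ennreal_leI)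
    also have "\<dots> = ennreal (l * (A + e) / 2 + (B + e) / (2 * l))"
      using l e nn by (simp add: ennreal_mult[symmetric] ennreal_plus[symmetric] del: ennreal_plus)
    also have "l * (A + e) / 2 + (B + e) / (2 * l) = sqrt (A + e) * sqrt (B + e)"
    proof -
      define p q where "p = sqrt (A + e)" and "q = sqrt (B + e)"
      have pq: "p > 0" "q > 0" "A + e = p * p" "B + e = q * q" using e nn by (auto simp: p_def q_def)
      show ?thesis unfolding l_def p_def[symmetric] q_def[symmetric] pq(3,4) using pq(1,2) by (simp add: field_simps)
    qed
    finally show ?thesis .
  qed
  have lim: "((\<lambda>e. ennreal (sqrt (A + e) * sqrt (B + e))) \<longlongrightarrow> ennreal (sqrt (A + 0) * sqrt (B + 0))) (at_right 0)"
    by (intro tendsto_ennrealI tendsto_intros)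
  show ?thesis
    using tendsto_lowerbound[OF lim, of "\<integral>\<^sup>+x. ennreal (u x * v x) \<partial>M"] *
    by (auto simp: eventually_at_filter)
qed

text \<open>With the weight \<open>exp (- e |\<eta>|\<^sup>2)\<close> the left side is, by the Gram identity, a quadratic form whose kernel is a Gaussian of
total mass \<open>(2\<pi>)\<^sup>d\<close> for every \<open>e\<close>, so Schur's test bounds it uniformly; the weight is then removed with Fatou's lemma.\<close>

lemma fourier_bessel_inequality:
  fixes h :: "'a::euclidean_space \<Rightarrow> complex"
  assumes h: "integrable lborel h" and h2: "square_integrable h"
  shows "(\<integral>\<^sup>+\<eta>. ennreal ((norm (\<integral>y. cis (- (\<eta> \<bullet> y)) * h y \<partial>lborel))\<^sup>2) \<partial>lborel)
    \<le> ennreal ((2 * pi) ^ DIM('a) * (\<integral>y. (norm (h y))\<^sup>2 \<partial>lborel))"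
proof -
  define F where "F \<eta> = (\<integral>y. cis (- (\<eta> \<bullet> y)) * h y \<partial>lborel)" for \<eta>
  define D where "D = (2 * pi) ^ DIM('a) * (\<integral>y. (norm (h y))\<^sup>2 \<partial>lborel)"
  have [measurable]: "h \<in> borel_measurable borel" using borel_measurable_integrable[OF h] by simp
  have Fm [measurable]: "F \<in> borel_measurable borel"
  proof -
    have "F \<in> borel_measurable lborel"
      unfolding F_def by (rule lborel.borel_measurable_lebesgue_integral) measurable
    then show ?thesis by simp
  qed
  have eps: "(\<integral>\<^sup>+\<eta>. ennreal (gaussian e \<eta> * (norm (F \<eta>))\<^sup>2) \<partial>lborel) \<le> ennreal D" if e: "0 < e" for e
  proof -
    define G where "G y y' = gaussian (1 / (4 * e)) (y' - y)" for y y' :: 'a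
    define c where "c = sqrt (pi / e) ^ DIM('a)"
    have c0: "0 \<le> c" using e by (simp add: c_def)
    have [measurable]: "(\<lambda>p. G (fst p) (snd p)) \<in> borel_measurable borel" "\<And>y. G y \<in> borel_measurable borel"
       "\<And>y'. (\<lambda>y. G y y') \<in> borel_measurable borel"
      unfolding G_def by measurable
    have g1: "integrable lborel (\<lambda>\<eta>::'a. gaussian e \<eta>)"
      using gauss_integral(1)[OF e, of "0::'a"] by simp
    have meas: "(\<lambda>(z, w). cis (- (z \<bullet> w))) \<in> borel_measurable (lborel \<Otimes>\<^sub>M (lborel :: 'a measure))"
      by measurable
    note gr = gram_identity[OF sigma_finite_lborel sigma_finite_lborel g1 h meas, of 1, simplified, folded F_def]
    have R: "(\<integral>z. exp (- (e * (norm z)\<^sup>2)) * cis (- (z \<bullet> y)) * cnj (cis (- (z \<bullet> y'))) \<partial>lborel) = of_real (c * G y y')" for y y' :: 'a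
    proof -
      have "(\<integral>z. exp (- (e * (norm z)\<^sup>2)) * cis (- (z \<bullet> y)) * cnj (cis (- (z \<bullet> y'))) \<partial>lborel)
         = (\<integral>z. of_real (gaussian e z) * cis ((y' - y) \<bullet> z) \<partial>lborel)"
        by (intro Bochner_Integration.integral_cong) (auto simp: cis_cnj mult.assoc cis_mult inner_commute inner_diff_right)
      also have "\<dots> = of_real (c * G y y')"
        using gauss_FT[OF e, of "y' - y"] by (simp add: has_bochner_integral_iff c_def G_def)
      finally show ?thesis .
    qed
    have GI: "(\<integral>y'. G y y' \<partial>lborel) = sqrt (4 * pi * e) ^ DIM('a)" "integrable lborel (G y)" for y
      using gauss_integral[of "1 / (4 * e)" y] e by (auto simp: G_def[abs_def] mult_ac)
    have Gs: "G y y' = G y' y" for y y' by (simp add: G_def norm_minus_commute)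
    define L where "L = (\<integral>y. (norm (h y))\<^sup>2 \<partial>lborel)"
    have Gb: "\<bar>G y y'\<bar> \<le> 1" "0 \<le> G y y'" for y y' using e by (auto simp: G_def)
    have int2: "(\<integral>\<^sup>+p. ennreal (G (fst p) (snd p) * (norm (h (fst p)))\<^sup>2) \<partial>lborel) = ennreal (sqrt (4 * pi * e) ^ DIM('a) * L)"
    proof -
      have "(\<integral>\<^sup>+p. ennreal (G (fst p) (snd p) * (norm (h (fst p)))\<^sup>2) \<partial>lborel)
         = (\<integral>\<^sup>+y. \<integral>\<^sup>+y'. ennreal (G y y') * ennreal ((norm (h y))\<^sup>2) \<partial>lborel \<partial>lborel)"
        by (subst lborel_prod_nn_integral) (auto simp: ennreal_mult'' Gb)
      also have "\<dots> = (\<integral>\<^sup>+y. ennreal (sqrt (4 * pi * e) ^ DIM('a)) * ennreal ((norm (h y))\<^sup>2) \<partial>lborel)"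
        by (intro nn_integral_cong, subst nn_integral_multc)
          (auto simp: nn_integral_eq_integral[OF GI(2)] Gb GI(1))
      also have "\<dots> = ennreal (sqrt (4 * pi * e) ^ DIM('a) * L)"
        using h2 e by (subst nn_integral_cmult) (auto simp: nn_integral_eq_integral L_def ennreal_mult)
      finally show ?thesis .
    qed
    have L0: "0 \<le> L" by (simp add: L_def)
    have int2': "integrable lborel (\<lambda>p. G (fst p) (snd p) * (norm (h (fst p)))\<^sup>2)"
       "(\<integral>p. G (fst p) (snd p) * (norm (h (fst p)))\<^sup>2 \<partial>lborel) = sqrt (4 * pi * e) ^ DIM('a) * L"
      using int2 L0 e Gb by (auto intro!: integrableI_nonneg simp: integral_eq_nn_integral)
    have int3: "(\<integral>\<^sup>+p. ennreal (G (fst p) (snd p) * (norm (h (snd p)))\<^sup>2) \<partial>lborel) = ennreal (sqrt (4 * pi * e) ^ DIM('a) * L)"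
    proof -
      have "(\<integral>\<^sup>+p. ennreal (G (fst p) (snd p) * (norm (h (snd p)))\<^sup>2) \<partial>lborel)
         = (\<integral>\<^sup>+y. \<integral>\<^sup>+y'. ennreal (G y y' * (norm (h y'))\<^sup>2) \<partial>lborel \<partial>lborel)"
        by (subst lborel_prod_nn_integral) auto
      also have "\<dots> = (\<integral>\<^sup>+y'. \<integral>\<^sup>+y. ennreal (G y y' * (norm (h y'))\<^sup>2) \<partial>lborel \<partial>lborel)"
        by (rule lborel_pair.Fubini'[symmetric]) (unfold G_def, measurable)
      also have "\<dots> = (\<integral>\<^sup>+y'. \<integral>\<^sup>+y. ennreal (G y' y * (norm (h y'))\<^sup>2) \<partial>lborel \<partial>lborel)"
        by (intro nn_integral_cong, subst Gs, rule refl)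
      also have "\<dots> = (\<integral>\<^sup>+p. ennreal (G (fst p) (snd p) * (norm (h (fst p)))\<^sup>2) \<partial>lborel)"
        by (subst lborel_prod_nn_integral) auto
      finally show ?thesis using int2 by simp
    qed
    have int3': "integrable lborel (\<lambda>p. G (fst p) (snd p) * (norm (h (snd p)))\<^sup>2)"
       "(\<integral>p. G (fst p) (snd p) * (norm (h (snd p)))\<^sup>2 \<partial>lborel) = sqrt (4 * pi * e) ^ DIM('a) * L"
      using int3 L0 e Gb by (auto intro!: integrableI_nonneg simp: integral_eq_nn_integral)
    have Hint: "integrable lborel (\<lambda>p. of_real (G (fst p) (snd p)) * (h (fst p) * cnj (h (snd p))))"
      using integrable_pair_bounded[OF sigma_finite_lborel sigma_finite_lborel h, of "\<lambda>y. cnj (h y)" "\<lambda>x y. of_real (G x y)" 1] h Gb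
      by (simp add: case_prod_beta' lborel_prod)
    have "complex_of_real (\<integral>\<eta>. exp (- (e * (norm \<eta>)\<^sup>2)) * (norm (F \<eta>))\<^sup>2 \<partial>lborel)
       = (\<integral>y. h y * (\<integral>y'. cnj (h y') * of_real (c * G y y') \<partial>lborel) \<partial>lborel)"
      using gr(2) by (simp add: R)
    also have "\<dots> = of_real c * (\<integral>y. (\<integral>y'. of_real (G y y') * (h y * cnj (h y')) \<partial>lborel) \<partial>lborel)"
      by (simp add: mult_ac flip: integral_mult_right_zero)
    also have "\<dots> = of_real c * (\<integral>p. of_real (G (fst p) (snd p)) * (h (fst p) * cnj (h (snd p))) \<partial>lborel)"
      by (subst lborel_prod_integral[OF Hint]) simp
    finally have eq: "complex_of_real (\<integral>\<eta>. exp (- (e * (norm \<eta>)\<^sup>2)) * (norm (F \<eta>))\<^sup>2 \<partial>lborel) = of_real c * (\<integral>p. of_real (G (fst p) (snd p)) * (h (fst p) * cnj (h (snd p))) \<partial>lborel)" .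
    have "(\<integral>\<eta>. exp (- (e * (norm \<eta>)\<^sup>2)) * (norm (F \<eta>))\<^sup>2 \<partial>lborel) \<le> norm (complex_of_real (\<integral>\<eta>. exp (- (e * (norm \<eta>)\<^sup>2)) * (norm (F \<eta>))\<^sup>2 \<partial>lborel))"
      by simp
    also have "\<dots> \<le> c * (\<integral>p. norm (of_real (G (fst p) (snd p)) * (h (fst p) * cnj (h (snd p)))) \<partial>lborel)"
      unfolding eq norm_mult[of "of_real c"] using c0 by (auto intro!: mult_left_mono integral_norm_bound)
    also have "\<dots> \<le> c * (\<integral>p. (G (fst p) (snd p) * (norm (h (fst p)))\<^sup>2 + G (fst p) (snd p) * (norm (h (snd p)))\<^sup>2) / 2 \<partial>lborel)"
    proof (intro mult_left_mono integral_mono)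
      fix p
      have "norm (h (fst p)) * norm (h (snd p)) \<le> ((norm (h (fst p)))\<^sup>2 + (norm (h (snd p)))\<^sup>2) / 2"
        using sum_squares_bound[of "norm (h (fst p))" "norm (h (snd p))"] by simp
      from mult_left_mono[OF this Gb(2)[of "fst p" "snd p"]]
      show "norm (of_real (G (fst p) (snd p)) * (h (fst p) * cnj (h (snd p)))) \<le> (G (fst p) (snd p) * (norm (h (fst p)))\<^sup>2 + G (fst p) (snd p) * (norm (h (snd p)))\<^sup>2) / 2"
        by (simp add: norm_mult Gb algebra_simps)
    qed (use Hint int2' int3' c0 in auto)
    also have "\<dots> = c * (sqrt (4 * pi * e) ^ DIM('a) * L)"
      using int2' int3' by simp
    also have "\<dots> = D"
    proof -
      have "sqrt (pi / e) * sqrt (4 * pi * e) = sqrt ((2 * pi)\<^sup>2)"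
        using e unfolding real_sqrt_mult[symmetric] by (simp add: power2_eq_square)
      then have "sqrt (pi / e) * sqrt (4 * pi * e) = 2 * pi" by (simp only: real_sqrt_abs) simp
      then have "sqrt (pi / e) ^ DIM('a) * sqrt (4 * pi * e) ^ DIM('a) = (2 * pi) ^ DIM('a)"
        by (simp only: power_mult_distrib[symmetric])
      then show ?thesis unfolding c_def D_def L_def[symmetric] mult.assoc[symmetric] by simp
    qed
    finally have le: "(\<integral>\<eta>. gaussian e \<eta> * (norm (F \<eta>))\<^sup>2 \<partial>lborel) \<le> D" by simp
    have "(\<integral>\<^sup>+\<eta>. ennreal (gaussian e \<eta> * (norm (F \<eta>))\<^sup>2) \<partial>lborel) = ennreal (\<integral>\<eta>. gaussian e \<eta> * (norm (F \<eta>))\<^sup>2 \<partial>lborel)"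
      using gr(1) by (intro nn_integral_eq_integral) auto
    with le show ?thesis by (simp add: ennreal_leI)
  qed
  define u where "u n \<eta> = ennreal (gaussian (1 / real (Suc n)) \<eta> * (norm (F \<eta>))\<^sup>2)" for n and \<eta> :: 'a
  have lim: "(\<lambda>n. u n \<eta>) \<longlonglongrightarrow> ennreal ((norm (F \<eta>))\<^sup>2)" for \<eta>
  proof -
    have "(\<lambda>n. ennreal (gaussian (1 / real (Suc n)) \<eta> * (norm (F \<eta>))\<^sup>2)) \<longlonglongrightarrow> ennreal (gaussian 0 \<eta> * (norm (F \<eta>))\<^sup>2)"
      by (intro tendsto_ennrealI tendsto_intros LIMSEQ_Suc[OF lim_1_over_n])
    then show ?thesis by (simp add: u_def)
  qed
  have "(\<integral>\<^sup>+\<eta>. ennreal ((norm (F \<eta>))\<^sup>2) \<partial>lborel) = (\<integral>\<^sup>+\<eta>. liminf (\<lambda>n. u n \<eta>) \<partial>lborel)"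
    by (intro nn_integral_cong lim_imp_Liminf[symmetric] lim) simp
  also have "\<dots> \<le> liminf (\<lambda>n. \<integral>\<^sup>+\<eta>. u n \<eta> \<partial>lborel)"
    by (rule nn_integral_liminf) (simp add: u_def)
  also have "\<dots> \<le> liminf (\<lambda>n. ennreal D)"
    by (intro Liminf_mono always_eventually allI) (unfold u_def, rule eps, simp)
  finally show ?thesis by (simp add: F_def D_def Liminf_const)
qed

section \<open>Short-time Fourier and Husimi transforms\<close>

text \<open>The analysing window \<open>exp (- 2\<rho> |y - s|\<^sup>2)\<close> is the one that appears when \<open>exp (- \<rho> |x - y|\<^sup>2)\<close>, the effect of
mollifying in \<open>\<xi>\<close>, is split between the two arguments \<open>x\<close> and \<open>y\<close>.\<close>

definition stft :: "real \<Rightarrow> ('a::euclidean_space \<Rightarrow> complex) \<Rightarrow> 'a \<Rightarrow> 'a \<Rightarrow> complex" where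
  "stft \<rho> f s \<eta> = (\<integral>y. cis (- (\<eta> \<bullet> y)) * (of_real (gaussian (2 * \<rho>) (y - s)) * f y) \<partial>lborel)"

text \<open>The expectation in \<open>f\<close> of a Gaussian (thermal) state centred at the phase space point \<open>(s, \<sigma>)\<close>. The definition as an average of
squares makes its positivity evident; \<open>husimi_kernel\<close> is, up to a constant factor, the integral
kernel of this quadratic form.\<close>

definition husimi :: "real \<Rightarrow> real \<Rightarrow> ('a::euclidean_space \<Rightarrow> complex) \<Rightarrow> 'a \<Rightarrow> 'a \<Rightarrow> real" where
  "husimi \<rho> \<gamma> f s \<sigma> = (\<integral>\<eta>. gaussian (1 / (4 * \<gamma>)) \<eta> * (norm (stft \<rho> f s (\<eta> + \<sigma>)))\<^sup>2 \<partial>lborel)"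

definition husimi_kernel :: "real \<Rightarrow> real \<Rightarrow> 'a::euclidean_space \<Rightarrow> 'a \<Rightarrow> 'a \<Rightarrow> 'a \<Rightarrow> complex" where
  "husimi_kernel \<rho> \<gamma> s \<sigma> y y' =
     of_real (exp (- (2 * \<rho>) * (norm (y - s))\<^sup>2 - 2 * \<rho> * (norm (y' - s))\<^sup>2 - \<gamma> * (norm (y - y'))\<^sup>2))
       * cis (- (\<sigma> \<bullet> (y - y')))"

lemma husimi_nonneg: "0 \<le> husimi \<rho> \<gamma> f s \<sigma>"
  unfolding husimi_def by (intro integral_nonneg_AE) auto

lemma norm_husimi_kernel_le:
  assumes "0 \<le> \<rho>" "0 \<le> \<gamma>"
  shows "norm (husimi_kernel \<rho> \<gamma> s \<sigma> y y') \<le> 1"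
proof -
  have "0 \<le> \<rho> * (norm (y - s))\<^sup>2" "0 \<le> \<rho> * (norm (y' - s))\<^sup>2" "0 \<le> \<gamma> * (norm (y - y'))\<^sup>2"
    using assms by auto
  then have "- (2 * \<rho>) * (norm (y - s))\<^sup>2 - 2 * \<rho> * (norm (y' - s))\<^sup>2 - \<gamma> * (norm (y - y'))\<^sup>2 \<le> 0"
    by (simp only: mult_minus_left mult.assoc)
  then show ?thesis unfolding husimi_kernel_def norm_mult norm_cis norm_of_real by simp
qed

lemma husimi_kernel_measurable [measurable]:
  "(\<lambda>y. husimi_kernel \<rho> \<gamma> s \<sigma> y y') \<in> borel_measurable borel"
  "(\<lambda>y'. husimi_kernel \<rho> \<gamma> s \<sigma> y y') \<in> borel_measurable borel"
  "(\<lambda>p. husimi_kernel \<rho> \<gamma> s \<sigma> (fst p) (snd p)) \<in> borel_measurable borel"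
  unfolding husimi_kernel_def by measurable

lemma stft_measurable:
  assumes [measurable]: "f \<in> borel_measurable borel"
  shows "(\<lambda>p. stft \<rho> f (fst p) (snd p)) \<in> borel_measurable borel"
proof -
  have "(\<lambda>p::'a\<times>'a. stft \<rho> f (fst p) (snd p)) \<in> borel_measurable lborel"
    unfolding stft_def by (rule lborel.borel_measurable_lebesgue_integral) measurable
  then show ?thesis by simp
qed

text \<open>The Gram identity applied to the Fourier transform: a Gaussian of \<open>y - y'\<close> is the Fourier transform of a positive
Gaussian.\<close>

lemma husimi_gram:
  fixes f :: "'a::euclidean_space \<Rightarrow> complex"
  assumes \<rho>: "0 < \<rho>" and \<gamma>: "0 < \<gamma>" and f: "integrable lborel f"
  shows "integrable lborel (\<lambda>\<eta>. gaussian (1 / (4 * \<gamma>)) \<eta> * (norm (stft \<rho> f s (\<eta> + \<sigma>)))\<^sup>2)"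
    and "complex_of_real (husimi \<rho> \<gamma> f s \<sigma>) = of_real (sqrt (4 * pi * \<gamma>) ^ DIM('a))
      * (\<integral>y. f y * (\<integral>y'. cnj (f y') * husimi_kernel \<rho> \<gamma> s \<sigma> y y' \<partial>lborel) \<partial>lborel)"
proof -
  define \<Phi> :: "'a \<Rightarrow> 'a \<Rightarrow> complex" where "\<Phi> \<eta> y = cis (- ((\<eta> + \<sigma>) \<bullet> y)) * of_real (gaussian (2 * \<rho>) (y - s))" for \<eta> y
  have a: "0 < 1 / (4 * \<gamma>)" using \<gamma> by simp
  have nu: "integrable lborel (\<lambda>\<eta>::'a. gaussian (1 / (4 * \<gamma>)) \<eta>)"
    using gauss_integral(1)[OF a, of "0::'a"] by simp
  have m: "(\<lambda>(z, w). \<Phi> z w) \<in> borel_measurable (lborel \<Otimes>\<^sub>M lborel)"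
    unfolding \<Phi>_def by measurable
  have b: "norm (\<Phi> z w) \<le> 1" for z w
    using \<rho> by (auto simp: \<Phi>_def norm_mult)
  note g = gram_identity[OF sigma_finite_lborel sigma_finite_lborel nu f m b]
  have st: "(\<integral>w. \<Phi> \<eta> w * f w \<partial>lborel) = stft \<rho> f s (\<eta> + \<sigma>)" for \<eta>
    by (simp add: stft_def \<Phi>_def mult.assoc)
  show "integrable lborel (\<lambda>\<eta>. gaussian (1 / (4 * \<gamma>)) \<eta> * (norm (stft \<rho> f s (\<eta> + \<sigma>)))\<^sup>2)"
    using g(1) unfolding st .
  define c where "c = sqrt (4 * pi * \<gamma>) ^ DIM('a)"
  have R: "(\<integral>z. of_real (gaussian (1 / (4 * \<gamma>)) z) * \<Phi> z w * cnj (\<Phi> z w') \<partial>lborel) = of_real c * husimi_kernel \<rho> \<gamma> s \<sigma> w w'" for w w'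
  proof -
    define K where "K = cis (- (\<sigma> \<bullet> (w - w'))) * of_real (gaussian (2 * \<rho>) (w - s) * gaussian (2 * \<rho>) (w' - s))"
    have pt: "of_real (gaussian (1 / (4 * \<gamma>)) z) * \<Phi> z w * cnj (\<Phi> z w') = K * (of_real (gaussian (1 / (4 * \<gamma>)) z) * cis ((w' - w) \<bullet> z))" for z
    proof -
      have "cis (- ((z + \<sigma>) \<bullet> w)) * cis ((z + \<sigma>) \<bullet> w') = cis (- (\<sigma> \<bullet> (w - w'))) * cis ((w' - w) \<bullet> z)"
        by (simp add: cis_mult algebra_simps inner_commute)
      then show ?thesis
        unfolding \<Phi>_def K_def complex_cnj_mult cis_cnj complex_cnj_complex_of_real minus_minus of_real_mult
        by algebra
    qed
    have "(\<integral>z. of_real (gaussian (1 / (4 * \<gamma>)) z) * \<Phi> z w * cnj (\<Phi> z w') \<partial>lborel)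
      = K * of_real (sqrt (pi / (1 / (4 * \<gamma>))) ^ DIM('a) * exp (- (norm (w' - w))\<^sup>2 / (4 * (1 / (4 * \<gamma>)))))"
      by (simp only: pt integral_mult_right_zero gauss_FT[OF a, of "w' - w", unfolded has_bochner_integral_iff, THEN conjunct2])
    also have "\<dots> = of_real c * husimi_kernel \<rho> \<gamma> s \<sigma> w w'"
    proof -
      have e: "exp (- (2 * \<rho>) * (norm (w - s))\<^sup>2 - 2 * \<rho> * (norm (w' - s))\<^sup>2 - \<gamma> * (norm (w - w'))\<^sup>2)
         = gaussian (2 * \<rho>) (w - s) * gaussian (2 * \<rho>) (w' - s) * exp (- (norm (w' - w))\<^sup>2 / (4 * (1 / (4 * \<gamma>))))"
        using \<gamma> by (simp add: exp_add[symmetric] norm_minus_commute mult.commute del: of_real_exp)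
      have e2: "sqrt (pi / (1 / (4 * \<gamma>))) ^ DIM('a) = c" by (simp add: c_def mult_ac)
      show ?thesis unfolding husimi_kernel_def K_def e e2 of_real_mult by algebra
    qed
    finally show ?thesis .
  qed
  have "complex_of_real (husimi \<rho> \<gamma> f s \<sigma>) = (\<integral>w. f w * (\<integral>w'. cnj (f w') * (of_real c * husimi_kernel \<rho> \<gamma> s \<sigma> w w') \<partial>lborel) \<partial>lborel)"
    using g(2) unfolding st husimi_def R .
  also have "\<dots> = of_real c * (\<integral>y. f y * (\<integral>y'. cnj (f y') * husimi_kernel \<rho> \<gamma> s \<sigma> y y' \<partial>lborel) \<partial>lborel)"
    by (simp add: mult_ac flip: integral_mult_right_zero)
  finally show "complex_of_real (husimi \<rho> \<gamma> f s \<sigma>) = of_real (sqrt (4 * pi * \<gamma>) ^ DIM('a))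
      * (\<integral>y. f y * (\<integral>y'. cnj (f y') * husimi_kernel \<rho> \<gamma> s \<sigma> y y' \<partial>lborel) \<partial>lborel)"
    unfolding c_def .
qed

lemma husimi_measurable:
  fixes f :: "'a::euclidean_space \<Rightarrow> complex"
  assumes [measurable]: "f \<in> borel_measurable borel"
  shows "(\<lambda>p. husimi \<rho> \<gamma> f (fst p) (snd p)) \<in> borel_measurable borel"
proof -
  note stft_measurable[OF assms, measurable]
  have [measurable]: "(\<lambda>q::('a \<times> 'a) \<times> 'a. stft \<rho> f (fst (fst q)) (snd q + snd (fst q))) \<in> borel_measurable (lborel \<Otimes>\<^sub>M lborel)"
  proof -
    have 1: "(\<lambda>q::('a \<times> 'a) \<times> 'a. (fst (fst q), snd q + snd (fst q))) \<in> borel_measurable borel"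
      by (intro borel_measurable_continuous_onI continuous_intros)
    have "(\<lambda>q::('a \<times> 'a) \<times> 'a. stft \<rho> f (fst (fst q)) (snd q + snd (fst q))) \<in> borel_measurable borel"
      using measurable_compose[OF 1 stft_measurable[OF assms]] by simp
    then show ?thesis by (simp add: lborel_prod)
  qed
  have "(\<lambda>p::'a\<times>'a. husimi \<rho> \<gamma> f (fst p) (snd p)) \<in> borel_measurable lborel"
    unfolding husimi_def
    by (rule lborel.borel_measurable_lebesgue_integral) (unfold case_prod_beta', measurable)
  then show ?thesis by simp
qed

text \<open>Integrating over \<open>\<sigma>\<close> decouples the averaging Gaussian from the transform, Bessel's inequality removes the transform,
and the integral over \<open>s\<close> of the squared analysing window is a constant.\<close>

lemma husimi_total:
  fixes f :: "'a::euclidean_space \<Rightarrow> complex"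
  assumes \<rho>: "0 < \<rho>" and \<gamma>: "0 < \<gamma>" and f: "integrable lborel f" and f2: "square_integrable f"
  shows "(\<integral>\<^sup>+p. ennreal (husimi \<rho> \<gamma> f (fst p) (snd p)) \<partial>lborel)
    \<le> ennreal (sqrt (4 * pi * \<gamma>) ^ DIM('a) * ((2 * pi) ^ DIM('a) * (sqrt (pi / (4 * \<rho>)) ^ DIM('a) * (\<integral>x. (norm (f x))\<^sup>2 \<partial>lborel))))"
proof -
  have fm [measurable]: "f \<in> borel_measurable borel" using borel_measurable_integrable[OF f] by simp
  define c where "c = sqrt (4 * pi * \<gamma>) ^ DIM('a)"
  have c0: "0 \<le> c" using \<gamma> by (simp add: c_def)
  have a: "0 < 1 / (4 * \<gamma>)" using \<gamma> by simp
  note stm = stft_measurable[OF fm, of \<rho>]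
  have stm1 [measurable]: "(\<lambda>\<eta>. stft \<rho> f s \<eta>) \<in> borel_measurable borel" for s
    using measurable_compose[OF _ stm, of "\<lambda>\<eta>. (s, \<eta>)" borel] by simp
  have stm2 [measurable]: "(\<lambda>p. stft \<rho> f s (fst p + snd p)) \<in> borel_measurable borel" for s
    using measurable_compose[OF _ stm1, of "\<lambda>p. fst p + snd p" borel s] by measurable
  have row: "(\<integral>\<^sup>+\<sigma>. ennreal (husimi \<rho> \<gamma> f s \<sigma>) \<partial>lborel)
     \<le> ennreal c * (ennreal ((2 * pi) ^ DIM('a)) * (\<integral>\<^sup>+y. ennreal (gaussian (4 * \<rho>) (y - s)) * ennreal ((norm (f y))\<^sup>2) \<partial>lborel))" for s
  proof -
    have "(\<integral>\<^sup>+\<sigma>. ennreal (husimi \<rho> \<gamma> f s \<sigma>) \<partial>lborel)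
       = (\<integral>\<^sup>+\<sigma>. \<integral>\<^sup>+\<eta>. ennreal (gaussian (1 / (4 * \<gamma>)) \<eta>) * ennreal ((norm (stft \<rho> f s (\<eta> + \<sigma>)))\<^sup>2) \<partial>lborel \<partial>lborel)"
      unfolding husimi_def
      by (intro nn_integral_cong, subst nn_integral_eq_integral[symmetric, OF husimi_gram(1)[OF \<rho> \<gamma> f]])
        (auto simp: ennreal_mult)
    also have "\<dots> = (\<integral>\<^sup>+\<eta>. \<integral>\<^sup>+\<sigma>. ennreal (gaussian (1 / (4 * \<gamma>)) \<eta>) * ennreal ((norm (stft \<rho> f s (\<eta> + \<sigma>)))\<^sup>2) \<partial>lborel \<partial>lborel)"
    proof (rule lborel_pair.Fubini')
      have "(\<lambda>p. ennreal (gaussian (1 / (4 * \<gamma>)) (fst p)) * ennreal ((norm (stft \<rho> f s (fst p + snd p)))\<^sup>2)) \<in> borel_measurable borel"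
        by measurable
      then show "(\<lambda>(\<eta>, \<sigma>). ennreal (gaussian (1 / (4 * \<gamma>)) \<eta>) * ennreal ((norm (stft \<rho> f s (\<eta> + \<sigma>)))\<^sup>2)) \<in> borel_measurable (lborel \<Otimes>\<^sub>M lborel)"
        by (simp add: lborel_prod case_prod_beta')
    qed
    also have "\<dots> = (\<integral>\<^sup>+\<eta>. ennreal (gaussian (1 / (4 * \<gamma>)) (\<eta>::'a)) * (\<integral>\<^sup>+\<sigma>. ennreal ((norm (stft \<rho> f s \<sigma>))\<^sup>2) \<partial>lborel) \<partial>lborel)"
      by (intro nn_integral_cong, subst nn_integral_cmult, simp,
          subst lborel_nn_integral_translate[of "\<lambda>\<sigma>. ennreal ((norm (stft \<rho> f s \<sigma>))\<^sup>2)"]) auto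
    also have "\<dots> = (\<integral>\<^sup>+\<eta>. ennreal (gaussian (1 / (4 * \<gamma>)) (\<eta>::'a)) \<partial>lborel) * (\<integral>\<^sup>+\<sigma>. ennreal ((norm (stft \<rho> f s \<sigma>))\<^sup>2) \<partial>lborel)"
      by (rule nn_integral_multc) measurable
    also have "(\<integral>\<^sup>+\<eta>. ennreal (gaussian (1 / (4 * \<gamma>)) (\<eta>::'a)) \<partial>lborel) = ennreal c"
      using gauss_integral(3)[OF a, of "0::'a"] by (simp add: c_def mult_ac)
    also have "(\<integral>\<^sup>+\<sigma>. ennreal ((norm (stft \<rho> f s \<sigma>))\<^sup>2) \<partial>lborel)
        \<le> ennreal ((2 * pi) ^ DIM('a) * (\<integral>y. (norm (of_real (gaussian (2 * \<rho>) (y - s)) * f y))\<^sup>2 \<partial>lborel))"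
      unfolding stft_def
    proof (rule fourier_bessel_inequality)
      show "complex_integrable lborel (\<lambda>y. complex_of_real (gaussian (2 * \<rho>) (y - s)) * f y)"
        by (rule Bochner_Integration.integrable_bound[OF f]) (use \<rho> in \<open>auto simp: norm_mult mult_left_le_one_le\<close>)
      show "integrable lborel (\<lambda>y. (cmod (complex_of_real (gaussian (2 * \<rho>) (y - s)) * f y))\<^sup>2)"
        by (rule Bochner_Integration.integrable_bound[OF f2]) (use \<rho> in \<open>auto simp: norm_mult power_mult_distrib mult_left_le_one_le power_le_one\<close>)
    qed
    also have "\<dots> = ennreal ((2 * pi) ^ DIM('a)) * (\<integral>\<^sup>+y. ennreal (gaussian (4 * \<rho>) (y - s)) * ennreal ((norm (f y))\<^sup>2) \<partial>lborel)"
    proof -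
      have eq: "(norm (of_real (gaussian (2 * \<rho>) (y - s)) * f y))\<^sup>2 = gaussian (4 * \<rho>) (y - s) * (norm (f y))\<^sup>2" for y
        by (simp add: norm_mult power_mult_distrib exp_double[symmetric] del: of_real_exp)
      have i: "integrable lborel (\<lambda>y. gaussian (4 * \<rho>) (y - s) * (norm (f y))\<^sup>2)"
        by (rule Bochner_Integration.integrable_bound[OF f2]) (use \<rho> in \<open>auto simp: norm_mult mult_left_le_one_le\<close>)
      have "(\<integral>\<^sup>+y. ennreal (gaussian (4 * \<rho>) (y - s)) * ennreal ((norm (f y))\<^sup>2) \<partial>lborel) = ennreal (\<integral>y. gaussian (4 * \<rho>) (y - s) * (norm (f y))\<^sup>2 \<partial>lborel)"
        by (subst nn_integral_eq_integral[OF i, symmetric]) (auto simp: ennreal_mult)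
      then show ?thesis unfolding eq by (simp add: ennreal_mult)
    qed
    finally show ?thesis by (simp add: mult_left_mono)
  qed
  have "(\<integral>\<^sup>+p. ennreal (husimi \<rho> \<gamma> f (fst p) (snd p)) \<partial>lborel) = (\<integral>\<^sup>+s. \<integral>\<^sup>+\<sigma>. ennreal (husimi \<rho> \<gamma> f s \<sigma>) \<partial>lborel \<partial>lborel)"
    using husimi_measurable[OF fm] by (subst lborel_prod_nn_integral) auto
  also have "\<dots> \<le> (\<integral>\<^sup>+s. ennreal c * (ennreal ((2 * pi) ^ DIM('a)) * (\<integral>\<^sup>+y. ennreal (gaussian (4 * \<rho>) (y - s)) * ennreal ((norm (f y))\<^sup>2) \<partial>lborel)) \<partial>lborel)"
    by (intro nn_integral_mono row)
  also have "\<dots> = ennreal c * (ennreal ((2 * pi) ^ DIM('a)) * (\<integral>\<^sup>+s. \<integral>\<^sup>+y. ennreal (gaussian (4 * \<rho>) (y - s)) * ennreal ((norm (f y))\<^sup>2) \<partial>lborel \<partial>lborel))"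
    by (subst nn_integral_cmult, measurable, subst nn_integral_cmult, measurable)
  also have "(\<integral>\<^sup>+s. \<integral>\<^sup>+y. ennreal (gaussian (4 * \<rho>) (y - s)) * ennreal ((norm (f y))\<^sup>2) \<partial>lborel \<partial>lborel)
     = (\<integral>\<^sup>+y. \<integral>\<^sup>+s. ennreal (gaussian (4 * \<rho>) (y - s)) * ennreal ((norm (f y))\<^sup>2) \<partial>lborel \<partial>lborel)"
    by (rule lborel_pair.Fubini') measurable
  also have "\<dots> = (\<integral>\<^sup>+y. ennreal (sqrt (pi / (4 * \<rho>)) ^ DIM('a)) * ennreal ((norm (f y))\<^sup>2) \<partial>lborel)"
  proof (intro nn_integral_cong)
    fix y :: 'a
    have "(\<integral>\<^sup>+s. ennreal (gaussian (4 * \<rho>) (y - s)) \<partial>lborel) = ennreal (sqrt (pi / (4 * \<rho>)) ^ DIM('a))"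
      using gauss_integral(3)[of "4 * \<rho>" y] \<rho> by (simp add: norm_minus_commute)
    then show "(\<integral>\<^sup>+s. ennreal (gaussian (4 * \<rho>) (y - s)) * ennreal ((norm (f y))\<^sup>2) \<partial>lborel) = ennreal (sqrt (pi / (4 * \<rho>)) ^ DIM('a)) * ennreal ((norm (f y))\<^sup>2)"
      by (subst nn_integral_multc) auto
  qed
  also have "\<dots> = ennreal (sqrt (pi / (4 * \<rho>)) ^ DIM('a) * (\<integral>x. (norm (f x))\<^sup>2 \<partial>lborel))"
    using f2 \<rho> by (subst nn_integral_cmult) (auto simp: nn_integral_eq_integral ennreal_mult)
  finally show ?thesis using c0 \<rho> by (simp add: ennreal_mult c_def)
qed

section \<open>The mollified Wigner transform and its window\<close>

text \<open>The point \<open>z = (X, \<xi>)\<close> lies in phase space and \<open>w = (x, y)\<close> is a pair of positions. Up to the factor \<open>(4\<pi>\<tau>)\<^sup>d\<^sup>/\<^sup>2\<close> this is the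
Gaussian mollification, by time \<open>\<tau>\<close> in \<open>X\<close> and time \<open>\<rho>\<close> in \<open>\<xi>\<close>, of the kernel of the Wigner transform.\<close>

definition wigner_kernel :: "real \<Rightarrow> real \<Rightarrow> 'a::euclidean_space \<times> 'a \<Rightarrow> 'a \<times> 'a \<Rightarrow> complex" where
  "wigner_kernel \<tau> \<rho> z w =
     of_real (gaussian (1 / (4 * \<tau>)) (fst z - (fst w + snd w) /\<^sub>R 2) * gaussian \<rho> (fst w - snd w))
       * cis ((fst w - snd w) \<bullet> snd z)"

definition smooth_wigner :: "real \<Rightarrow> real \<Rightarrow> ('a::euclidean_space \<Rightarrow> complex) \<Rightarrow> ('a \<Rightarrow> complex) \<Rightarrow> 'a \<times> 'a \<Rightarrow> complex" where
  "smooth_wigner \<tau> \<rho> f g z = (\<integral>w. wigner_kernel \<tau> \<rho> z w * (f (snd w) * cnj (g (fst w))) \<partial>lborel)"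

lemma norm_wigner_kernel_le: "0 < \<tau> \<Longrightarrow> 0 \<le> \<rho> \<Longrightarrow> norm (wigner_kernel \<tau> \<rho> z w) \<le> 1"
  by (auto simp: wigner_kernel_def norm_mult intro!: mult_le_one)

lemma wigner_kernel_measurable:
  "(\<lambda>(z, w). wigner_kernel \<tau> \<rho> z w) \<in> borel_measurable (lborel \<Otimes>\<^sub>M lborel)"
  unfolding wigner_kernel_def case_prod_beta' by measurable

lemma wigner_kernel_measurable_snd [measurable]: "(\<lambda>w. wigner_kernel \<tau> \<rho> z w) \<in> borel_measurable borel"
  unfolding wigner_kernel_def by measurable

lemma smooth_wigner_measurable [measurable]:
  fixes f g :: "'a::euclidean_space \<Rightarrow> complex"
  assumes [measurable]: "f \<in> borel_measurable borel" "g \<in> borel_measurable borel"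
  shows "smooth_wigner \<tau> \<rho> f g \<in> borel_measurable borel"
proof -
  note wigner_kernel_measurable[unfolded case_prod_beta', measurable]
  have "smooth_wigner \<tau> \<rho> f g \<in> borel_measurable lborel"
    unfolding smooth_wigner_def
    by (rule lborel.borel_measurable_lebesgue_integral) (unfold case_prod_beta', measurable)
  then show ?thesis by simp
qed

lemma combine_squares:
  fixes x a b :: "'a::real_inner"
  assumes "\<alpha> + \<beta> \<noteq> 0"
  shows "\<alpha> * (norm (x - a))\<^sup>2 + \<beta> * (norm (x - b))\<^sup>2
    = (\<alpha> + \<beta>) * (norm (x - (\<alpha> / (\<alpha> + \<beta>)) *\<^sub>R a - (\<beta> / (\<alpha> + \<beta>)) *\<^sub>R b))\<^sup>2 + \<alpha> * \<beta> / (\<alpha> + \<beta>) * (norm (a - b))\<^sup>2"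
proof -
  define u v where "u = x - a" and "v = x - b"
  define p where "p = \<alpha> / (\<alpha> + \<beta>)"
  \<comment> \<open>With barycentric weights \<open>p\<close> and \<open>1 - p\<close> the identity becomes homogeneous in \<open>\<alpha> + \<beta>\<close>.\<close>
  have q: "\<beta> / (\<alpha> + \<beta>) = 1 - p" using assms by (simp add: p_def field_simps)
  have al: "\<alpha> = p * (\<alpha> + \<beta>)" "\<beta> = (1 - p) * (\<alpha> + \<beta>)" using assms by (auto simp: p_def field_simps)
  have c: "x - p *\<^sub>R a - (1 - p) *\<^sub>R b = p *\<^sub>R u + (1 - p) *\<^sub>R v" by (simp add: u_def v_def algebra_simps)
  have ab: "a - b = v - u" by (simp add: u_def v_def)
  have e: "p * (norm u)\<^sup>2 + (1 - p) * (norm v)\<^sup>2 = (norm (p *\<^sub>R u + (1 - p) *\<^sub>R v))\<^sup>2 + p * (1 - p) * (norm (v - u))\<^sup>2"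
    unfolding power2_norm_eq_inner
    by (simp add: inner_add_left inner_add_right inner_diff_left inner_diff_right inner_commute[of v u] algebra_simps power2_eq_square)
  have co: "\<alpha> * \<beta> / (\<alpha> + \<beta>) = (\<alpha> + \<beta>) * (p * (1 - p))" using assms q[symmetric] by (simp add: p_def)
  have "\<alpha> * (norm u)\<^sup>2 + \<beta> * (norm v)\<^sup>2 = (\<alpha> + \<beta>) * (p * (norm u)\<^sup>2 + (1 - p) * (norm v)\<^sup>2)"
    by (subst (1) al(1), subst (1) al(2)) (simp add: algebra_simps)
  then show ?thesis unfolding e u_def[symmetric] v_def[symmetric] q p_def[symmetric] c ab co
    by (simp add: distrib_left)
qed

text \<open>The exponent left by the two Gaussian integrals in \<open>window_kernel\<close>, for positions measured from \<open>s\<close> and with \<open>u = 1/\<tau>\<close>: the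
right side has no terms that mix \<open>x, x'\<close> with \<open>y, y'\<close>.\<close>

lemma quad_identity:
  fixes x y x' y' :: "'a::real_inner"
  shows "8 * \<rho> * (norm (((x + y) /\<^sub>R 2 + (x' + y') /\<^sub>R 2) /\<^sub>R 2))\<^sup>2 + (u / 8) * (norm ((x + y) /\<^sub>R 2 - (x' + y') /\<^sub>R 2))\<^sup>2
      + \<rho> * (norm (x - y))\<^sup>2 + \<rho> * (norm (x' - y'))\<^sup>2 + (u / 32 - \<rho> / 2) * (norm ((x - y) - (x' - y')))\<^sup>2
    = 2 * \<rho> * ((norm y)\<^sup>2 + (norm y')\<^sup>2 + (norm x)\<^sup>2 + (norm x')\<^sup>2)
      + (u / 16 - \<rho>) * ((norm (y - y'))\<^sup>2 + (norm (x - x'))\<^sup>2)"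
  unfolding power2_norm_eq_inner
  by (simp add: inner_add_left inner_add_right inner_diff_left inner_diff_right
      inner_commute[of y x] inner_commute[of x' x] inner_commute[of y' x] inner_commute[of x' y] inner_commute[of y' y] inner_commute[of y' x'] field_simps)

text \<open>Completion of squares, first for the two equal Gaussians and then with the window.\<close>

lemma window_X:
  fixes m1 m2 s :: "'a::euclidean_space"
  assumes \<tau>: "0 < \<tau>" and \<kappa>: "0 < \<kappa>"
  shows "integrable lborel (\<lambda>X. gaussian \<kappa> (X - s) * gaussian (1 / (4 * \<tau>)) (X - m1) * gaussian (1 / (4 * \<tau>)) (X - m2))"
    and "(\<integral>X. gaussian \<kappa> (X - s) * gaussian (1 / (4 * \<tau>)) (X - m1) * gaussian (1 / (4 * \<tau>)) (X - m2) \<partial>lborel)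
      = sqrt (pi / (\<kappa> + 1 / (2 * \<tau>))) ^ DIM('a) *
        exp (- (\<kappa> / (1 + 2 * \<kappa> * \<tau>)) * (norm ((m1 + m2) /\<^sub>R 2 - s))\<^sup>2 - (1 / (8 * \<tau>)) * (norm (m1 - m2))\<^sup>2)"
proof -
  define m where "m = (m1 + m2) /\<^sub>R 2"
  define q where "q = 1 / (4 * \<tau>)"
  define r where "r = \<kappa> + 2 * q"
  have q: "q > 0" "1 / (2 * \<tau>) = 2 * q" "1 / (8 * \<tau>) = q / 2" using \<tau> by (auto simp: q_def)
  have r: "r > 0" using q \<kappa> by (simp add: r_def)
  define c where "c = (\<kappa> / r) *\<^sub>R s + (2 * q / r) *\<^sub>R m"
  have e1: "q * (norm (X - m1))\<^sup>2 + q * (norm (X - m2))\<^sup>2 = 2 * q * (norm (X - m))\<^sup>2 + q / 2 * (norm (m1 - m2))\<^sup>2" for X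
  proof -
    have "X - (1/2) *\<^sub>R m1 - (1/2) *\<^sub>R m2 = X - m"
      by (simp add: m_def algebra_simps)
    moreover have "q / (q + q) = 1 / 2" "q * q / (q + q) = q / 2" "q + q = 2 * q"
      using q(1) by (auto simp: field_simps)
    moreover have "q + q \<noteq> 0" using q(1) by simp
    ultimately show ?thesis
      using combine_squares[of q q X m1 m2] by (simp only: if_True simp_thms)
  qed
  have e2: "\<kappa> * (norm (X - s))\<^sup>2 + 2 * q * (norm (X - m))\<^sup>2 = r * (norm (X - c))\<^sup>2 + \<kappa> / (1 + 2 * \<kappa> * \<tau>) * (norm (m - s))\<^sup>2" for X
  proof -
    have "\<kappa> * (2 * q) / r = \<kappa> / (1 + 2 * \<kappa> * \<tau>)"
      using \<tau> \<kappa> by (simp add: r_def q_def field_simps)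
    then show ?thesis
      using combine_squares[of \<kappa> "2 * q" X s m] r by (simp add: r_def c_def norm_minus_commute diff_diff_eq)
  qed
  have e: "gaussian \<kappa> (X - s) * gaussian (1 / (4 * \<tau>)) (X - m1) * gaussian (1 / (4 * \<tau>)) (X - m2)
    = exp (- (\<kappa> / (1 + 2 * \<kappa> * \<tau>)) * (norm ((m1 + m2) /\<^sub>R 2 - s))\<^sup>2 - (1 / (8 * \<tau>)) * (norm (m1 - m2))\<^sup>2) * gaussian r (X - c)" for X
    unfolding q(3) q_def[symmetric] m_def[symmetric] exp_add[symmetric]
    using e1[of X] e2[of X] by simp
  have r2: "\<kappa> + 1 / (2 * \<tau>) = r" using q by (simp add: r_def)
  show "integrable lborel (\<lambda>X. gaussian \<kappa> (X - s) * gaussian (1 / (4 * \<tau>)) (X - m1) * gaussian (1 / (4 * \<tau>)) (X - m2))"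
    unfolding e by (intro integrable_mult_right gauss_integral(1) r)
  show "(\<integral>X. gaussian \<kappa> (X - s) * gaussian (1 / (4 * \<tau>)) (X - m1) * gaussian (1 / (4 * \<tau>)) (X - m2) \<partial>lborel)
      = sqrt (pi / (\<kappa> + 1 / (2 * \<tau>))) ^ DIM('a) *
        exp (- (\<kappa> / (1 + 2 * \<kappa> * \<tau>)) * (norm ((m1 + m2) /\<^sub>R 2 - s))\<^sup>2 - (1 / (8 * \<tau>)) * (norm (m1 - m2))\<^sup>2)"
    unfolding e r2 integral_mult_right_zero gauss_integral(2)[OF r] by simp
qed

definition window :: "real \<Rightarrow> real \<Rightarrow> 'a::euclidean_space \<times> 'a \<Rightarrow> 'a \<times> 'a \<Rightarrow> real" where
  "window \<kappa> \<kappa>' p z = gaussian \<kappa> (fst z - fst p) * gaussian \<kappa>' (snd z - snd p)"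

lemma window_measurable [measurable]:
  "(\<lambda>z. window \<kappa> \<kappa>' p z) \<in> borel_measurable borel"
  "(\<lambda>q. window \<kappa> \<kappa>' (fst q) (snd q)) \<in> borel_measurable borel"
  unfolding window_def by measurable

lemma integrable_lborel_prod_mult_real:
  fixes f :: "'a::euclidean_space \<Rightarrow> real" and g :: "'b::euclidean_space \<Rightarrow> real"
  assumes f: "integrable lborel f" and g: "integrable lborel g"
  shows "integrable lborel (\<lambda>p. f (fst p) * g (snd p))"
    and "(\<integral>p. f (fst p) * g (snd p) \<partial>lborel) = (\<integral>x. f x \<partial>lborel) * (\<integral>x. g x \<partial>lborel)"
proof -
  have "integrable lborel (\<lambda>p. complex_of_real (f (fst p) * g (snd p)))"
    using integrable_lborel_prod_mult(1)[of "\<lambda>x. of_real (f x)" "\<lambda>x. of_real (g x)"] f g by simp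
  then show i: "integrable lborel (\<lambda>p. f (fst p) * g (snd p))"
    by (simp only: complex_of_real_integrable_eq)
  show "(\<integral>p. f (fst p) * g (snd p) \<partial>lborel) = (\<integral>x. f x \<partial>lborel) * (\<integral>x. g x \<partial>lborel)"
    by (subst lborel_prod_integral[OF i]) simp
qed

lemma window_integral:
  fixes p :: "'a::euclidean_space \<times> 'a"
  assumes "0 < \<kappa>" "0 < \<kappa>'"
  shows "integrable lborel (window \<kappa> \<kappa>' p)"
    and "(\<integral>z. window \<kappa> \<kappa>' p z \<partial>lborel) = sqrt (pi / \<kappa>) ^ DIM('a) * sqrt (pi / \<kappa>') ^ DIM('a)"
  using integrable_lborel_prod_mult_real[OF gauss_integral(1)[OF assms(1), of "fst p"] gauss_integral(1)[OF assms(2), of "snd p"]]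
  unfolding window_def[abs_def] gauss_integral(2)[OF assms(1)] gauss_integral(2)[OF assms(2)] by simp_all

text \<open>The reason for the tensor product: after both Gaussian integrals the exponent is a combination of
\<open>|m - s|\<^sup>2\<close>, \<open>|n|\<^sup>2\<close>, \<open>|m1 - m2|\<^sup>2\<close> and \<open>|t - t'|\<^sup>2\<close>, where \<open>m\<close> is the mean of the midpoints \<open>m1\<close>, \<open>m2\<close>, and \<open>n\<close> the mean of the
differences \<open>t\<close>, \<open>t'\<close>. It separates into a form in \<open>(y, y')\<close> and one in \<open>(x, x')\<close> precisely when the coefficients in each of the two
pairs have ratio \<open>4\<close>, and the window widths \<open>8\<rho>/\<theta>\<close> and \<open>8\<tau>/\<theta>\<close> solve these two equations. They are positive exactly when
\<open>16\<tau>\<rho> < 1\<close>.\<close>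

lemma window_kernel:
  fixes w w' :: "'a::euclidean_space \<times> 'a"
  assumes \<tau>: "0 < \<tau>" and \<rho>: "0 < \<rho>" and small: "16 * \<tau> * \<rho> < 1"
  defines "\<theta> \<equiv> 1 - 16 * \<tau> * \<rho>"
  shows "(\<integral>z. of_real (window (8 * \<rho> / \<theta>) (8 * \<tau> / \<theta>) (s, \<sigma>) z) * wigner_kernel \<tau> \<rho> z w * cnj (wigner_kernel \<tau> \<rho> z w') \<partial>lborel)
    = of_real ((pi * \<theta> / 2) ^ DIM('a)) * (husimi_kernel \<rho> (\<theta> / (16 * \<tau>)) s \<sigma> (snd w) (snd w') * cnj (husimi_kernel \<rho> (\<theta> / (16 * \<tau>)) s \<sigma> (fst w) (fst w')))"
proof -
  define \<kappa> \<kappa>' where "\<kappa> = 8 * \<rho> / \<theta>" and "\<kappa>' = 8 * \<tau> / \<theta>"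
  have \<theta>: "0 < \<theta>" using small by (simp add: \<theta>_def)
  have \<kappa>: "0 < \<kappa>" "0 < \<kappa>'" using \<theta> \<tau> \<rho> by (auto simp: \<kappa>_def \<kappa>'_def)
  define m1 m2 where "m1 = (fst w + snd w) /\<^sub>R 2" and "m2 = (fst w' + snd w') /\<^sub>R 2"
  define t t' where "t = fst w - snd w" and "t' = fst w' - snd w'"
  define A :: "'a \<Rightarrow> real" where "A X = gaussian \<kappa> (X - s) * gaussian (1 / (4 * \<tau>)) (X - m1) * gaussian (1 / (4 * \<tau>)) (X - m2)" for X
  define B :: "'a \<Rightarrow> complex" where "B \<xi> = of_real (gaussian \<kappa>' (\<xi> - \<sigma>)) * cis ((t - t') \<bullet> \<xi>)" for \<xi>
  define E where "E = gaussian \<rho> t * gaussian \<rho> t'"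
  have iA: "integrable lborel (\<lambda>X. complex_of_real (A X))"
    unfolding A_def[abs_def] using window_X(1)[OF \<tau> \<kappa>(1)] by (simp only: complex_of_real_integrable_eq)
  have iB: "integrable lborel B" unfolding B_def[abs_def] by (rule gauss_FT_shift(1)[OF \<kappa>(2)])
  have pt: "of_real (window \<kappa> \<kappa>' (s, \<sigma>) z) * wigner_kernel \<tau> \<rho> z w * cnj (wigner_kernel \<tau> \<rho> z w') = of_real E * (of_real (A (fst z)) * B (snd z))" for z
  proof -
    have ph: "cis ((t - t') \<bullet> snd z) = cis (t \<bullet> snd z) * cis (- (t' \<bullet> snd z))"
      by (simp add: cis_mult inner_diff_left)
    show ?thesis
      unfolding window_def wigner_kernel_def E_def A_def B_def ph t_def[symmetric] t'_def[symmetric] m1_def[symmetric] m2_def[symmetric]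
        complex_cnj_mult cis_cnj complex_cnj_complex_of_real of_real_mult fst_conv snd_conv
      by algebra
  qed
  have "(\<integral>z. of_real (window \<kappa> \<kappa>' (s, \<sigma>) z) * wigner_kernel \<tau> \<rho> z w * cnj (wigner_kernel \<tau> \<rho> z w') \<partial>lborel)
      = of_real E * (of_real (integral\<^sup>L lborel A) * integral\<^sup>L lborel B)"
    unfolding pt integral_mult_right_zero integrable_lborel_prod_mult(2)[OF iA iB] integral_complex_of_real ..
  also have "integral\<^sup>L lborel A = sqrt (pi / (\<kappa> + 1 / (2 * \<tau>))) ^ DIM('a) *
        exp (- (\<kappa> / (1 + 2 * \<kappa> * \<tau>)) * (norm ((m1 + m2) /\<^sub>R 2 - s))\<^sup>2 - (1 / (8 * \<tau>)) * (norm (m1 - m2))\<^sup>2)"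
    unfolding A_def[abs_def] by (rule window_X(2)[OF \<tau> \<kappa>(1)])
  also have "integral\<^sup>L lborel B = of_real (sqrt (pi / \<kappa>') ^ DIM('a) * exp (- (norm (t - t'))\<^sup>2 / (4 * \<kappa>'))) * cis ((t - t') \<bullet> \<sigma>)"
    unfolding B_def[abs_def] by (rule gauss_FT_shift(2)[OF \<kappa>(2)])
  also have "of_real E * (of_real (sqrt (pi / (\<kappa> + 1 / (2 * \<tau>))) ^ DIM('a) *
        exp (- (\<kappa> / (1 + 2 * \<kappa> * \<tau>)) * (norm ((m1 + m2) /\<^sub>R 2 - s))\<^sup>2 - (1 / (8 * \<tau>)) * (norm (m1 - m2))\<^sup>2))
      * (of_real (sqrt (pi / \<kappa>') ^ DIM('a) * exp (- (norm (t - t'))\<^sup>2 / (4 * \<kappa>'))) * cis ((t - t') \<bullet> \<sigma>)))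
    = of_real ((sqrt (pi / (\<kappa> + 1 / (2 * \<tau>))) * sqrt (pi / \<kappa>')) ^ DIM('a))
      * (of_real (E * exp (- (\<kappa> / (1 + 2 * \<kappa> * \<tau>)) * (norm ((m1 + m2) /\<^sub>R 2 - s))\<^sup>2 - (1 / (8 * \<tau>)) * (norm (m1 - m2))\<^sup>2) * exp (- (norm (t - t'))\<^sup>2 / (4 * \<kappa>')))
      * cis ((t - t') \<bullet> \<sigma>))"
    unfolding of_real_mult power_mult_distrib by algebra
  also have "sqrt (pi / (\<kappa> + 1 / (2 * \<tau>))) * sqrt (pi / \<kappa>') = pi * \<theta> / 2"
  proof -
    have "\<kappa> + 1 / (2 * \<tau>) = 1 / (2 * \<tau> * \<theta>)"
      using \<theta> \<tau> unfolding \<kappa>_def by (simp add: field_simps) (simp add: \<theta>_def algebra_simps)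
    then have "pi / (\<kappa> + 1 / (2 * \<tau>)) * (pi / \<kappa>') = pi / (1 / (2 * \<tau> * \<theta>)) * (pi / (8 * \<tau> / \<theta>))"
      by (simp only: \<kappa>'_def)
    also have "\<dots> = (pi * \<theta> / 2)\<^sup>2"
      using \<theta> \<tau> by (simp add: field_simps power2_eq_square)
    finally have "pi / (\<kappa> + 1 / (2 * \<tau>)) * (pi / \<kappa>') = (pi * \<theta> / 2)\<^sup>2" .
    then show ?thesis using \<theta> by (simp add: real_sqrt_mult[symmetric])
  qed
  also have "of_real (E * exp (- (\<kappa> / (1 + 2 * \<kappa> * \<tau>)) * (norm ((m1 + m2) /\<^sub>R 2 - s))\<^sup>2 - (1 / (8 * \<tau>)) * (norm (m1 - m2))\<^sup>2) * exp (- (norm (t - t'))\<^sup>2 / (4 * \<kappa>'))) * cis ((t - t') \<bullet> \<sigma>)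
    = husimi_kernel \<rho> (\<theta> / (16 * \<tau>)) s \<sigma> (snd w) (snd w') * cnj (husimi_kernel \<rho> (\<theta> / (16 * \<tau>)) s \<sigma> (fst w) (fst w'))"
  proof -
    have k1: "\<kappa> / (1 + 2 * \<kappa> * \<tau>) = 8 * \<rho>"
      using \<theta> \<tau> \<rho> unfolding \<kappa>_def by (simp add: field_simps) (simp add: \<theta>_def algebra_simps)
    \<comment> \<open>In terms of \<open>1/\<tau>\<close> all coefficients are linear, which is the form of \<open>quad_identity\<close>.\<close>
    define u where "u = 1 / \<tau>"
    have k2: "1 / (4 * \<kappa>') = u / 32 - \<rho> / 2" "\<theta> / (16 * \<tau>) = u / 16 - \<rho>" "1 / (8 * \<tau>) = u / 8"
      using \<theta> \<tau> unfolding \<kappa>'_def u_def by (simp_all add: field_simps) (simp_all add: \<theta>_def algebra_simps)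
    have k2': "N / (4 * \<kappa>') = (u / 32 - \<rho> / 2) * N" for N unfolding k2(1)[symmetric] by simp
    define x y x' y' where "x = fst w - s" and "y = snd w - s" and "x' = fst w' - s" and "y' = snd w' - s"
    have v: "(m1 + m2) /\<^sub>R 2 - s = ((x + y) /\<^sub>R 2 + (x' + y') /\<^sub>R 2) /\<^sub>R 2" "m1 - m2 = (x + y) /\<^sub>R 2 - (x' + y') /\<^sub>R 2"
      "t = x - y" "t' = x' - y'" "snd w - snd w' = y - y'" "fst w - fst w' = x - x'"
      by (simp_all add: m1_def m2_def t_def t'_def x_def y_def x'_def y'_def algebra_simps flip: scaleR_add_left)
    have ex: "E * exp (- (\<kappa> / (1 + 2 * \<kappa> * \<tau>)) * (norm ((m1 + m2) /\<^sub>R 2 - s))\<^sup>2 - (1 / (8 * \<tau>)) * (norm (m1 - m2))\<^sup>2) * exp (- (norm (t - t'))\<^sup>2 / (4 * \<kappa>'))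
      = exp (- (2 * \<rho>) * (norm y)\<^sup>2 - 2 * \<rho> * (norm y')\<^sup>2 - (\<theta> / (16 * \<tau>)) * (norm (y - y'))\<^sup>2)
       * exp (- (2 * \<rho>) * (norm x)\<^sup>2 - 2 * \<rho> * (norm x')\<^sup>2 - (\<theta> / (16 * \<tau>)) * (norm (x - x'))\<^sup>2)"
      unfolding E_def exp_add[symmetric] k1 minus_divide_left[symmetric] k2' k2(2,3) v
      using quad_identity[of \<rho> x y x' y' u] by (intro arg_cong[where f=exp]) (simp add: algebra_simps)
    have ph: "cis ((t - t') \<bullet> \<sigma>) = cis (- (\<sigma> \<bullet> (y - y'))) * cis (\<sigma> \<bullet> (x - x'))"
      unfolding v by (simp add: cis_mult algebra_simps inner_commute)
    show ?thesis
      unfolding ex ph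
      unfolding husimi_kernel_def v complex_cnj_mult cis_cnj complex_cnj_complex_of_real minus_minus
        x_def[symmetric] y_def[symmetric] x'_def[symmetric] y'_def[symmetric] of_real_mult
      by algebra
  qed
  finally show ?thesis unfolding \<kappa>_def \<kappa>'_def .
qed

section \<open>Phase space estimate of the mollified Wigner transform\<close>

lemma integrable_mult_bounded:
  fixes f h :: "'a \<Rightarrow> complex"
  assumes f: "integrable M f" and [measurable]: "h \<in> borel_measurable M" and B: "\<And>x. norm (h x) \<le> B"
  shows "integrable M (\<lambda>x. f x * h x)"
proof (rule Bochner_Integration.integrable_bound)
  show "integrable M (\<lambda>x. of_real B * f x)" using f by simp
  show "AE x in M. norm (f x * h x) \<le> norm (of_real B * f x)"
  proof (rule AE_I2)
    fix x
    have "norm (f x) * norm (h x) \<le> norm (f x) * \<bar>B\<bar>"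
      using B[of x] by (intro mult_left_mono) auto
    then show "norm (f x * h x) \<le> norm (of_real B * f x)" by (simp add: norm_mult mult.commute)
  qed
qed (use f in auto)

text \<open>Because the Gram kernel is a tensor product, the fourfold integral splits into the two Husimi forms; the one for \<open>g\<close>
appears complex conjugated, which is harmless since it is real.\<close>

lemma window_energy:
  fixes f g :: "'a::euclidean_space \<Rightarrow> complex"
  assumes \<tau>: "0 < \<tau>" and \<rho>: "0 < \<rho>" and small: "16 * \<tau> * \<rho> < 1"
    and f: "integrable lborel f" and g: "integrable lborel g"
  defines "\<theta> \<equiv> 1 - 16 * \<tau> * \<rho>"
  shows "integrable lborel (\<lambda>z. window (8 * \<rho> / \<theta>) (8 * \<tau> / \<theta>) (s, \<sigma>) z * (norm (smooth_wigner \<tau> \<rho> f g z))\<^sup>2)"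
    and "(sqrt (4 * pi * (\<theta> / (16 * \<tau>))) ^ DIM('a))\<^sup>2 * (\<integral>z. window (8 * \<rho> / \<theta>) (8 * \<tau> / \<theta>) (s, \<sigma>) z * (norm (smooth_wigner \<tau> \<rho> f g z))\<^sup>2 \<partial>lborel)
      = (pi * \<theta> / 2) ^ DIM('a) * (husimi \<rho> (\<theta> / (16 * \<tau>)) f s \<sigma> * husimi \<rho> (\<theta> / (16 * \<tau>)) g s \<sigma>)"
proof -
  define \<gamma> where "\<gamma> = \<theta> / (16 * \<tau>)"
  define c where "c = sqrt (4 * pi * \<gamma>) ^ DIM('a)"
  have \<theta>: "0 < \<theta>" using small by (simp add: \<theta>_def)
  have \<kappa>: "0 < 8 * \<rho> / \<theta>" "0 < 8 * \<tau> / \<theta>" and \<gamma>: "0 < \<gamma>" using \<theta> \<tau> \<rho> by (auto simp: \<gamma>_def)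
  have fm [measurable]: "f \<in> borel_measurable borel" and gm [measurable]: "g \<in> borel_measurable borel"
    using borel_measurable_integrable[OF f] borel_measurable_integrable[OF g] by auto
  have cg: "integrable lborel (\<lambda>x. cnj (g x))" and cf: "integrable lborel (\<lambda>x. cnj (f x))" using f g by auto
  define H where "H w = f (snd w) * cnj (g (fst w))" for w
  have H: "integrable lborel H"
    using integrable_lborel_prod_mult(1)[OF cg f] by (simp add: H_def[abs_def] mult.commute)
  note gr = gram_identity[OF sigma_finite_lborel sigma_finite_lborel window_integral(1)[OF \<kappa>, of "(s, \<sigma>)"] H wigner_kernel_measurable norm_wigner_kernel_le[OF \<tau> less_imp_le[OF \<rho>]]]
  have sw: "(\<integral>w. wigner_kernel \<tau> \<rho> z w * H w \<partial>lborel) = smooth_wigner \<tau> \<rho> f g z" for z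
    by (simp add: smooth_wigner_def H_def)
  show "integrable lborel (\<lambda>z. window (8 * \<rho> / \<theta>) (8 * \<tau> / \<theta>) (s, \<sigma>) z * (norm (smooth_wigner \<tau> \<rho> f g z))\<^sup>2)"
    using gr(1) unfolding sw .
  define Q where "Q = husimi_kernel \<rho> \<gamma> s \<sigma>"
  have Qb: "norm (Q y y') \<le> 1" for y y' unfolding Q_def using \<rho> \<gamma> by (intro norm_husimi_kernel_le) auto
  have [measurable]: "(\<lambda>y. Q y y') \<in> borel_measurable borel" "(\<lambda>y'. Q y y') \<in> borel_measurable borel"
    "(\<lambda>p. Q (fst p) (snd p)) \<in> borel_measurable borel" for y y' by (simp_all add: Q_def)
  define qf where "qf y = (\<integral>y'. cnj (f y') * Q y y' \<partial>lborel)" for y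
  define qg where "qg y = (\<integral>y'. cnj (g y') * Q y y' \<partial>lborel)" for y
  have Qm: "(\<lambda>(y, y'). h y' * Q y y') \<in> borel_measurable (lborel \<Otimes>\<^sub>M lborel)" if [measurable]: "h \<in> borel_measurable borel" for h
  proof -
    have "(\<lambda>p. Q (fst p) (snd p)) \<in> borel_measurable borel" by (simp add: Q_def)
    moreover have "(\<lambda>p::'a \<times> 'a. h (snd p)) \<in> borel_measurable borel" by measurable
    ultimately have "(\<lambda>p. h (snd p) * Q (fst p) (snd p)) \<in> borel_measurable borel" by (rule borel_measurable_times[rotated])
    then show ?thesis by (simp add: lborel_prod case_prod_beta')
  qed
  have qm: "qf \<in> borel_measurable lborel" "qg \<in> borel_measurable lborel"
    unfolding qf_def qg_def
    by (rule lborel.borel_measurable_lebesgue_integral, rule Qm[OF borel_measurable_cnj[OF fm]],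
        rule lborel.borel_measurable_lebesgue_integral, rule Qm[OF borel_measurable_cnj[OF gm]])
  have qm' [measurable]: "qf \<in> borel_measurable borel" "qg \<in> borel_measurable borel" using qm by auto
  have qb: "norm (\<integral>y'. cnj (h y') * Q y y' \<partial>lborel) \<le> (\<integral>y'. norm (h y') \<partial>lborel)" if "integrable lborel h" for h y
  proof -
    have "norm (\<integral>y'. cnj (h y') * Q y y' \<partial>lborel) \<le> (\<integral>y'. norm (cnj (h y') * Q y y') \<partial>lborel)"
      by (rule integral_norm_bound)
    also have "\<dots> \<le> (\<integral>y'. norm (h y') \<partial>lborel)"
      by (rule integral_mono') (use that Qb in \<open>auto simp: norm_mult mult_left_le\<close>)
    finally show ?thesis .
  qed
  have if1: "integrable lborel (\<lambda>y. f y * qf y)"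
    by (rule integrable_mult_bounded[OF f _ qb[OF f, folded qf_def]]) auto
  have ig1: "integrable lborel (\<lambda>y. g y * qg y)"
    by (rule integrable_mult_bounded[OF g _ qb[OF g, folded qg_def]]) auto
  have inner: "(\<integral>w'. cnj (H w') * (Q (snd w) (snd w') * cnj (Q (fst w) (fst w'))) \<partial>lborel) = cnj (qg (fst w)) * qf (snd w)" for w
  proof -
    have 1: "integrable lborel (\<lambda>y'. cnj (f y') * Q (snd w) y')"
      by (rule integrable_mult_bounded[OF cf _ Qb]) auto
    have "integrable lborel (\<lambda>x'. cnj (g x') * Q (fst w) x')"
      by (rule integrable_mult_bounded[OF cg _ Qb]) auto
    then have 2: "integrable lborel (\<lambda>x'. cnj (cnj (g x') * Q (fst w) x'))"
      by (rule integrable_cnj)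
    have "(\<integral>w'. cnj (H w') * (Q (snd w) (snd w') * cnj (Q (fst w) (fst w'))) \<partial>lborel)
       = (\<integral>w'. cnj (cnj (g (fst w')) * Q (fst w) (fst w')) * (cnj (f (snd w')) * Q (snd w) (snd w')) \<partial>lborel)"
      by (simp add: H_def mult_ac)
    also have "\<dots> = (\<integral>x'. cnj (cnj (g x') * Q (fst w) x') \<partial>lborel) * qf (snd w)"
      unfolding integrable_lborel_prod_mult(2)[OF 2 1] qf_def ..
    finally show ?thesis unfolding qg_def Bochner_Integration.integral_cnj .
  qed
  define J where "J = (\<integral>y. f y * qf y \<partial>lborel)"
  define K where "K = (\<integral>y. g y * qg y \<partial>lborel)"
  have outer: "(\<integral>w. H w * (cnj (qg (fst w)) * qf (snd w)) \<partial>lborel) = cnj K * J"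
  proof -
    have 2: "integrable lborel (\<lambda>y. cnj (g y * qg y))" using ig1 by (rule integrable_cnj)
    have "(\<integral>w. H w * (cnj (qg (fst w)) * qf (snd w)) \<partial>lborel) = (\<integral>w. cnj (g (fst w) * qg (fst w)) * (f (snd w) * qf (snd w)) \<partial>lborel)"
      by (simp add: H_def mult_ac)
    also have "\<dots> = cnj K * J"
      unfolding integrable_lborel_prod_mult(2)[OF 2 if1] J_def K_def Bochner_Integration.integral_cnj ..
    finally show ?thesis .
  qed
  have hf: "complex_of_real (husimi \<rho> \<gamma> f s \<sigma>) = of_real c * J"
    using husimi_gram(2)[OF \<rho> \<gamma> f, of s \<sigma>] by (simp add: c_def J_def qf_def Q_def)
  have hg: "complex_of_real (husimi \<rho> \<gamma> g s \<sigma>) = of_real c * K"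
    using husimi_gram(2)[OF \<rho> \<gamma> g, of s \<sigma>] by (simp add: c_def K_def qg_def Q_def)
  have hg': "complex_of_real (husimi \<rho> \<gamma> g s \<sigma>) = of_real c * cnj K"
    using arg_cong[OF hg, of cnj] by simp
  define W where "W = (\<integral>z. window (8 * \<rho> / \<theta>) (8 * \<tau> / \<theta>) (s, \<sigma>) z * (norm (smooth_wigner \<tau> \<rho> f g z))\<^sup>2 \<partial>lborel)"
  have "complex_of_real W = (\<integral>w. H w * (\<integral>w'. cnj (H w') * (of_real ((pi * \<theta> / 2) ^ DIM('a)) * (Q (snd w) (snd w') * cnj (Q (fst w) (fst w')))) \<partial>lborel) \<partial>lborel)"
    using gr(2) unfolding sw W_def[symmetric] Q_def \<gamma>_def window_kernel[OF \<tau> \<rho> small, folded \<theta>_def] .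
  also have "\<dots> = of_real ((pi * \<theta> / 2) ^ DIM('a)) * (\<integral>w. H w * (\<integral>w'. cnj (H w') * (Q (snd w) (snd w') * cnj (Q (fst w) (fst w'))) \<partial>lborel) \<partial>lborel)"
    by (simp only: mult.left_commute[of _ "of_real ((pi * \<theta> / 2) ^ DIM('a))"] integral_mult_right_zero)
  also have "\<dots> = of_real ((pi * \<theta> / 2) ^ DIM('a)) * (cnj K * J)"
    unfolding inner outer ..
  finally have Weq: "complex_of_real W = of_real ((pi * \<theta> / 2) ^ DIM('a)) * (cnj K * J)" .
  have "complex_of_real (c\<^sup>2 * W) = of_real ((pi * \<theta> / 2) ^ DIM('a)) * ((of_real c * J) * (of_real c * cnj K))"
    by (simp only: of_real_mult of_real_power Weq power2_eq_square mult_ac)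
  also have "\<dots> = complex_of_real ((pi * \<theta> / 2) ^ DIM('a) * (husimi \<rho> \<gamma> f s \<sigma> * husimi \<rho> \<gamma> g s \<sigma>))"
    by (simp only: hf[symmetric] hg'[symmetric] of_real_mult)
  finally show "(sqrt (4 * pi * (\<theta> / (16 * \<tau>))) ^ DIM('a))\<^sup>2 * (\<integral>z. window (8 * \<rho> / \<theta>) (8 * \<tau> / \<theta>) (s, \<sigma>) z * (norm (smooth_wigner \<tau> \<rho> f g z))\<^sup>2 \<partial>lborel)
      = (pi * \<theta> / 2) ^ DIM('a) * (husimi \<rho> (\<theta> / (16 * \<tau>)) f s \<sigma> * husimi \<rho> (\<theta> / (16 * \<tau>)) g s \<sigma>)"
    unfolding of_real_eq_iff c_def \<gamma>_def W_def .
qed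

text \<open>The windows have area of order \<open>(\<tau>\<rho>)\<^sup>-\<^sup>d\<^sup>/\<^sup>2\<close>, and the Cauchy-Schwarz inequality inside a window costs the square root of this
area; a second one over the centres \<open>p\<close> separates \<open>f\<close> from \<open>g\<close>. The factor \<open>\<theta>\<close> cancels in the end, so the bound does not
degenerate as \<open>16\<tau>\<rho>\<close> approaches \<open>1\<close>.\<close>

lemma smooth_wigner_L1_small:
  fixes f g :: "'a::euclidean_space \<Rightarrow> complex"
  assumes \<tau>: "0 < \<tau>" and \<rho>: "0 < \<rho>" and small: "16 * \<tau> * \<rho> < 1"
    and f: "integrable lborel f" and g: "integrable lborel g"
    and f2: "square_integrable f" and g2: "square_integrable g"
  shows "(\<integral>\<^sup>+z. ennreal (norm (smooth_wigner \<tau> \<rho> f g z)) \<partial>lborel)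
    \<le> ennreal ((2 * pi) ^ DIM('a) * sqrt (pi * sqrt (\<tau> / \<rho>)) ^ DIM('a) * (L2_norm f * L2_norm g))"
proof -
  define d where "d = DIM('a)"
  define \<theta> where "\<theta> = 1 - 16 * \<tau> * \<rho>"
  define \<gamma> where "\<gamma> = \<theta> / (16 * \<tau>)"
  define c where "c = sqrt (4 * pi * \<gamma>) ^ d"
  define \<kappa> \<kappa>' where "\<kappa> = 8 * \<rho> / \<theta>" and "\<kappa>' = 8 * \<tau> / \<theta>"
  define A where "A = (pi * \<theta> / 2) ^ d"
  define N where "N = sqrt (pi / \<kappa>) ^ d * sqrt (pi / \<kappa>') ^ d"
  define V where "V = smooth_wigner \<tau> \<rho> f g"
  define Lf Lg where "Lf = (\<integral>x. (norm (f x))\<^sup>2 \<partial>lborel)" and "Lg = (\<integral>x. (norm (g x))\<^sup>2 \<partial>lborel)"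
  have L0: "0 \<le> Lf" "0 \<le> Lg" by (auto simp: Lf_def Lg_def)
  have \<theta>: "0 < \<theta>" using small by (simp add: \<theta>_def)
  have \<kappa>: "0 < \<kappa>" "0 < \<kappa>'" and \<gamma>: "0 < \<gamma>" using \<theta> \<tau> \<rho> by (auto simp: \<gamma>_def \<kappa>_def \<kappa>'_def)
  have pos: "0 < c" "0 < A" "0 < N" using \<theta> \<kappa> \<gamma> by (auto simp: c_def A_def N_def)
  have fm [measurable]: "f \<in> borel_measurable borel" and gm [measurable]: "g \<in> borel_measurable borel"
    using borel_measurable_integrable[OF f] borel_measurable_integrable[OF g] by auto
  have Vm [measurable]: "V \<in> borel_measurable borel" by (simp add: V_def)
  note husimi_measurable[OF fm, measurable] husimi_measurable[OF gm, measurable]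
  have wN: "(\<integral>\<^sup>+z. ennreal (window \<kappa> \<kappa>' p z) \<partial>lborel) = ennreal N" for p :: "'a \<times> 'a"
    using nn_integral_eq_integral[OF window_integral(1)[OF \<kappa>, of p]] window_integral(2)[OF \<kappa>, of p]
    by (simp add: window_def N_def d_def)
  have w0: "0 \<le> window \<kappa> \<kappa>' p z" for p z :: "'a \<times> 'a" by (simp add: window_def)
  have ws: "window \<kappa> \<kappa>' p z = window \<kappa> \<kappa>' z p" for p z :: "'a \<times> 'a" by (simp add: window_def norm_minus_commute)
  define hf hg where "hf p = husimi \<rho> \<gamma> f (fst p) (snd p)" and "hg p = husimi \<rho> \<gamma> g (fst p) (snd p)" for p
  have h0: "0 \<le> hf p" "0 \<le> hg p" for p by (auto simp: hf_def hg_def husimi_nonneg)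
  have hm [measurable]: "hf \<in> borel_measurable borel" "hg \<in> borel_measurable borel"
    unfolding hf_def hg_def by measurable
  have loc: "(\<integral>\<^sup>+z. ennreal (window \<kappa> \<kappa>' p z * norm (V z)) \<partial>lborel) \<le> ennreal (sqrt N * (sqrt A / c)) * ennreal (sqrt (hf p) * sqrt (hg p))" for p
  proof -
    define W where "W = (\<integral>z. window \<kappa> \<kappa>' p z * (norm (V z))\<^sup>2 \<partial>lborel)"
    have i: "integrable lborel (\<lambda>z. window \<kappa> \<kappa>' p z * (norm (V z))\<^sup>2)"
      using window_energy(1)[OF \<tau> \<rho> small f g, of "fst p" "snd p"] by (simp add: V_def \<kappa>_def \<kappa>'_def \<theta>_def)
    have e: "c\<^sup>2 * W = A * (hf p * hg p)"
      using window_energy(2)[OF \<tau> \<rho> small f g, of "fst p" "snd p"]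
      by (simp add: W_def V_def \<kappa>_def \<kappa>'_def \<theta>_def c_def A_def \<gamma>_def d_def hf_def hg_def)
    have W: "W = A * (hf p * hg p) / c\<^sup>2" using e pos by (simp add: field_simps)
    have W0: "0 \<le> W" unfolding W using pos h0 by simp
    have "(\<integral>\<^sup>+z. ennreal (window \<kappa> \<kappa>' p z * norm (V z)) \<partial>lborel) = (\<integral>\<^sup>+z. ennreal (sqrt (window \<kappa> \<kappa>' p z) * (sqrt (window \<kappa> \<kappa>' p z) * norm (V z))) \<partial>lborel)"
      by (simp add: mult.assoc[symmetric] w0)
    also have "\<dots> \<le> ennreal (sqrt N * sqrt W)"
    proof (rule nn_integral_Cauchy_Schwarz)
      show "(\<integral>\<^sup>+z. ennreal ((sqrt (window \<kappa> \<kappa>' p z))\<^sup>2) \<partial>lborel) \<le> ennreal N" by (simp add: w0 wN)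
      show "(\<integral>\<^sup>+z. ennreal ((sqrt (window \<kappa> \<kappa>' p z) * norm (V z))\<^sup>2) \<partial>lborel) \<le> ennreal W"
        using nn_integral_eq_integral[OF i] by (simp add: w0 power_mult_distrib W_def)
    qed (use W0 w0 pos in auto)
    also have "sqrt N * sqrt W = (sqrt N * (sqrt A / c)) * (sqrt (hf p) * sqrt (hg p))"
      unfolding W using pos by (simp add: real_sqrt_mult real_sqrt_divide)
    also have "ennreal \<dots> = ennreal (sqrt N * (sqrt A / c)) * ennreal (sqrt (hf p) * sqrt (hg p))"
      using pos h0 by (intro ennreal_mult) auto
    finally show ?thesis .
  qed
  define Bf Bg where "Bf = c * ((2 * pi) ^ d * (sqrt (pi / (4 * \<rho>)) ^ d * Lf))" and "Bg = c * ((2 * pi) ^ d * (sqrt (pi / (4 * \<rho>)) ^ d * Lg))"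
  have B0: "0 \<le> Bf" "0 \<le> Bg" using pos \<rho> L0 by (auto simp: Bf_def Bg_def)
  have hh: "(\<integral>\<^sup>+p. ennreal (sqrt (hf p) * sqrt (hg p)) \<partial>lborel) \<le> ennreal (sqrt Bf * sqrt Bg)"
  proof (rule nn_integral_Cauchy_Schwarz)
    show "(\<integral>\<^sup>+p. ennreal ((sqrt (hf p))\<^sup>2) \<partial>lborel) \<le> ennreal Bf"
      using husimi_total[OF \<rho> \<gamma> f f2] by (simp add: h0) (simp add: hf_def Bf_def c_def d_def Lf_def)
    show "(\<integral>\<^sup>+p. ennreal ((sqrt (hg p))\<^sup>2) \<partial>lborel) \<le> ennreal Bg"
      using husimi_total[OF \<rho> \<gamma> g g2] by (simp add: h0) (simp add: hg_def Bg_def c_def d_def Lg_def)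
  qed (use B0 h0 in auto)
  have [measurable]: "(\<lambda>p. window \<kappa> \<kappa>' (fst p) (snd p)) \<in> borel_measurable (lborel \<Otimes>\<^sub>M (lborel :: ('a \<times> 'a) measure))"
    by (simp add: lborel_prod)
  have "ennreal N * (\<integral>\<^sup>+z. ennreal (norm (V z)) \<partial>lborel) = (\<integral>\<^sup>+z. \<integral>\<^sup>+p. ennreal (window \<kappa> \<kappa>' p z * norm (V z)) \<partial>lborel \<partial>lborel)"
  proof (subst nn_integral_cmult[symmetric], simp, intro nn_integral_cong)
    fix z
    have "(\<integral>\<^sup>+p. ennreal (window \<kappa> \<kappa>' p z * norm (V z)) \<partial>lborel) = (\<integral>\<^sup>+p. ennreal (window \<kappa> \<kappa>' z p) * ennreal (norm (V z)) \<partial>lborel)"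
      by (subst ws) (simp add: ennreal_mult w0)
    also have "\<dots> = ennreal N * ennreal (norm (V z))"
      by (subst nn_integral_multc) (auto simp: wN)
    finally show "ennreal N * ennreal (norm (V z)) = (\<integral>\<^sup>+p. ennreal (window \<kappa> \<kappa>' p z * norm (V z)) \<partial>lborel)" by simp
  qed
  also have "\<dots> = (\<integral>\<^sup>+p. \<integral>\<^sup>+z. ennreal (window \<kappa> \<kappa>' p z * norm (V z)) \<partial>lborel \<partial>lborel)"
  proof (rule lborel_pair.Fubini')
    have "(\<lambda>q. ennreal (window \<kappa> \<kappa>' (fst q) (snd q) * norm (V (snd q)))) \<in> borel_measurable (lborel \<Otimes>\<^sub>M lborel)"
      by measurable
    then show "(\<lambda>(p, z). ennreal (window \<kappa> \<kappa>' p z * norm (V z))) \<in> borel_measurable (lborel \<Otimes>\<^sub>M lborel)"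
      by (simp add: case_prod_beta')
  qed
  also have "\<dots> \<le> (\<integral>\<^sup>+p. ennreal (sqrt N * (sqrt A / c)) * ennreal (sqrt (hf p) * sqrt (hg p)) \<partial>lborel)"
    by (intro nn_integral_mono loc)
  also have "\<dots> = ennreal (sqrt N * (sqrt A / c)) * (\<integral>\<^sup>+p. ennreal (sqrt (hf p) * sqrt (hg p)) \<partial>lborel)"
    by (rule nn_integral_cmult) measurable
  also have "\<dots> \<le> ennreal (sqrt N * (sqrt A / c)) * ennreal (sqrt Bf * sqrt Bg)"
    by (intro mult_left_mono hh) simp
  also have "\<dots> = ennreal (N * (sqrt (A / N) * ((2 * pi) ^ d * sqrt (pi / (4 * \<rho>)) ^ d) * (sqrt Lf * sqrt Lg)))"
  proof -
    define e where "e = c * ((2 * pi) ^ d * sqrt (pi / (4 * \<rho>)) ^ d)"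
    have e0: "0 \<le> e" using pos \<rho> by (simp add: e_def)
    have "sqrt Bf * sqrt Bg = e * (sqrt Lf * sqrt Lg)"
    proof -
      have "Bf = e * Lf" "Bg = e * Lg" by (auto simp: Bf_def Bg_def e_def)
      then show ?thesis using e0 by (simp add: real_sqrt_mult)
    qed
    moreover have "sqrt N * (sqrt A / c) * (e * (sqrt Lf * sqrt Lg)) = N * (sqrt (A / N) * ((2 * pi) ^ d * sqrt (pi / (4 * \<rho>)) ^ d) * (sqrt Lf * sqrt Lg))"
    proof -
      have "N = sqrt N * sqrt N" using pos by simp
      then have "sqrt N * sqrt A = N * sqrt (A / N)" using pos by (simp add: real_sqrt_divide field_simps)
      then show ?thesis using pos by (simp add: e_def)
    qed
    ultimately show ?thesis using pos e0 L0 B0 by (subst ennreal_mult[symmetric]) auto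
  qed
  finally have "ennreal N * (\<integral>\<^sup>+z. ennreal (norm (V z)) \<partial>lborel) \<le> ennreal N * ennreal (sqrt (A / N) * ((2 * pi) ^ d * sqrt (pi / (4 * \<rho>)) ^ d) * (sqrt Lf * sqrt Lg))"
    using pos \<rho> L0 by (simp add: ennreal_mult)
  then have "(\<integral>\<^sup>+z. ennreal (norm (V z)) \<partial>lborel) \<le> ennreal (sqrt (A / N) * ((2 * pi) ^ d * sqrt (pi / (4 * \<rho>)) ^ d) * (sqrt Lf * sqrt Lg))"
    using pos by (simp add: ennreal_mult_le_mult_iff)
  also have "sqrt (A / N) * ((2 * pi) ^ d * sqrt (pi / (4 * \<rho>)) ^ d) = (2 * pi) ^ d * sqrt (pi * sqrt (\<tau> / \<rho>)) ^ d"
  proof -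
    have n: "sqrt (pi / \<kappa>) * sqrt (pi / \<kappa>') = pi * \<theta> / (8 * sqrt (\<rho> * \<tau>))"
    proof -
      have "pi / \<kappa> * (pi / \<kappa>') = (pi * \<theta>)\<^sup>2 / (8\<^sup>2 * (\<rho> * \<tau>))"
        using \<theta> \<tau> \<rho> by (simp add: \<kappa>_def \<kappa>'_def field_simps power2_eq_square)
      then have "sqrt (pi / \<kappa> * (pi / \<kappa>')) = sqrt ((pi * \<theta>)\<^sup>2 / (8\<^sup>2 * (\<rho> * \<tau>)))" by simp
      then show ?thesis using \<theta> by (simp only: real_sqrt_mult real_sqrt_divide real_sqrt_abs) simp
    qed
    have "A / N = ((pi * \<theta> / 2) / (pi * \<theta> / (8 * sqrt (\<rho> * \<tau>)))) ^ d"
      unfolding A_def N_def power_mult_distrib[symmetric] n power_divide ..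
    also have "(pi * \<theta> / 2) / (pi * \<theta> / (8 * sqrt (\<rho> * \<tau>))) = 4 * sqrt (\<rho> * \<tau>)"
      using \<theta> \<rho> \<tau> by (simp add: field_simps)
    finally have AN: "A / N = (4 * sqrt (\<rho> * \<tau>)) ^ d" .
    have "sqrt (A / N) * sqrt (pi / (4 * \<rho>)) ^ d = (sqrt (4 * sqrt (\<rho> * \<tau>)) * sqrt (pi / (4 * \<rho>))) ^ d"
      unfolding AN real_sqrt_power power_mult_distrib[symmetric] ..
    also have "sqrt (4 * sqrt (\<rho> * \<tau>)) * sqrt (pi / (4 * \<rho>)) = sqrt (pi * sqrt (\<tau> / \<rho>))"
    proof -
      have "sqrt (\<rho> * \<tau>) / \<rho> = sqrt (\<tau> / \<rho>)"
        using \<rho> by (simp add: real_sqrt_mult real_sqrt_divide field_simps)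
      then have "4 * sqrt (\<rho> * \<tau>) * (pi / (4 * \<rho>)) = pi * sqrt (\<tau> / \<rho>)"
        by (metis (no_types, opaque_lifting) mult.commute times_divide_eq_left times_divide_eq_right mult_divide_mult_cancel_left_if zero_neq_numeral)
      then show ?thesis by (simp only: real_sqrt_mult[symmetric])
    qed
    finally show ?thesis by (simp add: mult_ac)
  qed
  finally show ?thesis by (simp add: V_def d_def L2_norm_def Lf_def Lg_def)
qed

lemma norm_integral_le_nn_integral:
  fixes f :: "'a \<Rightarrow> complex"
  shows "ennreal (norm (integral\<^sup>L M f)) \<le> (\<integral>\<^sup>+x. ennreal (norm (f x)) \<partial>M)"
  by (cases "integrable M f") (auto simp: integral_norm_bound_ennreal not_integrable_integral_eq)

text \<open>The extra factor \<open>exp (- r |x - y|\<^sup>2)\<close> is the Fourier transform of a positive Gaussian, so it acts as a convolution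
in \<open>\<xi>\<close>.\<close>

lemma smooth_wigner_widen:
  fixes f g :: "'a::euclidean_space \<Rightarrow> complex"
  assumes \<tau>: "0 < \<tau>" and \<rho>: "0 \<le> \<rho>" and r: "0 < r"
    and f: "integrable lborel f" and g: "integrable lborel g"
  shows "of_real (sqrt (4 * pi * r) ^ DIM('a)) * smooth_wigner \<tau> (\<rho> + r) f g (X, \<xi>)
    = (\<integral>\<eta>. of_real (gaussian (1 / (4 * r)) \<eta>) * smooth_wigner \<tau> \<rho> f g (X, \<eta> + \<xi>) \<partial>lborel)"
proof -
  define H where "H w = f (snd w) * cnj (g (fst w))" for w
  have cg: "integrable lborel (\<lambda>x. cnj (g x))" using g by simp
  have H: "integrable lborel H"
    using integrable_lborel_prod_mult(1)[OF cg f] by (simp add: H_def[abs_def] mult.commute)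
  have a: "0 < 1 / (4 * r)" using r by simp
  have G: "integrable lborel (\<lambda>\<eta>::'a. complex_of_real (gaussian (1 / (4 * r)) \<eta>))"
    using gauss_integral(1)[OF a, of "0::'a"] by (simp only: complex_of_real_integrable_eq diff_zero)
  have pt: "of_real (sqrt (4 * pi * r) ^ DIM('a)) * wigner_kernel \<tau> (\<rho> + r) (X, \<xi>) w
      = (\<integral>\<eta>. wigner_kernel \<tau> \<rho> (X, \<eta> + \<xi>) w * of_real (gaussian (1 / (4 * r)) \<eta>) \<partial>lborel)" for w
  proof -
    define t where "t = fst w - snd w"
    have 1: "wigner_kernel \<tau> \<rho> (X, \<eta> + \<xi>) w * of_real (gaussian (1 / (4 * r)) \<eta>)
       = wigner_kernel \<tau> \<rho> (X, \<xi>) w * (of_real (gaussian (1 / (4 * r)) \<eta>) * cis (t \<bullet> \<eta>))" for \<eta>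
      unfolding wigner_kernel_def t_def[symmetric] fst_conv snd_conv inner_add_right cis_mult[symmetric] by algebra
    have 2: "wigner_kernel \<tau> (\<rho> + r) (X, \<xi>) w = wigner_kernel \<tau> \<rho> (X, \<xi>) w * of_real (gaussian r t)"
    proof -
      have "gaussian (\<rho> + r) t = gaussian \<rho> t * gaussian r t"
        by (simp add: exp_add[symmetric] algebra_simps)
      then show ?thesis unfolding wigner_kernel_def t_def[symmetric] by (simp add: mult_ac)
    qed
    have 3: "(\<integral>\<eta>. of_real (gaussian (1 / (4 * r)) \<eta>) * cis (t \<bullet> \<eta>) \<partial>lborel) = of_real (sqrt (4 * pi * r) ^ DIM('a) * gaussian r t)"
      using gauss_FT[OF a, of t] by (simp add: has_bochner_integral_iff mult_ac)
    show ?thesis unfolding 1 integral_mult_right_zero 2 3 by simp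
  qed
  have "of_real (sqrt (4 * pi * r) ^ DIM('a)) * smooth_wigner \<tau> (\<rho> + r) f g (X, \<xi>)
     = (\<integral>w. H w * (of_real (sqrt (4 * pi * r) ^ DIM('a)) * wigner_kernel \<tau> (\<rho> + r) (X, \<xi>) w) \<partial>lborel)"
    unfolding smooth_wigner_def H_def[symmetric] integral_mult_right_zero[symmetric] by (simp add: mult_ac)
  also have "\<dots> = (\<integral>\<eta>. of_real (gaussian (1 / (4 * r)) \<eta>) * (\<integral>w. wigner_kernel \<tau> \<rho> (X, \<eta> + \<xi>) w * H w \<partial>lborel) \<partial>lborel)"
    unfolding pt
  proof (rule fubini_bounded[OF sigma_finite_lborel sigma_finite_lborel H G])
    show "norm (wigner_kernel \<tau> \<rho> (X, \<eta> + \<xi>) w) \<le> 1" for \<eta> w by (rule norm_wigner_kernel_le[OF \<tau> \<rho>])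
    show "(\<lambda>(w, \<eta>). wigner_kernel \<tau> \<rho> (X, \<eta> + \<xi>) w) \<in> borel_measurable (lborel \<Otimes>\<^sub>M lborel)"
      unfolding wigner_kernel_def case_prod_beta' fst_conv snd_conv by measurable
  qed
  finally show ?thesis unfolding smooth_wigner_def H_def .
qed

lemma smooth_wigner_L1_mono:
  fixes f g :: "'a::euclidean_space \<Rightarrow> complex"
  assumes \<tau>: "0 < \<tau>" and \<rho>: "0 \<le> \<rho>" and r: "0 < r"
    and f: "integrable lborel f" and g: "integrable lborel g"
  shows "(\<integral>\<^sup>+z. ennreal (norm (smooth_wigner \<tau> (\<rho> + r) f g z)) \<partial>lborel)
    \<le> (\<integral>\<^sup>+z. ennreal (norm (smooth_wigner \<tau> \<rho> f g z)) \<partial>lborel)"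
proof -
  define c where "c = sqrt (4 * pi * r) ^ DIM('a)"
  have c: "0 < c" using r by (simp add: c_def)
  have a: "0 < 1 / (4 * r)" using r by simp
  define V where "V = smooth_wigner \<tau> \<rho> f g"
  define G where "G \<eta> = gaussian (1 / (4 * r)) \<eta>" for \<eta> :: 'a
  have [measurable]: "f \<in> borel_measurable borel" "g \<in> borel_measurable borel"
    using borel_measurable_integrable[OF f] borel_measurable_integrable[OF g] by auto
  have Vm [measurable]: "V \<in> borel_measurable borel" by (simp add: V_def)
  have [measurable]: "smooth_wigner \<tau> (\<rho> + r) f g \<in> borel_measurable borel" by simp
  have [measurable]: "G \<in> borel_measurable borel" unfolding G_def by measurable
  have GI: "(\<integral>\<^sup>+\<eta>. ennreal (G \<eta>) \<partial>lborel) = ennreal c"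
    using gauss_integral(3)[OF a, of "0::'a"] by (simp add: G_def c_def mult_ac)
  have V1 [measurable]: "(\<lambda>\<xi>. V (X, \<xi>)) \<in> borel_measurable borel" for X
    by (rule measurable_compose[OF _ Vm]) (auto intro!: borel_measurable_continuous_onI continuous_intros)
  have V2 [measurable]: "(\<lambda>p. V (X, snd p + fst p)) \<in> borel_measurable borel" for X
    by (rule measurable_compose[OF _ Vm]) (auto intro!: borel_measurable_continuous_onI continuous_intros)
  have pt: "ennreal c * ennreal (norm (smooth_wigner \<tau> (\<rho> + r) f g (X, \<xi>))) \<le> (\<integral>\<^sup>+\<eta>. ennreal (G \<eta>) * ennreal (norm (V (X, \<eta> + \<xi>))) \<partial>lborel)" for X \<xi>
  proof -
    have "ennreal c * ennreal (norm (smooth_wigner \<tau> (\<rho> + r) f g (X, \<xi>))) = ennreal (norm (of_real c * smooth_wigner \<tau> (\<rho> + r) f g (X, \<xi>)))"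
      using c by (simp add: norm_mult ennreal_mult)
    also have "\<dots> = ennreal (norm (\<integral>\<eta>. of_real (G \<eta>) * V (X, \<eta> + \<xi>) \<partial>lborel))"
      unfolding c_def smooth_wigner_widen[OF \<tau> \<rho> r f g] V_def G_def ..
    also have "\<dots> \<le> (\<integral>\<^sup>+\<eta>. ennreal (norm (of_real (G \<eta>) * V (X, \<eta> + \<xi>))) \<partial>lborel)"
      by (rule norm_integral_le_nn_integral)
    finally show ?thesis by (simp add: norm_mult ennreal_mult G_def)
  qed
  have "ennreal c * (\<integral>\<^sup>+z. ennreal (norm (smooth_wigner \<tau> (\<rho> + r) f g z)) \<partial>lborel)
     = (\<integral>\<^sup>+X. \<integral>\<^sup>+\<xi>. ennreal c * ennreal (norm (smooth_wigner \<tau> (\<rho> + r) f g (X, \<xi>))) \<partial>lborel \<partial>lborel)"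
    by (subst nn_integral_cmult[symmetric], simp, subst lborel_prod_nn_integral, simp, rule refl)
  also have "\<dots> \<le> (\<integral>\<^sup>+X. \<integral>\<^sup>+\<xi>. \<integral>\<^sup>+\<eta>. ennreal (G \<eta>) * ennreal (norm (V (X, \<eta> + \<xi>))) \<partial>lborel \<partial>lborel \<partial>lborel)"
    by (intro nn_integral_mono pt)
  also have "\<dots> = (\<integral>\<^sup>+X. \<integral>\<^sup>+\<eta>. \<integral>\<^sup>+\<xi>. ennreal (G \<eta>) * ennreal (norm (V (X, \<eta> + \<xi>))) \<partial>lborel \<partial>lborel \<partial>lborel)"
  proof (rule nn_integral_cong, rule lborel_pair.Fubini'[symmetric])
    fix X
    have "(\<lambda>p. ennreal (G (snd p)) * ennreal (norm (V (X, snd p + fst p)))) \<in> borel_measurable borel"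
      by measurable
    then show "(\<lambda>(\<xi>, \<eta>). ennreal (G \<eta>) * ennreal (norm (V (X, \<eta> + \<xi>)))) \<in> borel_measurable (lborel \<Otimes>\<^sub>M lborel)"
      by (simp add: lborel_prod case_prod_beta')
  qed
  also have "\<dots> = (\<integral>\<^sup>+X. \<integral>\<^sup>+\<eta>. ennreal (G \<eta>) * (\<integral>\<^sup>+\<xi>. ennreal (norm (V (X, \<xi>))) \<partial>lborel) \<partial>lborel \<partial>lborel)"
  proof (intro nn_integral_cong)
    fix X \<eta> :: 'a
    have 1: "(\<lambda>\<xi>. ennreal (norm (V (X, \<eta> + \<xi>)))) \<in> borel_measurable lborel"
      using measurable_compose[of "\<lambda>\<xi>. \<eta> + \<xi>" borel borel, OF _ V1[of X]] by simp
    show "(\<integral>\<^sup>+\<xi>. ennreal (G \<eta>) * ennreal (norm (V (X, \<eta> + \<xi>))) \<partial>lborel) = ennreal (G \<eta>) * (\<integral>\<^sup>+\<xi>. ennreal (norm (V (X, \<xi>))) \<partial>lborel)"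
      using lborel_nn_integral_translate[of "\<lambda>\<xi>. ennreal (norm (V (X, \<xi>)))" \<eta>]
      by (subst nn_integral_cmult[OF 1]) simp
  qed
  also have "\<dots> = (\<integral>\<^sup>+X. ennreal c * (\<integral>\<^sup>+\<xi>. ennreal (norm (V (X, \<xi>))) \<partial>lborel) \<partial>lborel)"
    by (intro nn_integral_cong, subst nn_integral_multc) (auto simp: GI)
  also have "\<dots> = ennreal c * (\<integral>\<^sup>+z. ennreal (norm (V z)) \<partial>lborel)"
  proof -
    have "(\<lambda>(X, \<xi>). ennreal (norm (V (X, \<xi>)))) \<in> borel_measurable (lborel \<Otimes>\<^sub>M lborel)"
      by (simp add: lborel_prod case_prod_beta')
    then have "(\<lambda>X. \<integral>\<^sup>+\<xi>. ennreal (norm (V (X, \<xi>))) \<partial>lborel) \<in> borel_measurable lborel"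
      by (rule lborel.borel_measurable_nn_integral)
    then show ?thesis
      by (subst nn_integral_cmult, simp, subst lborel_prod_nn_integral[of "\<lambda>z. ennreal (norm (V z))"]) auto
  qed
  finally show ?thesis using c by (simp add: ennreal_mult_le_mult_iff V_def)
qed

text \<open>Replacing \<open>\<rho>\<close> by \<open>\<rho> / (1 + 16\<tau>\<rho>)\<close>, which always satisfies the smallness condition, gives a bound that is uniform in
\<open>(\<tau>, \<rho>)\<close> without a case distinction.\<close>

lemma smooth_wigner_L1:
  fixes f g :: "'a::euclidean_space \<Rightarrow> complex"
  assumes \<tau>: "0 < \<tau>" and \<rho>: "0 < \<rho>"
    and f: "integrable lborel f" and g: "integrable lborel g"
    and f2: "square_integrable f" and g2: "square_integrable g"
  shows "(\<integral>\<^sup>+z. ennreal (norm (smooth_wigner \<tau> \<rho> f g z)) \<partial>lborel)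
    \<le> ennreal ((2 * pi) ^ DIM('a) * (sqrt (4 * pi * \<tau>) ^ DIM('a) * (1 + 1 / (16 * \<tau> * \<rho>)) powr (DIM('a) / 4)) * (L2_norm f * L2_norm g))"
proof -
  define q where "q = 16 * \<tau> * \<rho>"
  define \<rho>0 where "\<rho>0 = \<rho> / (1 + q)"
  have q: "0 < q" using \<tau> \<rho> by (simp add: q_def)
  have \<rho>0: "0 < \<rho>0" using \<rho> q by (simp add: \<rho>0_def)
  have "16 * \<tau> * \<rho>0 = q / (1 + q)" by (simp add: \<rho>0_def q_def)
  then have sm: "16 * \<tau> * \<rho>0 < 1" using q by simp
  have r: "0 < \<rho> - \<rho>0" using q \<rho> by (simp add: \<rho>0_def field_simps)
  have "(\<integral>\<^sup>+z. ennreal (norm (smooth_wigner \<tau> \<rho> f g z)) \<partial>lborel) \<le> (\<integral>\<^sup>+z. ennreal (norm (smooth_wigner \<tau> \<rho>0 f g z)) \<partial>lborel)"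
    using smooth_wigner_L1_mono[OF \<tau> less_imp_le[OF \<rho>0] r f g] by simp
  also have "\<dots> \<le> ennreal ((2 * pi) ^ DIM('a) * sqrt (pi * sqrt (\<tau> / \<rho>0)) ^ DIM('a) * (L2_norm f * L2_norm g))"
    by (rule smooth_wigner_L1_small[OF \<tau> \<rho>0 sm f g f2 g2])
  also have "sqrt (pi * sqrt (\<tau> / \<rho>0)) ^ DIM('a) = sqrt (4 * pi * \<tau>) ^ DIM('a) * (1 + 1 / (16 * \<tau> * \<rho>)) powr (DIM('a) / 4)"
  proof -
    define v where "v = 1 + 1 / (16 * \<tau> * \<rho>)"
    have v: "0 < v" using \<tau> \<rho> by (simp add: v_def add_pos_pos)
    have "\<tau> / \<rho>0 = (4 * \<tau>)\<^sup>2 * v"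
      using \<tau> \<rho> q by (simp add: \<rho>0_def v_def q_def field_simps power2_eq_square)
    then have "pi * sqrt (\<tau> / \<rho>0) = (4 * pi * \<tau>) * sqrt v"
      using \<tau> by (simp add: real_sqrt_mult real_sqrt_abs)
    then have 1: "sqrt (pi * sqrt (\<tau> / \<rho>0)) = sqrt (4 * pi * \<tau>) * sqrt (sqrt v)"
      by (simp only: real_sqrt_mult)
    have "sqrt (sqrt v) ^ DIM('a) = v powr (DIM('a) / 4)"
    proof -
      have "sqrt (sqrt v) = v powr (1/4)"
        using v by (simp add: powr_half_sqrt[symmetric] powr_powr)
      then show ?thesis using v by (simp add: powr_realpow[symmetric] powr_powr)
    qed
    then show ?thesis unfolding 1 power_mult_distrib v_def by simp
  qed
  finally show ?thesis .
qed

lemma smoothed_symbol_pairing: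
  fixes f g :: "'a::euclidean_space \<Rightarrow> complex" and b :: "'a \<times> 'a \<Rightarrow> complex"
  assumes \<tau>: "0 < \<tau>" and \<rho>: "0 < \<rho>"
    and f: "integrable lborel f" and g: "integrable lborel g"
    and f2: "square_integrable f" and g2: "square_integrable g"
    and b: "integrable lborel b" and B: "\<And>z. norm (b z) \<le> B"
  shows "norm (\<integral>w. (f (snd w) * cnj (g (fst w))) * (\<integral>z. b z * wigner_kernel \<tau> \<rho> z w \<partial>lborel) \<partial>lborel)
    \<le> B * ((2 * pi) ^ DIM('a) * (sqrt (4 * pi * \<tau>) ^ DIM('a) * (1 + 1 / (16 * \<tau> * \<rho>)) powr (DIM('a) / 4)) * (L2_norm f * L2_norm g))"
proof -
  define H where "H w = f (snd w) * cnj (g (fst w))" for w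
  have cg: "integrable lborel (\<lambda>x. cnj (g x))" using g by simp
  have H: "integrable lborel H"
    using integrable_lborel_prod_mult(1)[OF cg f] by (simp add: H_def[abs_def] mult.commute)
  have B0: "0 \<le> B" using B[of undefined] norm_ge_zero order_trans by blast
  define R where "R = (2 * pi) ^ DIM('a) * (sqrt (4 * pi * \<tau>) ^ DIM('a) * (1 + 1 / (16 * \<tau> * \<rho>)) powr (DIM('a) / 4)) * (L2_norm f * L2_norm g)"
  have R0: "0 \<le> R" using \<tau> by (simp add: R_def L2_norm_def)
  have [measurable]: "f \<in> borel_measurable borel" "g \<in> borel_measurable borel"
    using borel_measurable_integrable[OF f] borel_measurable_integrable[OF g] by auto
  have Vm [measurable]: "smooth_wigner \<tau> \<rho> f g \<in> borel_measurable borel" by simp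
  have bm [measurable]: "b \<in> borel_measurable borel" using borel_measurable_integrable[OF b] by simp
  have "(\<integral>w. H w * (\<integral>z. b z * wigner_kernel \<tau> \<rho> z w \<partial>lborel) \<partial>lborel) = (\<integral>z. b z * (\<integral>w. wigner_kernel \<tau> \<rho> z w * H w \<partial>lborel) \<partial>lborel)"
    using fubini_bounded[OF sigma_finite_lborel sigma_finite_lborel b H wigner_kernel_measurable norm_wigner_kernel_le[OF \<tau> less_imp_le[OF \<rho>]]]
    by (simp add: mult.commute)
  also have "\<dots> = (\<integral>z. b z * smooth_wigner \<tau> \<rho> f g z \<partial>lborel)"
    by (simp add: smooth_wigner_def H_def)
  finally have eq: "(\<integral>w. H w * (\<integral>z. b z * wigner_kernel \<tau> \<rho> z w \<partial>lborel) \<partial>lborel) = (\<integral>z. b z * smooth_wigner \<tau> \<rho> f g z \<partial>lborel)" .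
  have "ennreal (norm (\<integral>z. b z * smooth_wigner \<tau> \<rho> f g z \<partial>lborel)) \<le> (\<integral>\<^sup>+z. ennreal (norm (b z * smooth_wigner \<tau> \<rho> f g z)) \<partial>lborel)"
    by (rule norm_integral_le_nn_integral)
  also have "\<dots> \<le> (\<integral>\<^sup>+z. ennreal B * ennreal (norm (smooth_wigner \<tau> \<rho> f g z)) \<partial>lborel)"
    by (intro nn_integral_mono) (auto simp: norm_mult ennreal_mult[symmetric] B0 intro!: ennreal_leI mult_right_mono B)
  also have "\<dots> = ennreal B * (\<integral>\<^sup>+z. ennreal (norm (smooth_wigner \<tau> \<rho> f g z)) \<partial>lborel)"
    by (rule nn_integral_cmult) measurable
  also have "\<dots> \<le> ennreal B * ennreal R"
    unfolding R_def by (intro mult_left_mono smooth_wigner_L1 assms) simp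
  also have "\<dots> = ennreal (B * R)" using B0 R0 by (simp add: ennreal_mult)
  finally show ?thesis unfolding H_def[symmetric] eq R_def[symmetric] using B0 R0 by (simp add: ennreal_le_iff)
qed

section \<open>Schwartz functions\<close>

lemma schwartz_smooth: "schwartz_fun f \<Longrightarrow> smooth_fun f"
  by (simp add: schwartz_fun_def)

lemma smooth_differentiable: "smooth_fun f \<Longrightarrow> set vs \<subseteq> Basis \<Longrightarrow> foldr dir_deriv vs f differentiable (at z)"
  by (simp add: smooth_fun_def)

lemma smooth_deriv:
  assumes "smooth_fun f" "set us \<subseteq> Basis"
  shows "smooth_fun (foldr dir_deriv us f)"
  unfolding smooth_fun_def
proof (intro allI impI)
  fix vs z assume "set vs \<subseteq> (Basis :: 'a set)"
  then show "foldr dir_deriv vs (foldr dir_deriv us f) differentiable (at z)"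
    using smooth_differentiable[OF assms(1), of "vs @ us" z] assms(2) by simp
qed

lemma schwartz_deriv:
  assumes f: "schwartz_fun f" and us: "set us \<subseteq> Basis"
  shows "schwartz_fun (foldr dir_deriv us f)"
  unfolding schwartz_fun_def
proof (intro conjI allI impI smooth_deriv schwartz_smooth assms)
  fix N vs assume "set vs \<subseteq> (Basis :: 'a set)"
  then have "bounded (range (\<lambda>z. (1 + norm z) ^ N *\<^sub>R foldr dir_deriv (vs @ us) f z))"
    using f us unfolding schwartz_fun_def by (metis le_sup_iff set_append)
  then show "bounded (range (\<lambda>z. (1 + norm z) ^ N *\<^sub>R foldr dir_deriv vs (foldr dir_deriv us f) z))"
    by simp
qed

lemma schwartz_decay:
  assumes "schwartz_fun f"
  obtains C where "0 \<le> C" "\<And>z. norm (f z) * (1 + norm z) ^ N \<le> C"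
proof -
  have "bounded (range (\<lambda>z. (1 + norm z) ^ N *\<^sub>R foldr dir_deriv [] f z))"
    using assms unfolding schwartz_fun_def by (metis empty_set empty_subsetI)
  then obtain C where C: "\<And>z. norm ((1 + norm z) ^ N *\<^sub>R f z) \<le> C"
    unfolding bounded_iff by auto
  have n: "norm ((1 + norm z) ^ N *\<^sub>R f z) = norm (f z) * (1 + norm z) ^ N" for z
    by (simp add: mult.commute abs_of_nonneg add_nonneg_nonneg)
  have "norm (f z) * (1 + norm z) ^ N \<le> C" for z using C[of z] unfolding n .
  moreover have "0 \<le> C" using norm_ge_zero C[of 0] by (rule order_trans)
  ultimately show ?thesis by (rule that[rotated])
qed

lemma smooth_continuous: "smooth_fun f \<Longrightarrow> continuous_on A f"
  using smooth_differentiable[of f "[]"]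
  by (auto intro!: continuous_at_imp_continuous_on differentiable_imp_continuous_within)

lemma smooth_measurable: "smooth_fun f \<Longrightarrow> f \<in> borel_measurable borel"
  by (rule borel_measurable_continuous_onI[OF smooth_continuous])

lemma dir_deriv_eqI: "(f has_derivative D) (at z) \<Longrightarrow> dir_deriv v f z = D v"
  unfolding dir_deriv_def using frechet_derivative_at by metis

lemma smooth_has_derivative:
  "smooth_fun f \<Longrightarrow> (f has_derivative frechet_derivative f (at z)) (at z)"
  using smooth_differentiable[of f "[]" z] by (simp add: frechet_derivative_works)

text \<open>Used for the restriction of a symbol to a slice and for its dilation, where \<open>J\<close> is an inclusion of coordinates and the identity
respectively.\<close>

lemma foldr_dir_deriv_affine:
  fixes f :: "'b::euclidean_space \<Rightarrow> complex" and S :: "'a::euclidean_space \<Rightarrow> 'b"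
  assumes f: "smooth_fun f" and S: "bounded_linear S"
    and SJ: "\<And>v. v \<in> Basis \<Longrightarrow> S v = c v *\<^sub>R J v" and J: "\<And>v. v \<in> Basis \<Longrightarrow> J v \<in> Basis"
    and vs: "set vs \<subseteq> Basis"
  shows "foldr dir_deriv vs (\<lambda>x. f (z0 + S x)) = (\<lambda>x. of_real (\<Prod>v\<leftarrow>vs. c v) * foldr dir_deriv (map J vs) f (z0 + S x))"
  using vs
proof (induction vs)
  case (Cons v vs)
  define F where "F = foldr dir_deriv (map J vs) f"
  have Jvs: "set (map J vs) \<subseteq> Basis" using Cons.prems J by auto
  have F: "smooth_fun F" unfolding F_def by (rule smooth_deriv[OF f Jvs])
  have v: "v \<in> Basis" using Cons.prems by simp
  show ?case
  proof
    fix x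
    let ?D = "frechet_derivative F (at (z0 + S x))"
    have lin: "linear ?D" using smooth_has_derivative[OF F] by (rule has_derivative_linear)
    have "((\<lambda>x. z0 + S x) has_derivative S) (at x)"
      using has_derivative_add[OF has_derivative_const[of z0] bounded_linear_imp_has_derivative[OF S, of "at x"]] by simp
    then have "((\<lambda>x. F (z0 + S x)) has_derivative (\<lambda>h. ?D (S h))) (at x)"
      by (rule has_derivative_compose) (rule smooth_has_derivative[OF F])
    then have "((\<lambda>x. of_real (\<Prod>v\<leftarrow>vs. c v) * F (z0 + S x)) has_derivative (\<lambda>h. of_real (\<Prod>v\<leftarrow>vs. c v) * ?D (S h))) (at x)"
      by (rule has_derivative_mult_right)
    then have "dir_deriv v (\<lambda>x. of_real (\<Prod>v\<leftarrow>vs. c v) * F (z0 + S x)) x = of_real (\<Prod>v\<leftarrow>vs. c v) * ?D (S v)"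
      by (rule dir_deriv_eqI)
    also have "?D (S v) = of_real (c v) * dir_deriv (J v) F (z0 + S x)"
      unfolding SJ[OF v] linear_scale[OF lin] dir_deriv_def by (simp add: scaleR_conv_of_real)
    finally show "foldr dir_deriv (v # vs) (\<lambda>x. f (z0 + S x)) x = of_real (\<Prod>v\<leftarrow>v # vs. c v) * foldr dir_deriv (map J (v # vs)) f (z0 + S x)"
      using Cons by (simp add: F_def mult_ac)
  qed
qed simp

lemma schwartz_affine:
  fixes f :: "'b::euclidean_space \<Rightarrow> complex" and S :: "'a::euclidean_space \<Rightarrow> 'b"
  assumes f: "schwartz_fun f" and S: "bounded_linear S"
    and SJ: "\<And>v. v \<in> Basis \<Longrightarrow> S v = c v *\<^sub>R J v" and J: "\<And>v. v \<in> Basis \<Longrightarrow> J v \<in> Basis"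
    and K: "\<And>x. 1 + norm x \<le> K * (1 + norm (z0 + S x))"
  shows "schwartz_fun (\<lambda>x. f (z0 + S x))"
proof -
  have sf: "smooth_fun f" using f by (rule schwartz_smooth)
  have eq: "foldr dir_deriv vs (\<lambda>x. f (z0 + S x)) = (\<lambda>x. of_real (\<Prod>v\<leftarrow>vs. c v) * foldr dir_deriv (map J vs) f (z0 + S x))"
    if "set vs \<subseteq> Basis" for vs
    by (rule foldr_dir_deriv_affine[OF sf S]) (use SJ J that in auto)
  have Jvs: "set (map J vs) \<subseteq> Basis" if "set vs \<subseteq> Basis" for vs using that J by auto
  show ?thesis
    unfolding schwartz_fun_def smooth_fun_def
  proof (intro conjI allI impI)
    fix vs z assume vs: "set vs \<subseteq> (Basis :: 'a set)"
    have "foldr dir_deriv (map J vs) f differentiable (at (z0 + S z))"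
      by (rule smooth_differentiable[OF sf Jvs[OF vs]])
    moreover have "(\<lambda>x. z0 + S x) differentiable (at z)"
      using bounded_linear_imp_differentiable[OF S] by (intro derivative_intros)
    ultimately have "(\<lambda>x. foldr dir_deriv (map J vs) f (z0 + S x)) differentiable (at z)"
      using differentiable_chain_at[of "\<lambda>x. z0 + S x" z "foldr dir_deriv (map J vs) f"] by (simp add: o_def)
    then show "foldr dir_deriv vs (\<lambda>x. f (z0 + S x)) differentiable (at z)"
      unfolding eq[OF vs] by (intro derivative_intros) auto
  next
    fix N vs assume vs: "set vs \<subseteq> (Basis :: 'a set)"
    obtain C where C: "0 \<le> C" "\<And>z. norm (foldr dir_deriv (map J vs) f z) * (1 + norm z) ^ N \<le> C"
      using schwartz_decay[OF schwartz_deriv[OF f Jvs[OF vs]]] by metis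
    define k where "k = \<bar>\<Prod>v\<leftarrow>vs. c v\<bar>"
    have K0: "0 \<le> K"
    proof (rule ccontr)
      assume "\<not> 0 \<le> K"
      then have "K * (1 + norm (z0 + S 0)) \<le> 0" by (intro mult_nonpos_nonneg) (auto simp: add_nonneg_nonneg)
      then show False using K[of 0] by simp
    qed
    have "norm ((1 + norm z) ^ N *\<^sub>R foldr dir_deriv vs (\<lambda>x. f (z0 + S x)) z) \<le> k * (K ^ N * C)" for z
    proof -
      have "norm ((1 + norm z) ^ N *\<^sub>R foldr dir_deriv vs (\<lambda>x. f (z0 + S x)) z)
        = k * ((1 + norm z) ^ N * norm (foldr dir_deriv (map J vs) f (z0 + S z)))"
        unfolding eq[OF vs] k_def by (simp add: norm_mult abs_of_nonneg add_nonneg_nonneg)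
      also have "\<dots> \<le> k * ((K * (1 + norm (z0 + S z))) ^ N * norm (foldr dir_deriv (map J vs) f (z0 + S z)))"
        by (intro mult_left_mono mult_right_mono power_mono K) (auto simp: k_def)
      also have "\<dots> = k * (K ^ N * (norm (foldr dir_deriv (map J vs) f (z0 + S z)) * (1 + norm (z0 + S z)) ^ N))"
        by (simp add: power_mult_distrib mult_ac)
      also have "\<dots> \<le> k * (K ^ N * C)"
        using K0 by (intro mult_left_mono C) (auto simp: k_def)
      finally show ?thesis .
    qed
    then show "bounded (range (\<lambda>z. (1 + norm z) ^ N *\<^sub>R foldr dir_deriv vs (\<lambda>x. f (z0 + S x)) z))"
      unfolding bounded_iff by blast
  qed
qed

text \<open>Comparison with a product of one-dimensional Cauchy densities.\<close>

lemma integrable_inverse_power: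
  "integrable lborel (\<lambda>x::'a::euclidean_space. 1 / (1 + norm x) ^ (2 * DIM('a)))"
proof -
  interpret product_sigma_finite "\<lambda>_::'a. lborel :: real measure" ..
  define F where "F (b::'a) x = inverse (1 + x\<^sup>2)" for b and x :: real
  have [measurable]: "F b \<in> borel_measurable borel" for b unfolding F_def by measurable
  have F: "integrable lborel (F b)" for b
    using integrable_inverse_1_plus_square by (simp add: set_integrable_def einterval_def F_def[abs_def])
  have meas: "(\<lambda>x::'a. \<Prod>b\<in>Basis. F b (x \<bullet> b)) \<in> borel_measurable borel" by measurable
  have comp: "(\<Sum>b\<in>Basis. f b *\<^sub>R b) \<bullet> b' = f b'" if "b' \<in> Basis" for f :: "'a \<Rightarrow> real" and b'
    using that by (rule inner_sum_left_Basis)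
  have "integrable (\<Pi>\<^sub>M b\<in>(Basis::'a set). lborel) (\<lambda>x. \<Prod>b\<in>Basis. F b (x b))"
    by (rule product_integrable_prod) (auto simp: F)
  then have i: "integrable lborel (\<lambda>x::'a. \<Prod>b\<in>Basis. F b (x \<bullet> b))"
    by (subst lborel_eq, subst integrable_distr_eq) (use meas in \<open>auto simp: comp cong: prod.cong\<close>)
  show ?thesis
  proof (rule Bochner_Integration.integrable_bound[OF i])
    show "AE x in lborel. norm (1 / (1 + norm (x::'a)) ^ (2 * DIM('a))) \<le> norm (\<Prod>b\<in>Basis. F b (x \<bullet> b))"
    proof (rule AE_I2)
      fix x :: 'a
      have b: "1 / (1 + norm x)\<^sup>2 \<le> F b (x \<bullet> b)" if "b \<in> Basis" for b
      proof -
        have "(x \<bullet> b)\<^sup>2 \<le> (norm x)\<^sup>2"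
          using Basis_le_norm[OF that, of x] by (metis abs_ge_zero power2_abs power_mono)
        moreover have "(1 + norm x)\<^sup>2 = 1 + 2 * norm x + (norm x)\<^sup>2" by (simp add: power2_sum)
        ultimately have "1 + (x \<bullet> b)\<^sup>2 \<le> (1 + norm x)\<^sup>2" using norm_ge_zero[of x] by linarith
        then show ?thesis unfolding F_def inverse_eq_divide
          by (intro divide_left_mono mult_pos_pos zero_less_power add_pos_nonneg) auto
      qed
      have "1 / (1 + norm x) ^ (2 * DIM('a)) = (\<Prod>b\<in>(Basis::'a set). 1 / (1 + norm x)\<^sup>2)"
        by (simp add: power_mult power_divide)
      also have "\<dots> \<le> (\<Prod>b\<in>Basis. F b (x \<bullet> b))"
        by (intro prod_mono) (use b in auto)
      finally show "norm (1 / (1 + norm x) ^ (2 * DIM('a))) \<le> norm (\<Prod>b\<in>Basis. F b (x \<bullet> b))"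
        by (simp add: abs_of_nonneg add_nonneg_nonneg)
    qed
  qed measurable
qed

lemma decay_bound:
  assumes "norm u * (1 + norm z) ^ N \<le> C"
  shows "norm u \<le> C * (1 / (1 + norm z) ^ N)"
proof -
  have "0 < (1 + norm z) ^ N" by (simp add: add_pos_nonneg)
  then show ?thesis using assms by (simp add: pos_le_divide_eq)
qed

lemma schwartz_integrable:
  fixes f :: "'a::euclidean_space \<Rightarrow> complex"
  assumes f: "schwartz_fun f"
  shows "integrable lborel f"
proof -
  obtain C where C: "0 \<le> C" "\<And>z. norm (f z) * (1 + norm z) ^ (2 * DIM('a)) \<le> C"
    using schwartz_decay[OF f] by metis
  show ?thesis
  proof (rule Bochner_Integration.integrable_bound[OF integrable_mult_right[OF integrable_inverse_power, of C]])
    show "AE x in lborel. norm (f x) \<le> norm (C * (1 / (1 + norm x) ^ (2 * DIM('a))))"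
      using decay_bound[OF C(2)] order_trans abs_ge_self by (fastforce simp: real_norm_def)
  qed (use smooth_measurable[OF schwartz_smooth[OF f]] in simp)
qed

lemma schwartz_bounded:
  assumes "schwartz_fun f"
  obtains C where "0 \<le> C" "\<And>z. norm (f z) \<le> C"
  using schwartz_decay[OF assms, of 0] by auto

text \<open>By translation invariance \<open>\<integral>(f (x + v) - f x) dx = 0\<close>; the difference is the integral of \<open>g\<close> along the segment from \<open>x\<close> to
\<open>x + v\<close>, and averaging over \<open>x\<close> turns this into \<open>\<integral>g\<close>.\<close>

lemma integral_dir_deriv_zero:
  fixes f :: "'a::euclidean_space \<Rightarrow> complex"
  assumes D: "\<And>x. (f has_derivative D x) (at x)"
    and g: "\<And>x. g x = D x v" and gc: "continuous_on UNIV g"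
    and fi: "integrable lborel f" and gi: "integrable lborel g"
  shows "(\<integral>x. g x \<partial>lborel) = 0"
proof -
  have gm [measurable]: "g \<in> borel_measurable borel" by (rule borel_measurable_continuous_onI[OF gc])
  have line: "(\<integral>s. indicator {0..1} s *\<^sub>R g (x + s *\<^sub>R v) \<partial>lborel) = f (v + x) - f x" for x
  proof -
    have "(\<integral>s. indicator {0..1} s *\<^sub>R g (x + s *\<^sub>R v) \<partial>lborel) = f (x + 1 *\<^sub>R v) - f (x + 0 *\<^sub>R v)"
    proof (rule integral_FTC_atLeastAtMost)
      fix s :: real
      have "((\<lambda>s. x + s *\<^sub>R v) has_derivative (\<lambda>h. h *\<^sub>R v)) (at s within {0..1})"
        by (auto intro!: derivative_eq_intros)
      then have "((\<lambda>s. f (x + s *\<^sub>R v)) has_derivative (\<lambda>h. D (x + s *\<^sub>R v) (h *\<^sub>R v))) (at s within {0..1})"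
        by (rule has_derivative_compose) (rule D)
      moreover have "D (x + s *\<^sub>R v) (h *\<^sub>R v) = h *\<^sub>R g (x + s *\<^sub>R v)" for h
        unfolding g by (rule linear_scale[OF has_derivative_linear[OF D]])
      ultimately show "((\<lambda>s. f (x + s *\<^sub>R v)) has_vector_derivative g (x + s *\<^sub>R v)) (at s within {0..1})"
        by (simp add: has_vector_derivative_def)
    next
      show "continuous_on {0..1} (\<lambda>s. g (x + s *\<^sub>R v))"
        by (intro continuous_on_compose2[OF gc] continuous_intros) auto
    qed simp
    then show ?thesis by (simp add: add.commute)
  qed
  have gmm [measurable]: "(\<lambda>p. g (snd p + fst p *\<^sub>R v)) \<in> borel_measurable (lborel \<Otimes>\<^sub>M lborel)"
  proof -
    have "(\<lambda>p::real \<times> 'a. g (snd p + fst p *\<^sub>R v)) \<in> borel_measurable borel"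
      by (intro borel_measurable_continuous_onI continuous_on_compose2[OF gc] continuous_intros) auto
    then show ?thesis by (simp add: lborel_prod)
  qed
  have tr: "(\<integral>x. h (x + s *\<^sub>R v) \<partial>lborel) = (\<integral>x. h x \<partial>lborel)" if "h \<in> borel_measurable borel" for s and h :: "'a \<Rightarrow> complex"
    using lborel_integral_translate[OF that, of "s *\<^sub>R v"] by (simp add: add.commute)
  have tr': "(\<integral>x. norm (g (x + s *\<^sub>R v)) \<partial>lborel) = (\<integral>x. norm (g x) \<partial>lborel)" for s
    using lborel_integral_translate[of "\<lambda>x. norm (g x)" "s *\<^sub>R v"] by (simp add: add.commute)
  have ti: "integrable lborel (\<lambda>x. g (x + s *\<^sub>R v))" for s
    using lborel_integrable_translate[OF gi, of "s *\<^sub>R v"] by (simp add: add.commute)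
  have ind: "integrable lborel (\<lambda>s::real. indicator {0..1} s * c)" for c :: real
    by (intro integrable_mult_left integrable_real_indicator) (auto simp: emeasure_lborel_Icc_eq)
  have int: "integrable (lborel \<Otimes>\<^sub>M lborel) (\<lambda>(s, x). indicator {0..1} s *\<^sub>R g (x + s *\<^sub>R v))"
  proof (rule lborel_pair.Fubini_integrable)
    show "(\<lambda>(s, x). indicator {0..1} s *\<^sub>R g (x + s *\<^sub>R v)) \<in> borel_measurable (lborel \<Otimes>\<^sub>M lborel)"
      unfolding case_prod_beta' by measurable
    show "integrable lborel (\<lambda>s. \<integral>x. norm (case (s, x) of (s, x) \<Rightarrow> indicator {0..1} s *\<^sub>R g (x + s *\<^sub>R v)) \<partial>lborel)"
      using ind[of "\<integral>x. norm (g x) \<partial>lborel"] by (simp add: tr' abs_of_nonneg)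
  qed (use ti in auto)
  have "0 = (\<integral>x. f (v + x) \<partial>lborel) - (\<integral>x. f x \<partial>lborel)"
    using lborel_integral_translate[of f v] borel_measurable_integrable[OF fi] by simp
  also have "\<dots> = (\<integral>x. f (v + x) - f x \<partial>lborel)"
    by (rule Bochner_Integration.integral_diff[symmetric, OF lborel_integrable_translate[OF fi] fi])
  also have "\<dots> = (\<integral>x. (\<integral>s. indicator {0..1} s *\<^sub>R g (x + s *\<^sub>R v) \<partial>lborel) \<partial>lborel)"
    by (simp only: line)
  also have "\<dots> = (\<integral>s. (\<integral>x. indicator {0..1} s *\<^sub>R g (x + s *\<^sub>R v) \<partial>lborel) \<partial>lborel)"
    by (rule lborel_pair.Fubini_integral[OF int])
  also have "\<dots> = (\<integral>s. indicator {0..1} s *\<^sub>R (\<integral>x. g x \<partial>lborel) \<partial>(lborel :: real measure))"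
    by (simp add: tr)
  also have "\<dots> = (\<integral>x. g x \<partial>lborel)"
    by (simp add: integral_scaleR_left)
  finally show ?thesis by simp
qed

lemma integrable_mult_cis:
  fixes f :: "'a::euclidean_space \<Rightarrow> complex"
  assumes "integrable lborel f"
  shows "integrable lborel (\<lambda>x. f x * cis (p \<bullet> x))"
  by (rule integrable_mult_bounded[OF assms, of _ 1]) auto

lemma FT_dir_deriv:
  fixes f :: "'a::euclidean_space \<Rightarrow> complex"
  assumes f: "schwartz_fun f" and v: "v \<in> Basis"
  shows "(\<integral>x. dir_deriv v f x * cis (p \<bullet> x) \<partial>lborel) = - \<i> * of_real (p \<bullet> v) * (\<integral>x. f x * cis (p \<bullet> x) \<partial>lborel)"
proof -
  have sf: "smooth_fun f" using f by (rule schwartz_smooth)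
  have f1: "schwartz_fun (dir_deriv v f)" using schwartz_deriv[OF f, of "[v]"] v by simp
  define g where "g x = dir_deriv v f x * cis (p \<bullet> x) + of_real (p \<bullet> v) * \<i> * (f x * cis (p \<bullet> x))" for x
  have i: "integrable lborel (\<lambda>x. f x * cis (p \<bullet> x))" by (rule integrable_mult_cis[OF schwartz_integrable[OF f]])
  have i1: "integrable lborel (\<lambda>x. dir_deriv v f x * cis (p \<bullet> x))" by (rule integrable_mult_cis[OF schwartz_integrable[OF f1]])
  have gi: "integrable lborel g" unfolding g_def by (intro Bochner_Integration.integrable_add integrable_mult_right i i1)
  have "(\<integral>x. g x \<partial>lborel) = 0"
  proof (rule integral_dir_deriv_zero)
    fix x
    show "((\<lambda>x. f x * cis (p \<bullet> x)) has_derivative (\<lambda>h. f x * ((p \<bullet> h) *\<^sub>R (\<i> * cis (p \<bullet> x))) + frechet_derivative f (at x) h * cis (p \<bullet> x))) (at x)"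
      by (intro has_derivative_mult smooth_has_derivative[OF sf] has_derivative_cis derivative_intros)
    show "g x = f x * ((p \<bullet> v) *\<^sub>R (\<i> * cis (p \<bullet> x))) + frechet_derivative f (at x) v * cis (p \<bullet> x)"
      by (simp add: g_def dir_deriv_def scaleR_conv_of_real)
  next
    show "continuous_on UNIV g" unfolding g_def
      by (intro continuous_intros smooth_continuous schwartz_smooth f f1)
  qed (fact i gi)+
  moreover have "(\<integral>x. g x \<partial>lborel) = (\<integral>x. dir_deriv v f x * cis (p \<bullet> x) \<partial>lborel) + of_real (p \<bullet> v) * \<i> * (\<integral>x. f x * cis (p \<bullet> x) \<partial>lborel)"
    unfolding g_def by (subst Bochner_Integration.integral_add[OF i1 integrable_mult_right[OF i]]) simp
  ultimately show ?thesis by (simp add: eq_neg_iff_add_eq_0 mult_ac)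
qed

lemma FT_derivs:
  fixes f :: "'a::euclidean_space \<Rightarrow> complex"
  assumes f: "schwartz_fun f" and vs: "set vs \<subseteq> Basis"
  shows "(\<integral>x. foldr dir_deriv vs f x * cis (p \<bullet> x) \<partial>lborel) = (\<Prod>v\<leftarrow>vs. - \<i> * of_real (p \<bullet> v)) * (\<integral>x. f x * cis (p \<bullet> x) \<partial>lborel)"
  using vs
proof (induction vs)
  case (Cons v vs)
  then show ?case
    using FT_dir_deriv[OF schwartz_deriv[OF f, of vs], of v p] by (simp add: mult.assoc)
qed simp

section \<open>Inverse powers of the Laplacian as averages of heat semigroups\<close>

text \<open>The index is shifted: \<open>erlang_measure k\<close> is the Gamma law of shape \<open>k + 1\<close>, with Laplace transform \<open>(1 + s)\<^sup>-\<^sup>k\<^sup>-\<^sup>1\<close>.\<close>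

definition erlang_measure :: "nat \<Rightarrow> real measure" where
  "erlang_measure k = density lborel (\<lambda>x. ennreal (erlang_density k 1 x))"

lemma prob_space_erlang_measure: "prob_space (erlang_measure k)"
  unfolding erlang_measure_def by (rule prob_space_erlang_density) simp

lemma sets_erlang_measure [simp, measurable_cong]: "sets (erlang_measure k) = sets borel"
  by (simp add: erlang_measure_def)

lemma space_erlang_measure [simp]: "space (erlang_measure k) = UNIV"
  by (simp add: erlang_measure_def)

lemma AE_erlang_pos: "AE \<tau> in erlang_measure k. 0 < \<tau>"
proof -
  have "AE x in lborel. (x::real) \<noteq> 0" by (rule AE_lborel_singleton)
  then show ?thesis
    unfolding erlang_measure_def by (subst AE_density) (auto simp: erlang_density_def elim!: eventually_mono split: if_splits)
qed

text \<open>The law lives on the positive half line; writing \<open>\<bar>\<tau>\<bar>\<close> makes the integrand bounded everywhere, as Fubini's theorem for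
bounded kernels requires.\<close>

lemma erlang_laplace:
  assumes s: "0 \<le> s"
  shows "(\<integral>\<tau>. exp (- \<bar>\<tau>\<bar> * s) \<partial>erlang_measure k) = 1 / (1 + s) ^ Suc k"
proof -
  have eq: "erlang_density k 1 x * exp (- \<bar>x\<bar> * s) = erlang_density k (1 + s) x / (1 + s) ^ Suc k" for x
  proof (cases "x < 0")
    case False
    define P where "P = (1 + s) ^ Suc k"
    have P: "P \<noteq> 0" using s by (simp add: P_def)
    have "exp (- (1 + s) * x) = exp (- 1 * x) * exp (- \<bar>x\<bar> * s)"
      using False by (simp add: exp_add[symmetric] algebra_simps)
    then show ?thesis
      using False P unfolding erlang_density_def P_def[symmetric] by simp
  qed (simp add: erlang_density_def)
  have "(\<integral>\<tau>. exp (- \<bar>\<tau>\<bar> * s) \<partial>erlang_measure k) = (\<integral>x. erlang_density k 1 x *\<^sub>R exp (- \<bar>x\<bar> * s) \<partial>lborel)"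
    unfolding erlang_measure_def by (subst integral_density) auto
  also have "\<dots> = (\<integral>x. erlang_density k (1 + s) x \<partial>lborel) / (1 + s) ^ Suc k"
    by (simp only: real_scaleR_def eq integral_divide_zero)
  also have "(\<integral>x. erlang_density k (1 + s) x \<partial>lborel) = 1"
    using nn_integral_erlang_ith_moment[of "1 + s" k 0] s by (subst integral_eq_nn_integral) auto
  finally show ?thesis .
qed

text \<open>The heat semigroup \<open>e\<^sup>\<tau>\<^sup>\<Delta> u\<close> in the scaled variable \<open>Z = (X - c) / \<surd>\<tau>\<close>, a form that is continuous up to \<open>\<tau> = 0\<close>.\<close>

definition heat_avg :: "real \<Rightarrow> ('a::euclidean_space \<Rightarrow> complex) \<Rightarrow> 'a \<Rightarrow> complex" where
  "heat_avg \<tau> u c = (\<integral>Z. of_real (gaussian (1 / 4) Z / sqrt (4 * pi) ^ DIM('a)) * u (c + sqrt \<tau> *\<^sub>R Z) \<partial>lborel)"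

lemma heat_weight:
  shows "integrable lborel (\<lambda>Z::'a::euclidean_space. gaussian (1 / 4) Z / sqrt (4 * pi) ^ DIM('a))"
    and "(\<integral>Z. gaussian (1 / 4) (Z::'a) / sqrt (4 * pi) ^ DIM('a) \<partial>lborel) = 1"
proof -
  have a: "0 < (1 / 4 :: real)" by simp
  show "integrable lborel (\<lambda>Z::'a. gaussian (1 / 4) Z / sqrt (4 * pi) ^ DIM('a))"
    using gauss_integral(1)[OF a, of "0::'a"] by (intro integrable_divide) simp
  show "(\<integral>Z. gaussian (1 / 4) (Z::'a) / sqrt (4 * pi) ^ DIM('a) \<partial>lborel) = 1"
    using gauss_integral(2)[OF a, of "0::'a"] by (simp add: mult.commute)
qed

lemma heat_avg_bound:
  fixes u :: "'a::euclidean_space \<Rightarrow> complex"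
  assumes "\<And>x. norm (u x) \<le> B"
  shows "norm (heat_avg \<tau> u c) \<le> B"
proof -
  have B0: "0 \<le> B" using assms[of undefined] norm_ge_zero order_trans by blast
  define N where "N Z = gaussian (1 / 4) Z / sqrt (4 * pi) ^ DIM('a)" for Z :: 'a
  have N: "integrable lborel N" "integral\<^sup>L lborel N = 1" "\<And>Z. 0 \<le> N Z"
    using heat_weight[where 'a='a] by (auto simp: N_def[abs_def])
  have "norm (heat_avg \<tau> u c) \<le> (\<integral>Z. norm (of_real (N Z) * u (c + sqrt \<tau> *\<^sub>R Z)) \<partial>lborel)"
    unfolding heat_avg_def N_def[symmetric] by (rule integral_norm_bound)
  also have "\<dots> \<le> (\<integral>Z. N Z * B \<partial>lborel)"
    by (rule integral_mono') (use N assms B0 in \<open>auto simp: norm_mult intro!: mult_left_mono\<close>)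
  also have "\<dots> = B" using N by simp
  finally show ?thesis .
qed

lemma heat_avg_convolution:
  fixes u :: "'a::euclidean_space \<Rightarrow> complex"
  assumes \<tau>: "0 < \<tau>" and [measurable]: "u \<in> borel_measurable borel"
  shows "of_real (sqrt (4 * pi * \<tau>) ^ DIM('a)) * heat_avg \<tau> u c = (\<integral>X. of_real (gaussian (1 / (4 * \<tau>)) (X - c)) * u X \<partial>lborel)"
proof -
  have "(\<integral>X. of_real (gaussian (1 / (4 * \<tau>)) (X - c)) * u X \<partial>lborel)
    = \<bar>sqrt \<tau>\<bar> ^ DIM('a) *\<^sub>R (\<integral>Z. of_real (gaussian (1 / (4 * \<tau>)) ((c + sqrt \<tau> *\<^sub>R Z) - c)) * u (c + sqrt \<tau> *\<^sub>R Z) \<partial>lborel)"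
    using \<tau> by (intro lborel_integral_affine) auto
  also have "\<dots> = of_real (sqrt \<tau> ^ DIM('a)) * (\<integral>Z. of_real (gaussian (1 / 4) Z) * u (c + sqrt \<tau> *\<^sub>R Z) \<partial>lborel)"
  proof -
    have e: "- (1 / (4 * \<tau>)) * (norm ((c + sqrt \<tau> *\<^sub>R Z) - c))\<^sup>2 = - (1 / 4) * (norm Z)\<^sup>2" for Z
      using \<tau> by (simp add: power_mult_distrib)
    show ?thesis unfolding e using \<tau> by (simp add: scaleR_conv_of_real)
  qed
  also have "\<dots> = of_real (sqrt (4 * pi * \<tau>) ^ DIM('a)) * heat_avg \<tau> u c"
  proof -
    have "heat_avg \<tau> u c = (1 / of_real (sqrt (4 * pi) ^ DIM('a))) * (\<integral>Z. of_real (gaussian (1 / 4) Z) * u (c + sqrt \<tau> *\<^sub>R Z) \<partial>lborel)"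
      unfolding heat_avg_def by (subst integral_mult_right_zero[symmetric]) simp
    moreover have "sqrt (4 * pi * \<tau>) ^ DIM('a) = sqrt (4 * pi) ^ DIM('a) * sqrt \<tau> ^ DIM('a)"
      by (simp only: real_sqrt_mult power_mult_distrib)
    ultimately show ?thesis by simp
  qed
  finally show ?thesis by simp
qed

lemma heat_avg_FT:
  fixes u :: "'a::euclidean_space \<Rightarrow> complex"
  assumes \<tau>: "0 < \<tau>" and u: "integrable lborel u"
  shows "of_real ((2 * pi) ^ DIM('a)) * heat_avg \<tau> u c
    = (\<integral>p. (of_real (gaussian \<tau> p) * cis (- (p \<bullet> c))) * (\<integral>X. cis (p \<bullet> X) * u X \<partial>lborel) \<partial>lborel)"
proof -
  have um: "u \<in> borel_measurable borel" using borel_measurable_integrable[OF u] by simp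
  have G: "integrable lborel (\<lambda>p. of_real (gaussian \<tau> p) * cis (- (p \<bullet> c)))"
    using gauss_FT_shift(1)[OF \<tau>, of "0::'a" "- c"] by (simp add: inner_commute)
  have "(\<integral>p. (of_real (gaussian \<tau> p) * cis (- (p \<bullet> c))) * (\<integral>X. cis (p \<bullet> X) * u X \<partial>lborel) \<partial>lborel)
    = (\<integral>X. u X * (\<integral>p. cis (p \<bullet> X) * (of_real (gaussian \<tau> p) * cis (- (p \<bullet> c))) \<partial>lborel) \<partial>lborel)"
    by (rule fubini_bounded[OF sigma_finite_lborel sigma_finite_lborel G u, of _ 1]) auto
  also have "\<dots> = (\<integral>X. of_real (sqrt (pi / \<tau>) ^ DIM('a)) * (of_real (gaussian (1 / (4 * \<tau>)) (X - c)) * u X) \<partial>lborel)"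
  proof (rule Bochner_Integration.integral_cong[OF refl])
    fix X
    have "cis (p \<bullet> X) * (of_real (gaussian \<tau> p) * cis (- (p \<bullet> c))) = of_real (gaussian \<tau> p) * cis ((X - c) \<bullet> p)" for p
    proof -
      have i: "(X - c) \<bullet> p = p \<bullet> X + - (p \<bullet> c)"
        by (subst inner_commute) (simp add: inner_diff_right)
      show ?thesis unfolding i cis_mult[symmetric] by (simp add: mult_ac)
    qed
    then have "(\<integral>p. cis (p \<bullet> X) * (of_real (gaussian \<tau> p) * cis (- (p \<bullet> c))) \<partial>lborel) = of_real (sqrt (pi / \<tau>) ^ DIM('a) * exp (- (norm (X - c))\<^sup>2 / (4 * \<tau>)))"
      using gauss_FT[OF \<tau>, of "X - c"] by (simp only: has_bochner_integral_iff)
    then show "u X * (\<integral>p. cis (p \<bullet> X) * (of_real (gaussian \<tau> p) * cis (- (p \<bullet> c))) \<partial>lborel) = of_real (sqrt (pi / \<tau>) ^ DIM('a)) * (of_real (gaussian (1 / (4 * \<tau>)) (X - c)) * u X)"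
      by simp
  qed
  also have "\<dots> = of_real (sqrt (pi / \<tau>) ^ DIM('a)) * (of_real (sqrt (4 * pi * \<tau>) ^ DIM('a)) * heat_avg \<tau> u c)"
    unfolding integral_mult_right_zero heat_avg_convolution[OF \<tau> um] ..
  also have "\<dots> = of_real ((2 * pi) ^ DIM('a)) * heat_avg \<tau> u c"
  proof -
    have "sqrt (pi / \<tau>) * sqrt (4 * pi * \<tau>) = sqrt ((2 * pi)\<^sup>2)"
      using \<tau> unfolding real_sqrt_mult[symmetric] by (simp add: power2_eq_square)
    then have "sqrt (pi / \<tau>) * sqrt (4 * pi * \<tau>) = 2 * pi" by (simp only: real_sqrt_abs) simp
    then have "sqrt (pi / \<tau>) ^ DIM('a) * sqrt (4 * pi * \<tau>) ^ DIM('a) = (2 * pi) ^ DIM('a)"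
      by (simp only: power_mult_distrib[symmetric])
    then show ?thesis by (simp only: mult.assoc[symmetric] of_real_mult[symmetric])
  qed
  finally show ?thesis ..
qed

lemma heat_avg_tendsto:
  fixes u :: "'a::euclidean_space \<Rightarrow> complex"
  assumes uc: "continuous_on UNIV u" and B: "\<And>x. norm (u x) \<le> B" and e: "e \<longlonglongrightarrow> \<tau>"
  shows "(\<lambda>n. heat_avg (e n) u c) \<longlonglongrightarrow> heat_avg \<tau> u c"
  unfolding heat_avg_def
proof (rule integral_dominated_convergence)
  have [measurable]: "u \<in> borel_measurable borel" by (rule borel_measurable_continuous_onI[OF uc])
  let ?N = "\<lambda>Z::'a. gaussian (1 / 4) Z / sqrt (4 * pi) ^ DIM('a)"
  show "integrable lborel (\<lambda>Z. ?N Z * B)" by (intro integrable_mult_left heat_weight(1))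
  show "AE Z in lborel. (\<lambda>n. of_real (?N Z) * u (c + sqrt (e n) *\<^sub>R Z)) \<longlonglongrightarrow> of_real (?N Z) * u (c + sqrt \<tau> *\<^sub>R Z)"
  proof (intro AE_I2 tendsto_intros)
    fix Z
    have "(\<lambda>n. c + sqrt (e n) *\<^sub>R Z) \<longlonglongrightarrow> c + sqrt \<tau> *\<^sub>R Z" by (intro tendsto_intros e)
    then show "(\<lambda>n. u (c + sqrt (e n) *\<^sub>R Z)) \<longlonglongrightarrow> u (c + sqrt \<tau> *\<^sub>R Z)"
      using continuous_on_tendsto_compose[OF uc] by auto
  qed
  show "AE Z in lborel. norm (of_real (?N Z) * u (c + sqrt (e n) *\<^sub>R Z)) \<le> ?N Z * B" for n
  proof (rule AE_I2)
    fix Z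
    have "norm (of_real (?N Z) * u (c + sqrt (e n) *\<^sub>R Z)) = ?N Z * norm (u (c + sqrt (e n) *\<^sub>R Z))"
      unfolding norm_mult norm_of_real by simp
    also have "\<dots> \<le> ?N Z * B" by (intro mult_left_mono B) simp
    finally show "norm (of_real (?N Z) * u (c + sqrt (e n) *\<^sub>R Z)) \<le> ?N Z * B" .
  qed
  show "(\<lambda>Z. of_real (?N Z) * u (c + sqrt \<tau> *\<^sub>R Z)) \<in> borel_measurable lborel"
    "(\<lambda>Z. of_real (?N Z) * u (c + sqrt (e n) *\<^sub>R Z)) \<in> borel_measurable lborel" for n
    by measurable
qed

lemma heat_avg_0: "heat_avg 0 u c = u c"
proof -
  have "heat_avg 0 u c = (\<integral>Z. complex_of_real (gaussian (1 / 4) (Z::'a) / sqrt (4 * pi) ^ DIM('a)) \<partial>lborel) * u c"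
    unfolding heat_avg_def by simp
  also have "(\<integral>Z. complex_of_real (gaussian (1 / 4) (Z::'a) / sqrt (4 * pi) ^ DIM('a)) \<partial>lborel) = 1"
    unfolding integral_complex_of_real heat_weight(2) by simp
  finally show ?thesis by simp
qed

lemma heat_avg_measurable:
  fixes u :: "'a::euclidean_space \<Rightarrow> complex"
  assumes [measurable]: "u \<in> borel_measurable borel"
  shows "(\<lambda>\<tau>. heat_avg \<tau> u c) \<in> borel_measurable borel"
proof -
  have "(\<lambda>\<tau>. heat_avg \<tau> u c) \<in> borel_measurable lborel"
    unfolding heat_avg_def by (rule lborel.borel_measurable_lebesgue_integral) (unfold case_prod_beta', measurable)
  then show ?thesis by simp
qed

text \<open>For \<open>e > 0\<close> the heat semigroup at time \<open>e\<close> is an absolutely convergent Fourier integral. Inserting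
\<open>(1 + |p|\<^sup>2)\<^sup>-\<^sup>k\<^sup>-\<^sup>1\<close> as the Laplace transform of the Erlang law gives the identity with \<open>u\<close> and \<open>A\<close> evolved by time \<open>e\<close>, and then
\<open>e\<close> tends to \<open>0\<close> on both sides.\<close>

lemma heat_representation:
  fixes u A :: "'a::euclidean_space \<Rightarrow> complex"
  assumes u: "integrable lborel u" "continuous_on UNIV u" "\<And>x. norm (u x) \<le> Bu"
    and A: "integrable lborel A" "continuous_on UNIV A" "\<And>x. norm (A x) \<le> B"
    and FT: "\<And>p. (\<integral>x. A x * cis (p \<bullet> x) \<partial>lborel) = of_real ((1 + (norm p)\<^sup>2) ^ Suc k) * (\<integral>x. u x * cis (p \<bullet> x) \<partial>lborel)"
  shows "u c = (\<integral>\<tau>. heat_avg \<tau> A c \<partial>erlang_measure k)"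
proof -
  interpret E: prob_space "erlang_measure k" by (rule prob_space_erlang_measure)
  have sE: "sigma_finite_measure (erlang_measure k)" by unfold_locales
  have Am [measurable]: "A \<in> borel_measurable borel" by (rule borel_measurable_continuous_onI[OF A(2)])
  define Ah where "Ah p = (\<integral>X. cis (p \<bullet> X) * A X \<partial>lborel)" for p
  define uh where "uh p = (\<integral>X. cis (p \<bullet> X) * u X \<partial>lborel)" for p
  have uA: "uh p = Ah p * (\<integral>\<tau>. of_real (gaussian \<bar>\<tau>\<bar> p) * 1 \<partial>erlang_measure k)" for p
  proof -
    have "0 < (1 + (norm p)\<^sup>2) ^ Suc k" by (intro zero_less_power) (simp add: add_pos_nonneg)
    then have "complex_of_real ((1 + (norm p)\<^sup>2) ^ Suc k) \<noteq> 0" by (simp only: of_real_eq_0_iff)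
    moreover have "Ah p = of_real ((1 + (norm p)\<^sup>2) ^ Suc k) * uh p"
      using FT[of p] by (simp only: Ah_def uh_def mult.commute)
    moreover have "(\<integral>\<tau>. complex_of_real (gaussian \<bar>\<tau>\<bar> p) * 1 \<partial>erlang_measure k) = of_real (1 / (1 + (norm p)\<^sup>2) ^ Suc k)"
      unfolding mult_1_right integral_complex_of_real erlang_laplace[OF zero_le_power2] ..
    ultimately show ?thesis by (simp only: of_real_divide of_real_1) simp
  qed
  have Ahb: "norm (Ah p) \<le> (\<integral>x. norm (A x) \<partial>lborel)" for p
  proof -
    have "norm (Ah p) \<le> (\<integral>X. norm (cis (p \<bullet> X) * A X) \<partial>lborel)" unfolding Ah_def by (rule integral_norm_bound)
    then show ?thesis by (simp add: norm_mult)
  qed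
  have Ahm [measurable]: "Ah \<in> borel_measurable borel"
  proof -
    have "Ah \<in> borel_measurable lborel"
      unfolding Ah_def by (rule lborel.borel_measurable_lebesgue_integral) (unfold case_prod_beta', measurable)
    then show ?thesis by simp
  qed
  define pid where "pid = complex_of_real ((2 * pi) ^ DIM('a))"
  have pid: "pid \<noteq> 0" by (simp add: pid_def)
  have eps: "heat_avg e u c = (\<integral>\<tau>. heat_avg (\<tau> + e) A c \<partial>erlang_measure k)" if e: "0 < e" for e
  proof -
    have G: "integrable lborel (\<lambda>p. (of_real (gaussian e p) * cis (- (p \<bullet> c))) * Ah p)"
    proof (rule integrable_mult_bounded[OF _ _ Ahb])
      show "integrable lborel (\<lambda>p. of_real (gaussian e p) * cis (- (p \<bullet> c)))"
        using gauss_FT_shift(1)[OF e, of "0::'a" "- c"] by (simp add: inner_commute)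
    qed simp
    have "pid * heat_avg e u c = (\<integral>p. (of_real (gaussian e p) * cis (- (p \<bullet> c))) * uh p \<partial>lborel)"
      unfolding pid_def heat_avg_FT[OF e u(1)] uh_def ..
    also have "\<dots> = (\<integral>p. (of_real (gaussian e p) * cis (- (p \<bullet> c)) * Ah p) * (\<integral>\<tau>. of_real (gaussian \<bar>\<tau>\<bar> p) * 1 \<partial>erlang_measure k) \<partial>lborel)"
      unfolding uA by (simp only: mult.assoc)
    also have "\<dots> = (\<integral>\<tau>. 1 * (\<integral>p. of_real (gaussian \<bar>\<tau>\<bar> p) * (of_real (gaussian e p) * cis (- (p \<bullet> c)) * Ah p) \<partial>lborel) \<partial>erlang_measure k)"
    proof (rule fubini_bounded[OF sigma_finite_lborel sE G])
      show "(\<lambda>(p::'a, \<tau>). complex_of_real (gaussian \<bar>\<tau>\<bar> p)) \<in> borel_measurable (lborel \<Otimes>\<^sub>M erlang_measure k)"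
        unfolding case_prod_beta' by measurable
      show "norm (complex_of_real (gaussian \<bar>\<tau>\<bar> (p::'a))) \<le> 1" for p \<tau> by simp
    qed simp
    also have "\<dots> = (\<integral>\<tau>. pid * heat_avg (\<tau> + e) A c \<partial>erlang_measure k)"
    proof (rule integral_cong_AE)
      show "(\<lambda>\<tau>. 1 * (\<integral>p. of_real (gaussian \<bar>\<tau>\<bar> p) * (of_real (gaussian e p) * cis (- (p \<bullet> c)) * Ah p) \<partial>lborel)) \<in> borel_measurable (erlang_measure k)"
        unfolding mult_1_left by (rule lborel.borel_measurable_lebesgue_integral) (unfold case_prod_beta', measurable)
      show "(\<lambda>\<tau>. pid * heat_avg (\<tau> + e) A c) \<in> borel_measurable (erlang_measure k)"
        using measurable_compose[OF _ heat_avg_measurable[OF Am], of "\<lambda>\<tau>. \<tau> + e" "erlang_measure k"] by measurable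
      show "AE \<tau> in erlang_measure k. 1 * (\<integral>p. of_real (gaussian \<bar>\<tau>\<bar> p) * (of_real (gaussian e p) * cis (- (p \<bullet> c)) * Ah p) \<partial>lborel) = pid * heat_avg (\<tau> + e) A c"
        using AE_erlang_pos
      proof eventually_elim
        fix \<tau> :: real assume \<tau>: "0 < \<tau>"
        then have te: "0 < \<tau> + e" using e by simp
        have "of_real (gaussian \<bar>\<tau>\<bar> p) * (of_real (gaussian e p) * cis (- (p \<bullet> c)) * Ah p) = of_real (gaussian (\<tau> + e) p) * cis (- (p \<bullet> c)) * Ah p" for p
        proof -
          have "gaussian (\<tau> + e) p = gaussian \<bar>\<tau>\<bar> p * gaussian e p"
            using \<tau> by (simp add: exp_add[symmetric] algebra_simps)
          then show ?thesis by (simp add: mult.assoc)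
        qed
        then show "1 * (\<integral>p. of_real (gaussian \<bar>\<tau>\<bar> p) * (of_real (gaussian e p) * cis (- (p \<bullet> c)) * Ah p) \<partial>lborel) = pid * heat_avg (\<tau> + e) A c"
          unfolding pid_def heat_avg_FT[OF te A(1)] Ah_def by (simp only: mult_1_left)
      qed
    qed
    also have "\<dots> = pid * (\<integral>\<tau>. heat_avg (\<tau> + e) A c \<partial>erlang_measure k)" by simp
    finally show ?thesis using pid by (simp only: mult_cancel_left) simp
  qed
  define e where "e n = 1 / real (Suc n)" for n
  have e0: "e \<longlonglongrightarrow> 0" unfolding e_def by (rule LIMSEQ_Suc[OF lim_1_over_n])
  have "(\<lambda>n. heat_avg (e n) u c) \<longlonglongrightarrow> heat_avg 0 u c" by (rule heat_avg_tendsto[OF u(2,3) e0])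
  moreover have "(\<lambda>n. heat_avg (e n) u c) \<longlonglongrightarrow> (\<integral>\<tau>. heat_avg \<tau> A c \<partial>erlang_measure k)"
  proof -
    have "(\<lambda>n. \<integral>\<tau>. heat_avg (\<tau> + e n) A c \<partial>erlang_measure k) \<longlonglongrightarrow> (\<integral>\<tau>. heat_avg \<tau> A c \<partial>erlang_measure k)"
    proof (rule integral_dominated_convergence[where w="\<lambda>_. B"])
      show "(\<lambda>\<tau>. heat_avg \<tau> A c) \<in> borel_measurable (erlang_measure k)"
        using heat_avg_measurable[OF Am] by simp
      show "(\<lambda>\<tau>. heat_avg (\<tau> + e n) A c) \<in> borel_measurable (erlang_measure k)" for n
        using measurable_compose[OF _ heat_avg_measurable[OF Am], of "\<lambda>\<tau>. \<tau> + e n" "erlang_measure k"] by measurable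
      show "AE \<tau> in erlang_measure k. (\<lambda>n. heat_avg (\<tau> + e n) A c) \<longlonglongrightarrow> heat_avg \<tau> A c"
      proof (rule AE_I2, rule heat_avg_tendsto[OF A(2,3)])
        fix \<tau> show "(\<lambda>n. \<tau> + e n) \<longlonglongrightarrow> \<tau>" using tendsto_add[OF tendsto_const[of \<tau>] e0] by simp
      qed
      show "AE \<tau> in erlang_measure k. norm (heat_avg (\<tau> + e n) A c) \<le> B" for n
        by (rule AE_I2, rule heat_avg_bound[OF A(3)])
    qed simp
    moreover have "heat_avg (e n) u c = (\<integral>\<tau>. heat_avg (\<tau> + e n) A c \<partial>erlang_measure k)" for n
      by (rule eps) (simp add: e_def)
    ultimately show ?thesis by simp
  qed
  ultimately show ?thesis unfolding heat_avg_0 by (rule LIMSEQ_unique)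
qed

section \<open>The bilinear estimate\<close>

text \<open>At \<open>t = x - y\<close> and \<open>X = (x + y) / 2\<close> this is \<open>(2\<pi>)\<^sup>d\<close> times the Weyl kernel of \<open>b\<close> at \<open>(x, y)\<close>.\<close>

definition fourier_xi :: "('a::euclidean_space \<times> 'a \<Rightarrow> complex) \<Rightarrow> 'a \<Rightarrow> 'a \<Rightarrow> complex" where
  "fourier_xi b t X = (\<integral>\<xi>. b (X, \<xi>) * cis (t \<bullet> \<xi>) \<partial>lborel)"

lemma fourier_xi_measurable:
  fixes b :: "'a::euclidean_space \<times> 'a \<Rightarrow> complex"
  assumes [measurable]: "b \<in> borel_measurable borel"
  shows "(\<lambda>p. fourier_xi b (fst p) (snd p)) \<in> borel_measurable borel"
proof -
  have "(\<lambda>p::'a\<times>'a. fourier_xi b (fst p) (snd p)) \<in> borel_measurable lborel"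
    unfolding fourier_xi_def by (rule lborel.borel_measurable_lebesgue_integral) (unfold case_prod_beta', measurable)
  then show ?thesis by simp
qed

lemma fourier_xi_bound:
  assumes g: "integrable lborel g" and bg: "\<And>X \<xi>. norm (b (X, \<xi>)) \<le> g \<xi>"
  shows "norm (fourier_xi b t X) \<le> (\<integral>\<xi>. g \<xi> \<partial>lborel)"
proof -
  have g0: "0 \<le> g \<xi>" for \<xi> using bg[of undefined \<xi>] norm_ge_zero order_trans by blast
  have "norm (fourier_xi b t X) \<le> (\<integral>\<xi>. norm (b (X, \<xi>) * cis (t \<bullet> \<xi>)) \<partial>lborel)"
    unfolding fourier_xi_def by (rule integral_norm_bound)
  also have "\<dots> \<le> (\<integral>\<xi>. g \<xi> \<partial>lborel)"
    by (rule integral_mono') (use g g0 bg in \<open>auto simp: norm_mult\<close>)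
  finally show ?thesis .
qed

lemma heat_avg_fourier_xi_measurable:
  fixes b :: "'a::euclidean_space \<times> 'a \<Rightarrow> complex"
  assumes "b \<in> borel_measurable borel"
  shows "(\<lambda>q::'a \<times> real \<times> 'a. heat_avg (fst (snd q)) (fourier_xi b (fst q)) (snd (snd q))) \<in> borel_measurable borel"
proof -
  have m: "(\<lambda>r::('a \<times> real \<times> 'a) \<times> 'a. fourier_xi b (fst (fst r)) (snd (snd (fst r)) + sqrt (fst (snd (fst r))) *\<^sub>R snd r)) \<in> borel_measurable (lborel \<Otimes>\<^sub>M lborel)"
  proof -
    have "(\<lambda>r::('a \<times> real \<times> 'a) \<times> 'a. (fst (fst r), snd (snd (fst r)) + sqrt (fst (snd (fst r))) *\<^sub>R snd r)) \<in> borel_measurable borel"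
      by (intro borel_measurable_continuous_onI continuous_intros)
    from measurable_compose[OF this fourier_xi_measurable[OF assms]] show ?thesis by (simp add: lborel_prod)
  qed
  have "(\<lambda>q::'a \<times> real \<times> 'a. heat_avg (fst (snd q)) (fourier_xi b (fst q)) (snd (snd q))) \<in> borel_measurable lborel"
    unfolding heat_avg_def
    by (rule lborel.borel_measurable_lebesgue_integral) (unfold case_prod_beta', intro borel_measurable_times m, measurable)
  then show ?thesis by simp
qed

text \<open>In \<open>X\<close> the heat representation is applied for each fixed \<open>\<xi>\<close>. In \<open>\<xi>\<close> both sides are Fourier transforms, so there the
average over \<open>\<rho>\<close> is the scalar Laplace transform at \<open>|t|\<^sup>2\<close>. The function \<open>g\<close> dominates \<open>A\<close> and justifies the exchange of the
integrals.\<close>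

lemma kernel_identity:
  fixes a A b :: "'a::euclidean_space \<times> 'a \<Rightarrow> complex"
  assumes slice: "\<And>\<xi>. integrable lborel (\<lambda>X. a (X, \<xi>))" "\<And>\<xi>. continuous_on UNIV (\<lambda>X. a (X, \<xi>))" "\<And>z. norm (a z) \<le> Ca"
    and sliceA: "\<And>\<xi>. integrable lborel (\<lambda>X. A (X, \<xi>))" "continuous_on UNIV A"
    and FTX: "\<And>\<xi> p. (\<integral>X. A (X, \<xi>) * cis (p \<bullet> X) \<partial>lborel) = of_real ((1 + (norm p)\<^sup>2) ^ Suc k) * (\<integral>X. a (X, \<xi>) * cis (p \<bullet> X) \<partial>lborel)"
    and FTxi: "\<And>X p. fourier_xi b p X = of_real ((1 + (norm p)\<^sup>2) ^ Suc k) * fourier_xi A p X"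
    and g: "integrable lborel g" "\<And>\<xi>. 0 < g \<xi>" "\<And>X \<xi>. norm (A (X, \<xi>)) \<le> g \<xi>"
  shows "fourier_xi a t c = (\<integral>\<tau>. (\<integral>\<rho>. of_real (gaussian \<bar>\<rho>\<bar> t) * heat_avg \<tau> (fourier_xi b t) c \<partial>erlang_measure k) \<partial>erlang_measure k)"
proof -
  interpret E: prob_space "erlang_measure k" by (rule prob_space_erlang_measure)
  have sE: "sigma_finite_measure (erlang_measure k)" by unfold_locales
  have Am [measurable]: "A \<in> borel_measurable borel" by (rule borel_measurable_continuous_onI[OF sliceA(2)])
  have gm [measurable]: "g \<in> borel_measurable borel" using borel_measurable_integrable[OF g(1)] by simp
  have Ac: "continuous_on UNIV (\<lambda>X. A (X, \<xi>))" for \<xi>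
    by (intro continuous_on_compose2[OF sliceA(2)] continuous_intros) auto
  define N where "N Z = complex_of_real (gaussian (1 / 4) Z / sqrt (4 * pi) ^ DIM('a))" for Z :: 'a
  have Ni: "integrable lborel N" unfolding N_def[abs_def] using heat_weight(1) by (simp only: complex_of_real_integrable_eq)
  have ha: "heat_avg \<tau> u c = (\<integral>Z. u (c + sqrt \<tau> *\<^sub>R Z) * N Z \<partial>lborel)" for \<tau> u
    by (simp only: heat_avg_def N_def mult.commute)
  define K where "K \<xi> X = A (X, \<xi>) / of_real (g \<xi>)" for \<xi> X
  have AK: "A (X, \<xi>) = of_real (g \<xi>) * K \<xi> X" for X \<xi> using g(2)[of \<xi>] by (simp add: K_def)
  have Kb: "norm (K \<xi> X) \<le> 1" for \<xi> X
    using g(2)[of \<xi>] g(3)[of X \<xi>] by (simp add: K_def norm_divide)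
  define f where "f \<xi> = of_real (g \<xi>) * cis (t \<bullet> \<xi>)" for \<xi>
  have fi: "integrable lborel f"
    unfolding f_def by (rule integrable_mult_cis) (use g(1) in simp)
  have m1: "(\<lambda>r::(('a \<times> real) \<times> 'a). K (fst (fst r)) (c + sqrt (snd (fst r)) *\<^sub>R snd r)) \<in> borel_measurable borel"
    unfolding K_def by measurable
  have Km: "(\<lambda>p::'a \<times> real. heat_avg (snd p) (K (fst p)) c) \<in> borel_measurable borel"
  proof -
    have "(\<lambda>p::'a \<times> real. heat_avg (snd p) (K (fst p)) c) \<in> borel_measurable lborel"
      unfolding ha
    proof (rule lborel.borel_measurable_lebesgue_integral)
      have "N \<in> borel_measurable borel" using borel_measurable_integrable[OF Ni] by simp
      then have "(\<lambda>r::(('a \<times> real) \<times> 'a). K (fst (fst r)) (c + sqrt (snd (fst r)) *\<^sub>R snd r) * N (snd r)) \<in> borel_measurable borel"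
        using m1 by measurable
      then show "(\<lambda>(p, Z). K (fst p) (c + sqrt (snd p) *\<^sub>R Z) * N Z) \<in> borel_measurable (lborel \<Otimes>\<^sub>M lborel)"
        by (simp add: lborel_prod case_prod_beta')
    qed
    then show ?thesis by simp
  qed
  have rep: "a (c, \<xi>) = of_real (g \<xi>) * (\<integral>\<tau>. heat_avg \<tau> (K \<xi>) c \<partial>erlang_measure k)" for \<xi>
  proof -
    have "a (c, \<xi>) = (\<integral>\<tau>. heat_avg \<tau> (\<lambda>X. A (X, \<xi>)) c \<partial>erlang_measure k)"
      by (rule heat_representation[OF slice(1) slice(2) slice(3) sliceA(1) Ac g(3) FTX])
    moreover have "heat_avg \<tau> (\<lambda>X. A (X, \<xi>)) c = of_real (g \<xi>) * heat_avg \<tau> (K \<xi>) c" for \<tau>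
      unfolding ha AK by (subst integral_mult_right_zero[symmetric]) (simp add: mult_ac)
    ultimately show ?thesis by simp
  qed
  have "fourier_xi a t c = (\<integral>\<xi>. f \<xi> * (\<integral>\<tau>. heat_avg \<tau> (K \<xi>) c * 1 \<partial>erlang_measure k) \<partial>lborel)"
    unfolding fourier_xi_def rep f_def by (simp add: mult_ac)
  also have "\<dots> = (\<integral>\<tau>. 1 * (\<integral>\<xi>. heat_avg \<tau> (K \<xi>) c * f \<xi> \<partial>lborel) \<partial>erlang_measure k)"
  proof (rule fubini_bounded[OF sigma_finite_lborel sE fi])
    show "(\<lambda>(\<xi>, \<tau>). heat_avg \<tau> (K \<xi>) c) \<in> borel_measurable (lborel \<Otimes>\<^sub>M erlang_measure k)"
    proof -
      have "(\<lambda>p. (fst p, snd p)) \<in> (lborel \<Otimes>\<^sub>M erlang_measure k) \<rightarrow>\<^sub>M (borel :: ('a \<times> real) measure)" by measurable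
      from measurable_compose[OF this Km] show ?thesis by (simp add: case_prod_beta')
    qed
    show "norm (heat_avg \<tau> (K \<xi>) c) \<le> 1" for \<xi> \<tau> by (rule heat_avg_bound[OF Kb])
  qed simp
  also have "\<dots> = (\<integral>\<tau>. heat_avg \<tau> (fourier_xi A t) c \<partial>erlang_measure k)"
  proof (rule Bochner_Integration.integral_cong[OF refl])
    fix \<tau>
    have "(\<integral>\<xi>. heat_avg \<tau> (K \<xi>) c * f \<xi> \<partial>lborel) = (\<integral>\<xi>. f \<xi> * (\<integral>Z. K \<xi> (c + sqrt \<tau> *\<^sub>R Z) * N Z \<partial>lborel) \<partial>lborel)"
      unfolding ha by (simp only: mult.commute)
    also have "\<dots> = (\<integral>Z. N Z * (\<integral>\<xi>. K \<xi> (c + sqrt \<tau> *\<^sub>R Z) * f \<xi> \<partial>lborel) \<partial>lborel)"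
    proof (rule fubini_bounded[OF sigma_finite_lborel sigma_finite_lborel fi Ni])
      show "(\<lambda>(\<xi>, Z). K \<xi> (c + sqrt \<tau> *\<^sub>R Z)) \<in> borel_measurable (lborel \<Otimes>\<^sub>M lborel)"
        unfolding K_def case_prod_beta' by measurable
    qed (rule Kb)
    also have "\<dots> = heat_avg \<tau> (fourier_xi A t) c"
      unfolding ha fourier_xi_def AK f_def by (simp add: mult_ac)
    finally show "1 * (\<integral>\<xi>. heat_avg \<tau> (K \<xi>) c * f \<xi> \<partial>lborel) = heat_avg \<tau> (fourier_xi A t) c" by simp
  qed
  also have "\<dots> = (\<integral>\<tau>. (\<integral>\<rho>. of_real (gaussian \<bar>\<rho>\<bar> t) * heat_avg \<tau> (fourier_xi b t) c \<partial>erlang_measure k) \<partial>erlang_measure k)"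
  proof (rule Bochner_Integration.integral_cong[OF refl])
    fix \<tau>
    define P where "P = (1 + (norm t)\<^sup>2) ^ Suc k"
    have P: "complex_of_real P \<noteq> 0"
      unfolding P_def of_real_eq_0_iff by (rule power_not_zero) (use zero_le_power2[of "norm t"] in linarith)
    have 1: "(\<integral>\<rho>. complex_of_real (gaussian \<bar>\<rho>\<bar> t) \<partial>erlang_measure k) = of_real (1 / P)"
      unfolding integral_complex_of_real erlang_laplace[OF zero_le_power2] P_def ..
    have 2: "heat_avg \<tau> (fourier_xi b t) c = of_real P * heat_avg \<tau> (fourier_xi A t) c"
      unfolding ha FTxi P_def[symmetric] by (subst integral_mult_right_zero[symmetric]) (simp add: mult_ac)
    have e: "(\<integral>\<rho>. of_real (gaussian \<bar>\<rho>\<bar> t) * heat_avg \<tau> (fourier_xi b t) c \<partial>erlang_measure k)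
      = of_real (1 / P) * (of_real P * heat_avg \<tau> (fourier_xi A t) c)"
      unfolding integral_mult_left_zero 1 2 ..
    show "heat_avg \<tau> (fourier_xi A t) c = (\<integral>\<rho>. of_real (gaussian \<bar>\<rho>\<bar> t) * heat_avg \<tau> (fourier_xi b t) c \<partial>erlang_measure k)"
      unfolding e using P by simp
  qed
  finally show ?thesis .
qed

text \<open>Averaging over \<open>(\<tau>, \<rho>)\<close> commutes with the pairing, and for each \<open>(\<tau>, \<rho>)\<close> the pairing is the one of \<open>b\<close> with the
mollified Wigner transform.\<close>

lemma bilinear_estimate:
  fixes a b :: "'a::euclidean_space \<times> 'a \<Rightarrow> complex"
  assumes id: "\<And>t c. fourier_xi a t c = (\<integral>\<tau>. (\<integral>\<rho>. of_real (gaussian \<bar>\<rho>\<bar> t) * heat_avg \<tau> (fourier_xi b t) c \<partial>erlang_measure k) \<partial>erlang_measure k)"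
    and b: "integrable lborel b" "\<And>z. norm (b z) \<le> B"
    and gb: "integrable lborel g" "\<And>X \<xi>. norm (b (X, \<xi>)) \<le> g \<xi>"
    and I: "(\<integral>\<^sup>+\<tau>. \<integral>\<^sup>+\<rho>. ennreal ((1 + 1 / (16 * \<tau> * \<rho>)) powr (DIM('a) / 4)) \<partial>erlang_measure k \<partial>erlang_measure k) \<le> ennreal I" and I0: "0 \<le> I"
    and f: "integrable lborel f" and h: "integrable lborel h"
    and f2: "square_integrable f" and h2: "square_integrable h"
  shows "norm (\<integral>w. (f (snd w) * cnj (h (fst w))) * fourier_xi a (fst w - snd w) ((fst w + snd w) /\<^sub>R 2) \<partial>lborel)
    \<le> B * (2 * pi) ^ DIM('a) * I * (L2_norm f * L2_norm h)"
proof -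
  interpret E: prob_space "erlang_measure k" by (rule prob_space_erlang_measure)
  interpret EE: pair_prob_space "erlang_measure k" "erlang_measure k" ..
  have sEE: "sigma_finite_measure (erlang_measure k \<Otimes>\<^sub>M erlang_measure k)" by unfold_locales
  define H where "H w = f (snd w) * cnj (h (fst w))" for w
  have ch: "integrable lborel (\<lambda>x. cnj (h x))" using h by simp
  have H: "integrable lborel H"
    using integrable_lborel_prod_mult(1)[OF ch f] by (simp add: H_def[abs_def] mult.commute)
  have Hm [measurable]: "H \<in> borel_measurable borel" using borel_measurable_integrable[OF H] by simp
  have bm: "b \<in> borel_measurable borel" using borel_measurable_integrable[OF b(1)] by simp
  have B0: "0 \<le> B" using b(2)[of undefined] norm_ge_zero order_trans by blast
  define Q where "Q w q = of_real (exp (- \<bar>snd q\<bar> * (norm (fst w - snd w))\<^sup>2)) * heat_avg (fst q) (fourier_xi b (fst w - snd w)) ((fst w + snd w) /\<^sub>R 2)"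
    for w :: "'a \<times> 'a" and q :: "real \<times> real"
  define C where "C = (\<integral>\<xi>. g \<xi> \<partial>lborel)"
  have hb: "norm (heat_avg \<tau> (fourier_xi b t) c) \<le> C" for \<tau> t c
    unfolding C_def by (intro heat_avg_bound fourier_xi_bound gb)
  have Qb: "norm (Q w q) \<le> C" for w q
  proof -
    have "norm (Q w q) \<le> 1 * C"
      unfolding Q_def norm_mult by (intro mult_mono hb) auto
    then show ?thesis by simp
  qed
  have Qm: "(\<lambda>(w, q). Q w q) \<in> borel_measurable (lborel \<Otimes>\<^sub>M (erlang_measure k \<Otimes>\<^sub>M erlang_measure k))"
  proof -
    have "(\<lambda>p::('a \<times> 'a) \<times> (real \<times> real). (fst (fst p) - snd (fst p), fst (snd p), (fst (fst p) + snd (fst p)) /\<^sub>R 2))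
      \<in> (lborel \<Otimes>\<^sub>M (erlang_measure k \<Otimes>\<^sub>M erlang_measure k)) \<rightarrow>\<^sub>M (borel :: ('a \<times> real \<times> 'a) measure)" by measurable
    from measurable_compose[OF this heat_avg_fourier_xi_measurable[OF bm]]
    have [measurable]: "(\<lambda>p::('a \<times> 'a) \<times> (real \<times> real). heat_avg (fst (snd p)) (fourier_xi b (fst (fst p) - snd (fst p))) ((fst (fst p) + snd (fst p)) /\<^sub>R 2))
      \<in> borel_measurable (lborel \<Otimes>\<^sub>M (erlang_measure k \<Otimes>\<^sub>M erlang_measure k))" by simp
    show ?thesis unfolding Q_def case_prod_beta' by measurable
  qed
  have Qq: "Q w \<in> borel_measurable (erlang_measure k \<Otimes>\<^sub>M erlang_measure k)" for w
    using measurable_compose[OF measurable_Pair1' Qm, of w] by simp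
  have idQ: "fourier_xi a (fst w - snd w) ((fst w + snd w) /\<^sub>R 2) = (\<integral>q. Q w q * 1 \<partial>(erlang_measure k \<Otimes>\<^sub>M erlang_measure k))" for w
  proof -
    have "integrable (erlang_measure k \<Otimes>\<^sub>M erlang_measure k) (Q w)"
      by (rule EE.P.integrable_const_bound[of _ C]) (use Qb Qq in auto)
    from EE.integral_fst'[OF this]
    have e: "(\<integral>q. Q w q \<partial>(erlang_measure k \<Otimes>\<^sub>M erlang_measure k)) = (\<integral>\<tau>. \<integral>\<rho>. Q w (\<tau>, \<rho>) \<partial>erlang_measure k \<partial>erlang_measure k)" by simp
    show ?thesis unfolding mult_1_right e id by (simp only: Q_def fst_conv snd_conv)
  qed
  define L where "L = L2_norm f * L2_norm h"
  have L0: "0 \<le> L" by (simp add: L_def L2_norm_def)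
  have pos: "AE q in erlang_measure k \<Otimes>\<^sub>M erlang_measure k. 0 < fst q \<and> 0 < snd q"
  proof (rule EE.AE_pair_measure)
    show "{q \<in> space (erlang_measure k \<Otimes>\<^sub>M erlang_measure k). 0 < fst q \<and> 0 < snd q} \<in> sets (erlang_measure k \<Otimes>\<^sub>M erlang_measure k)" by measurable
    show "AE \<tau> in erlang_measure k. AE \<rho> in erlang_measure k. 0 < fst (\<tau>, \<rho>) \<and> 0 < snd (\<tau>, \<rho>)"
      using AE_erlang_pos
    proof eventually_elim
      case (elim \<tau>)
      show ?case using AE_erlang_pos[of k] by eventually_elim (use elim in simp)
    qed
  qed
  have swap: "(\<integral>w. H w * (\<integral>q. Q w q * 1 \<partial>(erlang_measure k \<Otimes>\<^sub>M erlang_measure k)) \<partial>lborel) = (\<integral>q. 1 * (\<integral>w. Q w q * H w \<partial>lborel) \<partial>(erlang_measure k \<Otimes>\<^sub>M erlang_measure k))"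
    by (rule fubini_bounded[OF sigma_finite_lborel sEE H _ Qm Qb]) simp
  have each: "norm (\<integral>w. Q w q * H w \<partial>lborel) \<le> B * (2 * pi) ^ DIM('a) * L * (1 + 1 / (16 * fst q * snd q)) powr (DIM('a) / 4)"
    if q: "0 < fst q" "0 < snd q" for q
  proof -
    obtain \<tau> \<rho> where q_eq: "q = (\<tau>, \<rho>)" by (cases q)
    have \<tau>: "0 < \<tau>" and \<rho>: "0 < \<rho>" using q by (auto simp: q_eq)
    \<comment> \<open>The normalisation of the heat kernel that \<open>wigner_kernel\<close> omits.\<close>
    define s where "s = sqrt (4 * pi * \<tau>) ^ DIM('a)"
    have s: "0 < s" using \<tau> by (simp add: s_def)
    have Qw: "of_real s * Q w q = (\<integral>z. b z * wigner_kernel \<tau> \<rho> z w \<partial>lborel)" for w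
    proof -
      define t c where "t = fst w - snd w" and "c = (fst w + snd w) /\<^sub>R 2"
      have xm: "fourier_xi b t \<in> borel_measurable borel"
        using measurable_compose[OF _ fourier_xi_measurable[OF bm], of "\<lambda>X. (t, X)" borel] by simp
      have i: "integrable lborel (\<lambda>z. b z * wigner_kernel \<tau> \<rho> z w)"
      proof (rule integrable_mult_bounded[OF b(1) _ norm_wigner_kernel_le[OF \<tau> less_imp_le[OF \<rho>]]])
        show "(\<lambda>z. wigner_kernel \<tau> \<rho> z w) \<in> borel_measurable lborel" unfolding wigner_kernel_def by measurable
      qed
      have "(\<integral>z. b z * wigner_kernel \<tau> \<rho> z w \<partial>lborel) = (\<integral>X. \<integral>\<xi>. b (X, \<xi>) * wigner_kernel \<tau> \<rho> (X, \<xi>) w \<partial>lborel \<partial>lborel)"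
        by (rule lborel_prod_integral[OF i])
      also have "\<dots> = (\<integral>X. of_real (gaussian \<rho> t) * (of_real (gaussian (1 / (4 * \<tau>)) (X - c)) * fourier_xi b t X) \<partial>lborel)"
      proof (rule Bochner_Integration.integral_cong[OF refl])
        fix X
        have "b (X, \<xi>) * wigner_kernel \<tau> \<rho> (X, \<xi>) w = (of_real (gaussian \<rho> t) * of_real (gaussian (1 / (4 * \<tau>)) (X - c))) * (b (X, \<xi>) * cis (t \<bullet> \<xi>))" for \<xi>
          unfolding wigner_kernel_def t_def c_def fst_conv snd_conv of_real_mult by algebra
        then show "(\<integral>\<xi>. b (X, \<xi>) * wigner_kernel \<tau> \<rho> (X, \<xi>) w \<partial>lborel) = of_real (gaussian \<rho> t) * (of_real (gaussian (1 / (4 * \<tau>)) (X - c)) * fourier_xi b t X)"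
          unfolding fourier_xi_def by (simp only: integral_mult_right_zero mult.assoc)
      qed
      also have "\<dots> = of_real (gaussian \<rho> t) * (of_real s * heat_avg \<tau> (fourier_xi b t) c)"
        unfolding integral_mult_right_zero s_def heat_avg_convolution[OF \<tau> xm] ..
      also have "\<dots> = of_real s * Q w q"
        using \<rho> by (simp add: Q_def q_eq t_def c_def mult_ac)
      finally show ?thesis ..
    qed
    have "of_real s * (\<integral>w. Q w q * H w \<partial>lborel) = (\<integral>w. H w * (of_real s * Q w q) \<partial>lborel)"
      by (subst integral_mult_right_zero[symmetric]) (simp add: mult_ac)
    also have "\<dots> = (\<integral>w. H w * (\<integral>z. b z * wigner_kernel \<tau> \<rho> z w \<partial>lborel) \<partial>lborel)" unfolding Qw ..
    finally have "s * norm (\<integral>w. Q w q * H w \<partial>lborel) = norm (\<integral>w. H w * (\<integral>z. b z * wigner_kernel \<tau> \<rho> z w \<partial>lborel) \<partial>lborel)"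
      using s by (metis abs_of_pos norm_mult norm_of_real)
    also have "\<dots> \<le> B * ((2 * pi) ^ DIM('a) * (s * (1 + 1 / (16 * \<tau> * \<rho>)) powr (DIM('a) / 4)) * L)"
      unfolding H_def s_def L_def by (rule smoothed_symbol_pairing[OF \<tau> \<rho> f h f2 h2 b])
    also have "\<dots> = s * (B * (2 * pi) ^ DIM('a) * L * (1 + 1 / (16 * fst q * snd q)) powr (DIM('a) / 4))"
      by (simp add: q_eq mult_ac)
    finally show ?thesis using s by (simp only: mult_le_cancel_left_pos)
  qed
  have "ennreal (norm (\<integral>w. H w * fourier_xi a (fst w - snd w) ((fst w + snd w) /\<^sub>R 2) \<partial>lborel))
    = ennreal (norm (\<integral>q. (\<integral>w. Q w q * H w \<partial>lborel) \<partial>(erlang_measure k \<Otimes>\<^sub>M erlang_measure k)))"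
    unfolding idQ swap by simp
  also have "\<dots> \<le> (\<integral>\<^sup>+q. ennreal (norm (\<integral>w. Q w q * H w \<partial>lborel)) \<partial>(erlang_measure k \<Otimes>\<^sub>M erlang_measure k))"
    by (rule norm_integral_le_nn_integral)
  also have "\<dots> \<le> (\<integral>\<^sup>+q. ennreal (B * (2 * pi) ^ DIM('a) * L) * ennreal ((1 + 1 / (16 * fst q * snd q)) powr (DIM('a) / 4)) \<partial>(erlang_measure k \<Otimes>\<^sub>M erlang_measure k))"
  proof (rule nn_integral_mono_AE)
    show "AE q in erlang_measure k \<Otimes>\<^sub>M erlang_measure k. ennreal (norm (\<integral>w. Q w q * H w \<partial>lborel)) \<le> ennreal (B * (2 * pi) ^ DIM('a) * L) * ennreal ((1 + 1 / (16 * fst q * snd q)) powr (DIM('a) / 4))"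
      using pos
    proof eventually_elim
      case (elim q)
      then show ?case using each[of q] B0 L0 by (simp add: ennreal_mult[symmetric] ennreal_leI)
    qed
  qed
  also have "\<dots> = ennreal (B * (2 * pi) ^ DIM('a) * L) * (\<integral>\<^sup>+q. ennreal ((1 + 1 / (16 * fst q * snd q)) powr (DIM('a) / 4)) \<partial>(erlang_measure k \<Otimes>\<^sub>M erlang_measure k))"
    by (rule nn_integral_cmult) measurable
  also have "(\<integral>\<^sup>+q. ennreal ((1 + 1 / (16 * fst q * snd q)) powr (DIM('a) / 4)) \<partial>(erlang_measure k \<Otimes>\<^sub>M erlang_measure k))
    = (\<integral>\<^sup>+\<tau>. \<integral>\<^sup>+\<rho>. ennreal ((1 + 1 / (16 * \<tau> * \<rho>)) powr (DIM('a) / 4)) \<partial>erlang_measure k \<partial>erlang_measure k)"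
    by (subst E.nn_integral_fst[symmetric]) auto
  also have "ennreal (B * (2 * pi) ^ DIM('a) * L) * \<dots> \<le> ennreal (B * (2 * pi) ^ DIM('a) * L) * ennreal I"
    by (intro mult_left_mono I) simp
  also have "\<dots> = ennreal (B * (2 * pi) ^ DIM('a) * I * L)"
    using B0 L0 I0 by (simp add: ennreal_mult[symmetric] mult_ac)
  finally show ?thesis unfolding H_def L_def[symmetric]
    using B0 L0 I0 by (simp add: ennreal_le_iff)
qed

section \<open>The constant\<close>

lemma nn_integral_erlang_measure:
  assumes "f \<in> borel_measurable borel"
  shows "(\<integral>\<^sup>+\<tau>. f \<tau> \<partial>erlang_measure k) = (\<integral>\<^sup>+x. ennreal (erlang_density k 1 x) * f x \<partial>lborel)"
  unfolding erlang_measure_def using assms by (subst nn_integral_density) auto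

text \<open>The density of the law times \<open>\<tau>\<^sup>-\<^sup>d\<^sup>/\<^sup>4\<close> behaves like \<open>\<tau>\<close> to the power \<open>[d/4] - d/4 \<ge> -3/4\<close> near \<open>0\<close>; the interval \<open>[0, 1]\<close>
contributes at most \<open>4\<close> and the tail at most \<open>1\<close>.\<close>

lemma erlang_negative_moment:
  "(\<integral>\<^sup>+\<tau>. ennreal (\<tau> powr (- (real d / 4))) \<partial>erlang_measure (d div 4)) \<le> 5"
proof -
  define k where "k = d div 4"
  define p where "p = real d / 4"
  have "d = 4 * k + d mod 4" "d mod 4 < 4" by (simp_all add: k_def)
  then have "4 * k \<le> d" "d \<le> 4 * k + 3" by linarith+
  then have "real (4 * k) \<le> real d" "real d \<le> real (4 * k + 3)" by (simp_all only: of_nat_le_iff)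
  then have pk: "real k \<le> p" "p \<le> real k + 3 / 4" by (auto simp: p_def)
  have pt: "ennreal (erlang_density k 1 x) * ennreal (x powr (- p)) \<le> ennreal (indicator {0..1} x * x powr (- (3 / 4))) + ennreal (erlang_density 0 1 x)" for x
  proof (cases "0 < x")
    case True
    have fk: "1 \<le> (fact k :: real)" by (rule fact_ge_1)
    have "erlang_density k 1 x * x powr (- p) = x powr (real k - p) * exp (- x) / fact k"
      using True by (simp add: erlang_density_def powr_realpow[symmetric] powr_add[symmetric] powr_diff powr_minus divide_inverse)
    also have "\<dots> \<le> x powr (real k - p) * exp (- x)"
    proof -
      have "a / f \<le> a" if "0 \<le> a" "1 \<le> f" for a f :: real
        using that by (simp add: divide_le_eq mult_le_cancel_left1)
      then show ?thesis using fk by simp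
    qed
    also have "\<dots> \<le> indicator {0..1} x * x powr (- (3 / 4)) + erlang_density 0 1 x"
    proof (cases "x \<le> 1")
      case le: True
      have "x powr (real k - p) \<le> x powr (- (3 / 4))"
        using True le pk by (intro powr_mono') auto
      moreover have "exp (- x) \<le> 1" using True by simp
      ultimately have "x powr (real k - p) * exp (- x) \<le> x powr (- (3 / 4)) * 1"
        by (intro mult_mono) auto
      moreover have "0 \<le> erlang_density 0 1 x" by simp
      moreover have "indicator {0..1} x * x powr (- (3 / 4)) = x powr (- (3 / 4))" using True le by simp
      ultimately show ?thesis by linarith
    next
      case False
      then have "x powr (real k - p) \<le> x powr 0" using pk by (intro powr_mono) auto
      then have "x powr (real k - p) * exp (- x) \<le> 1 * exp (- x)" using False by (intro mult_right_mono) auto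
      then show ?thesis using False by (simp add: erlang_density_def)
    qed
    finally show ?thesis
      by (simp add: ennreal_mult[symmetric] ennreal_plus[symmetric] ennreal_leI del: ennreal_plus)
  next
    case False
    then have "x powr (- p) = 0 \<or> erlang_density k 1 x = 0" by (cases "x = 0") (auto simp: erlang_density_def)
    then show ?thesis by auto
  qed
  have "((\<lambda>x::real. x powr (- (3 / 4))) has_integral (1 powr (- (3 / 4) + 1) / (- (3 / 4) + 1))) {0..1}"
    by (rule has_integral_powr_from_0) auto
  then have "((\<lambda>x::real. x powr (- (3 / 4))) has_integral 4) {0..1}" by simp
  then have i1: "(\<integral>\<^sup>+x. ennreal (indicator {0..1} x * x powr (- (3 / 4))) \<partial>lborel) = ennreal 4"
    by (intro nn_integral_has_integral_lebesgue) auto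
  have i2: "(\<integral>\<^sup>+x. ennreal (erlang_density 0 1 x) \<partial>lborel) = 1"
    using nn_integral_erlang_ith_moment[of 1 0 0] by simp
  have "(\<integral>\<^sup>+\<tau>. ennreal (\<tau> powr (- p)) \<partial>erlang_measure k) = (\<integral>\<^sup>+x. ennreal (erlang_density k 1 x) * ennreal (x powr (- p)) \<partial>lborel)"
    by (rule nn_integral_erlang_measure) measurable
  also have "\<dots> \<le> (\<integral>\<^sup>+x. ennreal (indicator {0..1} x * x powr (- (3 / 4))) + ennreal (erlang_density 0 1 x) \<partial>lborel)"
    by (intro nn_integral_mono pt)
  also have "\<dots> = ennreal 4 + 1"
    using i1 i2 by (subst nn_integral_add) auto
  also have "\<dots> = 5" by (simp flip: ennreal_numeral ennreal_1 ennreal_plus)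
  finally show ?thesis by (simp add: p_def k_def)
qed

text \<open>Since \<open>1 + y \<le> 2 max(1, y)\<close>, the integrand is at most \<open>2\<^sup>d\<^sup>/\<^sup>4 (1 + 2\<^sup>-\<^sup>d (\<tau>\<rho>)\<^sup>-\<^sup>d\<^sup>/\<^sup>4)\<close>.\<close>

lemma smoothing_constant:
  "(\<integral>\<^sup>+\<tau>. \<integral>\<^sup>+\<rho>. ennreal ((1 + 1 / (16 * \<tau> * \<rho>)) powr (real d / 4)) \<partial>erlang_measure (d div 4) \<partial>erlang_measure (d div 4))
    \<le> ennreal (2 powr (real d / 4) * (1 + 25 / 2 ^ d))"
proof -
  define p where "p = real d / 4"
  have p0: "0 \<le> p" by (simp add: p_def)
  let ?E = "erlang_measure (d div 4)"
  interpret E: prob_space ?E by (rule prob_space_erlang_measure)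
  have p16: "16 powr (- p) = 1 / 2 ^ d"
  proof -
    have "(16::real) powr (- p) = (2 powr 4) powr (- p)" by simp
    also have "\<dots> = 2 powr (- real d)" by (simp only: powr_powr) (simp add: p_def)
    also have "\<dots> = 1 / 2 ^ d" by (simp add: powr_minus powr_realpow divide_inverse)
    finally show ?thesis .
  qed
  have pt: "ennreal ((1 + 1 / (16 * \<tau> * \<rho>)) powr p) \<le> ennreal (2 powr p) * (1 + ennreal (1 / 2 ^ d) * (ennreal (\<tau> powr (- p)) * ennreal (\<rho> powr (- p))))"
    if \<tau>: "0 < \<tau>" and \<rho>: "0 < \<rho>" for \<tau> \<rho>
  proof -
    define y where "y = 1 / (16 * \<tau> * \<rho>)"
    have y: "0 < y" using \<tau> \<rho> by (simp add: y_def)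
    have "(1 + y) powr p \<le> (2 * max 1 y) powr p" using y p0 by (intro powr_mono2) auto
    also have "\<dots> = 2 powr p * max 1 y powr p" using y by (intro powr_mult) 
    also have "\<dots> \<le> 2 powr p * (1 + y powr p)"
      by (intro mult_left_mono) (auto simp: max_def)
    also have "y powr p = 1 / 2 ^ d * (\<tau> powr (- p) * \<rho> powr (- p))"
    proof -
      have "y = (16 * \<tau> * \<rho>) powr (- 1)"
        using \<tau> \<rho> unfolding powr_minus y_def by (simp add: inverse_eq_divide)
      then have "y powr p = (16 * \<tau> * \<rho>) powr (- p)" by (simp only: powr_powr) simp
      also have "\<dots> = 16 powr (- p) * \<tau> powr (- p) * \<rho> powr (- p)"
        using \<tau> \<rho> by (subst powr_mult, simp, simp, subst powr_mult) auto
      finally show ?thesis unfolding p16 by (simp only: mult.assoc)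
    qed
    finally have "ennreal ((1 + y) powr p) \<le> ennreal (2 powr p * (1 + 1 / 2 ^ d * (\<tau> powr (- p) * \<rho> powr (- p))))"
      by (rule ennreal_leI)
    also have "\<dots> = ennreal (2 powr p) * (ennreal 1 + ennreal (1 / 2 ^ d) * (ennreal (\<tau> powr (- p)) * ennreal (\<rho> powr (- p))))"
      by (simp only: ennreal_mult ennreal_plus zero_le_one powr_ge_zero mult_nonneg_nonneg add_nonneg_nonneg zero_le_divide_1_iff zero_le_power zero_le_numeral)
    finally show ?thesis unfolding y_def ennreal_1 .
  qed
  have "(\<integral>\<^sup>+\<tau>. \<integral>\<^sup>+\<rho>. ennreal ((1 + 1 / (16 * \<tau> * \<rho>)) powr p) \<partial>?E \<partial>?E)
    \<le> (\<integral>\<^sup>+\<tau>. \<integral>\<^sup>+\<rho>. ennreal (2 powr p) * (1 + ennreal (1 / 2 ^ d) * (ennreal (\<tau> powr (- p)) * ennreal (\<rho> powr (- p)))) \<partial>?E \<partial>?E)"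
  proof (rule nn_integral_mono_AE)
    show "AE \<tau> in ?E. (\<integral>\<^sup>+\<rho>. ennreal ((1 + 1 / (16 * \<tau> * \<rho>)) powr p) \<partial>?E) \<le> (\<integral>\<^sup>+\<rho>. ennreal (2 powr p) * (1 + ennreal (1 / 2 ^ d) * (ennreal (\<tau> powr (- p)) * ennreal (\<rho> powr (- p)))) \<partial>?E)"
      using AE_erlang_pos
    proof eventually_elim
      fix \<tau> :: real assume \<tau>: "0 < \<tau>"
      show "(\<integral>\<^sup>+\<rho>. ennreal ((1 + 1 / (16 * \<tau> * \<rho>)) powr p) \<partial>?E) \<le> (\<integral>\<^sup>+\<rho>. ennreal (2 powr p) * (1 + ennreal (1 / 2 ^ d) * (ennreal (\<tau> powr (- p)) * ennreal (\<rho> powr (- p)))) \<partial>?E)"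
        by (rule nn_integral_mono_AE) (use AE_erlang_pos in eventually_elim, rule pt[OF \<tau>])
    qed
  qed
  also have "\<dots> = ennreal (2 powr p) * (1 + ennreal (1 / 2 ^ d) * ((\<integral>\<^sup>+\<tau>. ennreal (\<tau> powr (- p)) \<partial>?E) * (\<integral>\<^sup>+\<rho>. ennreal (\<rho> powr (- p)) \<partial>?E)))"
    by (simp add: nn_integral_cmult nn_integral_add nn_integral_multc E.emeasure_space_1[simplified])
  also have "\<dots> \<le> ennreal (2 powr p) * (1 + ennreal (1 / 2 ^ d) * (5 * 5))"
    unfolding p_def by (intro mult_left_mono add_mono mult_mono erlang_negative_moment) auto
  also have "\<dots> = ennreal (2 powr p * (1 + 25 / 2 ^ d))"
  proof -
    have "(5 * 5 :: ennreal) = ennreal 25" by (simp flip: ennreal_numeral ennreal_mult)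
    moreover have "ennreal (1 / 2 ^ d) * ennreal 25 = ennreal (25 / 2 ^ d)"
      by (subst ennreal_mult[symmetric]) auto
    moreover have "1 + ennreal (25 / 2 ^ d) = ennreal (1 + 25 / 2 ^ d)"
      by (subst ennreal_plus) auto
    ultimately show ?thesis by (simp only:) (rule ennreal_mult[symmetric], auto)
  qed
  finally show ?thesis by (simp add: p_def)
qed

lemma Gamma_half_integer_le:
  assumes "real n / 2 \<le> K" "1 \<le> K"
  shows "Gamma (real n / 2 + 1) \<le> K ^ ((n + 1) div 2)"
  using assms(1)
proof (induction n rule: less_induct)
  case (less n)
  consider "n = 0" | "n = 1" | m where "n = m + 2" by (metis One_nat_def add_2_eq_Suc' not0_implies_Suc)
  then show ?case
  proof cases
    case 2
    have "sqrt pi \<le> sqrt (2\<^sup>2)" using pi_less_4 by (intro real_sqrt_le_mono) simp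
    then have "sqrt pi \<le> 2" by simp
    moreover have "Gamma (1 / 2 + 1 :: real) = 1 / 2 * Gamma (1 / 2)" by (rule Gamma_plus1) (auto dest: nonpos_Ints_nonpos)
    moreover have "Gamma (1 / 2 :: real) = sqrt pi" by (rule Gamma_one_half_real)
    ultimately have "Gamma (1 / 2 + 1 :: real) \<le> 1" by linarith
    then show ?thesis using 2 assms(2) by simp
  next
    case (3 m)
    have "Gamma (real n / 2 + 1) = Gamma ((real m / 2 + 1) + 1)" by (simp add: 3 add_divide_distrib)
    also have "\<dots> = (real m / 2 + 1) * Gamma (real m / 2 + 1)"
    proof (rule Gamma_plus1)
      have "0 < real m / 2 + 1" by simp
      then show "real m / 2 + 1 \<notin> \<int>\<^sub>\<le>\<^sub>0" by (auto dest: nonpos_Ints_nonpos)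
    qed
    also have "\<dots> \<le> K * K ^ ((m + 1) div 2)"
      using less.prems 3 assms(2) by (intro mult_mono less.IH) (auto simp: add_divide_distrib)
    also have "\<dots> = K ^ ((n + 1) div 2)" by (simp add: 3)
    finally show ?thesis .
  qed simp
qed

text \<open>The crude bound \<open>\<pi> \<le> 4\<close> replaces the powers of \<open>\<pi>\<close> by powers of \<open>8\<close> and \<open>\<surd>2\<close>.\<close>

lemma cv_gamma_lower:
  fixes d :: nat
  defines "k \<equiv> cv_order d"
  assumes S: "sqrt (Gamma (real d / 2 + 1) * (2 * real k - real d)) \<le> S" and S0: "0 < S" and G: "0 < sqrt (Gamma (real d / 2 + 1) * (2 * real k - real d))"
  shows "sqrt 2 * real k ^ 2 * 2 ^ (3 * k) * (3 * real k) ^ k * real k ^ d * real d ^ k / (4 * S * (8 * sqrt 2) ^ d) \<le> cv_gamma d"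
proof -
  have p1: "1 / 8 ^ d \<le> (2 * pi) powr (- real d)"
  proof -
    have "(2 * pi) ^ d \<le> 8 ^ d" using pi_less_4 by (intro power_mono) auto
    then have "1 / 8 ^ d \<le> 1 / (2 * pi) ^ d" by (intro divide_left_mono) auto
    also have "\<dots> = (2 * pi) powr (- real d)" by (simp only: powr_minus powr_realpow divide_inverse mult_1_left) (simp add: powr_realpow)
    finally show ?thesis .
  qed
  have p2: "1 / sqrt 2 ^ d \<le> pi powr (- (real d / 4))"
  proof -
    have "pi powr (real d / 4) \<le> 4 powr (real d / 4)" using pi_less_4 by (intro powr_mono2) auto
    also have "(4::real) powr (real d / 4) = sqrt 2 ^ d"
    proof -
      have "(4::real) powr (real d / 4) = (2 powr 2) powr (real d / 4)" by simp
      also have "\<dots> = (2 powr (1/2)) powr real d" by (simp only: powr_powr) simp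
      also have "\<dots> = sqrt 2 ^ d" by (simp add: powr_half_sqrt powr_realpow)
      finally show ?thesis .
    qed
    finally have "1 / sqrt 2 ^ d \<le> 1 / pi powr (real d / 4)" by (intro divide_left_mono) auto
    also have "\<dots> = pi powr (- (real d / 4))" by (simp only: powr_minus divide_inverse mult_1_left)
    finally show ?thesis .
  qed
  define X where "X = sqrt 2 * real k ^ 2 * 2 ^ (3 * k)"
  define Y where "Y = (3 * real k) ^ k * real k ^ d * real d ^ k"
  define Z where "Z = sqrt (Gamma (real d / 2 + 1) * (2 * real k - real d))"
  have X0: "0 \<le> X" and Y0: "0 \<le> Y" by (auto simp: X_def Y_def)
  define e1 e2 where "e1 = 1 / (8::real) ^ d" and "e2 = 1 / sqrt 2 ^ d"
  define E1 E2 where "E1 = (2 * pi) powr (- real d)" and "E2 = pi powr (- (real d / 4))"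
  have e: "0 \<le> e1" "0 \<le> e2" "e1 \<le> E1" "e2 \<le> E2" "0 \<le> E1" "0 \<le> E2"
    using p1 p2 by (auto simp: e1_def e2_def E1_def E2_def)
  have q: "u / (4 * S * (8 * sqrt 2) ^ d) = e1 * (e2 * (u / (4 * S)))" for u
    by (simp add: power_mult_distrib e1_def e2_def)
  have "sqrt 2 * real k ^ 2 * 2 ^ (3 * k) * (3 * real k) ^ k * real k ^ d * real d ^ k = X * Y"
    by (simp only: X_def Y_def mult.assoc)
  then have "sqrt 2 * real k ^ 2 * 2 ^ (3 * k) * (3 * real k) ^ k * real k ^ d * real d ^ k / (4 * S * (8 * sqrt 2) ^ d) = e1 * (e2 * (X * Y / (4 * S)))"
    by (simp only: q)
  also have "\<dots> \<le> E1 * (E2 * (X * Y / (4 * Z)))"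
  proof -
    have Z0: "0 < Z" "Z \<le> S" using G S by (auto simp: Z_def)
    have XY: "0 \<le> X * Y" using X0 Y0 by simp
    have f: "X * Y / (4 * S) \<le> X * Y / (4 * Z)"
      using Z0 S0 XY by (intro divide_left_mono) auto
    have f0: "0 \<le> X * Y / (4 * S)" using XY S0 by simp
    have h: "e2 * (X * Y / (4 * S)) \<le> E2 * (X * Y / (4 * Z))"
      by (rule mult_mono[OF e(4) f e(6) f0])
    show ?thesis by (rule mult_mono[OF e(3) h e(5) mult_nonneg_nonneg[OF e(2) f0]])
  qed
  also have "\<dots> = cv_gamma d"
  proof -
    have g: "E1 * ((s * E2 * u * v) / w) * a * b * c = E1 * (E2 * ((s * u * v) * (a * b * c) / w))" for s u v w a b c :: real
      by simp
    show ?thesis unfolding cv_gamma_def Let_def k_def[symmetric] E1_def[symmetric] E2_def[symmetric] g X_def Y_def Z_def ..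
  qed
  finally show ?thesis .
qed

lemma fourth_root:
  assumes "0 < (x::real)"
  shows "(x ^ 4) powr (1/4) = x"
proof -
  have "x ^ 4 = x powr real (4::nat)" using powr_realpow[OF assms, of 4] by (rule sym)
  then show ?thesis using assms by (simp only: powr_powr) simp
qed

text \<open>For \<open>d \<ge> 4\<close> one has \<open>k \<ge> 4\<close> and the surplus in \<open>\<gamma>\<^sub>d\<close> is so large that \<open>\<Gamma>(d/2 + 1) \<le> k\<^sup>k\<close> and \<open>1 + d \<le> 5d/4\<close>
suffice: the comparison reduces to \<open>14\<^sup>d \<le> 4\<^sup>d (49/4)\<^sup>k\<close>, which holds because \<open>d \<le> 2k\<close>. The dimensions \<open>1, 2, 3\<close>, in which \<open>k = 2\<close>, are
checked with numerical values of \<open>\<Gamma>\<close>.\<close>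

lemma constant_le_cv_gamma:
  assumes d: "1 \<le> d"
  shows "2 powr (real d / 4) * (1 + 25 / 2 ^ d) * (1 + real d) ^ cv_order d \<le> cv_gamma d"
proof -
  define k where "k = cv_order d"
  have kd: "d + 1 \<le> 2 * k" "2 * k \<le> d + 4"
  proof -
    have "d = 4 * (d div 4) + d mod 4" "d mod 4 < 4" by simp_all
    then have "d + 1 \<le> 4 * (d div 4) + 4 \<and> 4 * (d div 4) + 4 \<le> d + 4" by linarith
    then show "d + 1 \<le> 2 * k" "2 * k \<le> d + 4" unfolding k_def cv_order_def by auto
  qed
  have kd': "real d + 1 \<le> 2 * real k" "2 * real k \<le> real d + 4"
  proof -
    have "real (d + 1) \<le> real (2 * k)" "real (2 * k) \<le> real (d + 4)" using kd by (simp_all only: of_nat_le_iff)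
    then show "real d + 1 \<le> 2 * real k" "2 * real k \<le> real d + 4" by auto
  qed
  have Gpos: "0 < Gamma (real d / 2 + 1)" by (rule Gamma_real_pos) simp
  have G: "0 < sqrt (Gamma (real d / 2 + 1) * (2 * real k - real d))"
    using Gpos kd' by simp
  note low = cv_gamma_lower[of d, folded k_def, OF _ _ G]
  have s2: "sqrt 2 \<le> 1.4143" "1.4142 \<le> sqrt 2"
    by (rule real_le_lsqrt, simp, simp add: power2_eq_square) (rule real_le_rsqrt, simp add: power2_eq_square)
  consider "d = 1" | "d = 2" | "d = 3" | "4 \<le> d" using d by linarith
  then show ?thesis
  proof cases
    case 1
    have k2: "k = 2" by (simp add: k_def cv_order_def 1)
    have "Gamma (real d / 2 + 1) \<le> 1" using Gamma_half_integer_le[of d 1] 1 by simp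
    then have "Gamma (real d / 2 + 1) * (2 * real k - real d) \<le> 1 * 3" using Gpos 1 k2 by (intro mult_mono) auto
    then have "sqrt (Gamma (real d / 2 + 1) * (2 * real k - real d)) \<le> 2" by (intro real_le_lsqrt) auto
    from low[OF this] have "288 \<le> cv_gamma d" by (simp add: 1 k2)
    moreover have "(2::real) powr (1/4) \<le> 2 powr 1" by (intro powr_mono) auto
    ultimately show ?thesis using 1 by (simp add: cv_order_def)
  next
    case 2
    have k2: "k = 2" by (simp add: k_def cv_order_def 2)
    have "Gamma (2::real) = 1" using Gamma_fact[of 1, where 'a=real] by simp
    then have "sqrt (Gamma (real d / 2 + 1) * (2 * real k - real d)) \<le> sqrt 2" by (simp add: 2 k2)
    from low[OF this] have "288 \<le> cv_gamma d" by (simp add: 2 k2)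
    moreover have "(2::real) powr (1/2) \<le> 1.5" using s2 by (simp add: powr_half_sqrt)
    ultimately show ?thesis using 2 by (simp add: cv_order_def)
  next
    case 3
    have k2: "k = 2" by (simp add: k_def cv_order_def 3)
    have "Gamma (real d / 2 + 1) \<le> 1.5"
    proof -
      have "sqrt pi \<le> sqrt (2\<^sup>2)" using pi_less_4 by (intro real_sqrt_le_mono) simp
      then have "sqrt pi \<le> 2" by simp
      moreover have "Gamma (1 / 2 + 1 :: real) = 1 / 2 * Gamma (1 / 2)" by (rule Gamma_plus1) (auto dest: nonpos_Ints_nonpos)
      moreover have "Gamma (1 / 2 :: real) = sqrt pi" by (rule Gamma_one_half_real)
      moreover have "Gamma (3 / 2 + 1 :: real) = 3 / 2 * Gamma (3 / 2)"
        by (rule Gamma_plus1) (auto dest: nonpos_Ints_nonpos)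
      ultimately show ?thesis by (simp add: 3)
    qed
    then have "sqrt (Gamma (real d / 2 + 1) * (2 * real k - real d)) \<le> 1.25"
      using Gpos 3 k2 by (intro real_le_lsqrt) (auto simp: power2_eq_square)
    from low[OF this] have "129 \<le> cv_gamma d" by (simp add: 3 k2 eval_nat_numeral)
    moreover have "(2::real) powr (3/4) \<le> 1.7"
    proof -
      have "(2::real) powr (3/4) = 8 powr (1/4)" using powr_powr[of "2::real" 3 "1/4"] by simp
      also have "\<dots> \<le> (1.7 ^ 4) powr (1/4)" by (intro powr_mono2) (auto simp: eval_nat_numeral)
      also have "\<dots> = 1.7" by (rule fourth_root) simp
      finally show ?thesis .
    qed
    ultimately show ?thesis using 3 by (simp add: cv_order_def)
  next
    case 4
    have k4: "4 \<le> k" using div_le_mono[OF 4, of 4] by (simp add: k_def cv_order_def)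
    define m where "m = d div 4 + 1"
    have km: "k = 2 * m" by (simp add: k_def cv_order_def m_def)
    have K: "4 \<le> real k" using k4 by simp
    have dd: "4 \<le> real d" using 4 by simp
    have "Gamma (real d / 2 + 1) \<le> real k ^ ((d + 1) div 2)"
      using kd' K by (intro Gamma_half_integer_le) auto
    also have "\<dots> \<le> real k ^ k" using kd K by (intro power_increasing) auto
    finally have Gk: "Gamma (real d / 2 + 1) \<le> real k ^ k" .
    have "Gamma (real d / 2 + 1) * (2 * real k - real d) \<le> real k ^ k * 4"
      using Gk Gpos kd' by (intro mult_mono) auto
    also have "\<dots> = (2 * real k ^ m)\<^sup>2" by (simp add: km power_mult_distrib power_mult[symmetric] mult.commute)
    finally have S: "sqrt (Gamma (real d / 2 + 1) * (2 * real k - real d)) \<le> 2 * real k ^ m"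
      using K by (intro real_le_lsqrt) auto
    have low': "sqrt 2 * real k ^ 2 * 2 ^ (3 * k) * (3 * real k) ^ k * real k ^ d * real d ^ k / (4 * (2 * real k ^ m) * (8 * sqrt 2) ^ d) \<le> cv_gamma d"
      using K by (intro low[OF S]) auto
    have a1: "2 powr (real d / 4) * (8 * sqrt 2) ^ d \<le> 14 ^ d"
    proof -
      have q: "(2::real) powr (1/4) \<le> 1.19"
      proof -
        have "(2::real) powr (1/4) \<le> (1.19 ^ 4) powr (1/4)" by (intro powr_mono2) (auto simp: eval_nat_numeral)
        also have "\<dots> = 1.19" by (rule fourth_root) simp
        finally show ?thesis .
      qed
      have "(2::real) powr (real d / 4) = (2 powr (1/4)) ^ d"
        by (simp add: powr_realpow[symmetric] powr_powr)
      then have "2 powr (real d / 4) * (8 * sqrt 2) ^ d = (2 powr (1/4) * (8 * sqrt 2)) ^ d"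
        by (simp only: power_mult_distrib)
      also have "\<dots> \<le> 14 ^ d"
      proof (rule power_mono)
        have "2 powr (1/4) * (8 * sqrt 2) \<le> 1.19 * (8 * 1.4143)" using q s2 by (intro mult_mono) auto
        also have "1.19 * (8 * 1.4143) \<le> (14::real)" by simp
        finally show "2 powr (1/4) * (8 * sqrt 2) \<le> 14" .
      qed simp
      finally show ?thesis .
    qed
    have a2: "(14::real) ^ d \<le> 4 ^ d * (49 / 4) ^ k"
    proof -
      have "(14::real) ^ d = (4 * (7 / 2)) ^ d" by simp
      also have "\<dots> = 4 ^ d * (7 / 2) ^ d" by (rule power_mult_distrib)
      also have "\<dots> \<le> 4 ^ d * (7 / 2) ^ (2 * k)" using kd by (intro mult_left_mono power_increasing) auto
      also have "(7 / 2 :: real) ^ (2 * k) = ((7 / 2)\<^sup>2) ^ k" by (rule power_mult)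
      also have "(7 / 2 :: real)\<^sup>2 = 49 / 4" by (simp add: power2_eq_square)
      finally show ?thesis .
    qed
    have a3: "(1 + real d) ^ k \<le> (5 / 4) ^ k * real d ^ k"
      unfolding power_mult_distrib[symmetric] using dd by (intro power_mono) auto
    have a4: "1 + 25 / 2 ^ d \<le> (2.6::real)"
    proof -
      have "(2::real) ^ 4 \<le> 2 ^ d" using 4 by (intro power_increasing) auto
      then have "25 / 2 ^ d \<le> 25 / (2 ^ 4 :: real)" by (intro divide_left_mono) auto
      also have "\<dots> \<le> 1.6" by simp
      finally show ?thesis by simp
    qed
    have a12: "2 powr (real d / 4) * (8 * sqrt 2) ^ d \<le> 4 ^ d * (49 / 4) ^ k"
      using a1 a2 by (rule order_trans)
    have r1: "u * v * w * (4 * (2 * x) * y) = v * (u * y) * w * (8 * x)" for u v w x y :: real by simp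
    have r2: "2.6 * (u * v) * (w * x) * (8 * y) = 2.6 * 8 * u * (v * w) * x * y" for u v w x y :: real by simp
    have "2 powr (real d / 4) * (1 + 25 / 2 ^ d) * (1 + real d) ^ k * (4 * (2 * real k ^ m) * (8 * sqrt 2) ^ d)
      = (1 + 25 / 2 ^ d) * (2 powr (real d / 4) * (8 * sqrt 2) ^ d) * (1 + real d) ^ k * (8 * real k ^ m)"
      by (rule r1)
    also have "\<dots> \<le> 2.6 * (4 ^ d * (49 / 4) ^ k) * ((5 / 4) ^ k * real d ^ k) * (8 * real k ^ m)"
      by (intro mult_mono[OF mult_mono[OF mult_mono[OF a4 a12] a3] order_refl] mult_nonneg_nonneg zero_le_power) auto
    also have "\<dots> = 2.6 * 8 * 4 ^ d * ((49 / 4) * (5 / 4)) ^ k * real d ^ k * real k ^ m"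
      unfolding r2 power_mult_distrib[of "49 / 4" "5 / 4"] ..
    also have "\<dots> \<le> (sqrt 2 * real k ^ 2) * real k ^ d * 24 ^ k * real d ^ k * real k ^ k"
    proof -
      have "2.6 * 8 \<le> (1.4142 * 4 ^ 2 :: real)" by simp
      also have "\<dots> \<le> sqrt 2 * real k ^ 2" using s2 K by (intro mult_mono power_mono) auto
      finally have t1: "2.6 * 8 \<le> sqrt 2 * (real k)\<^sup>2" .
      have t2: "(4::real) ^ d \<le> real k ^ d" using K by (intro power_mono) auto
      have t3: "((49 / 4) * (5 / 4)) ^ k \<le> (24 :: real) ^ k" by (intro power_mono) auto
      have t4: "real k ^ m \<le> real k ^ k" using K km by (intro power_increasing) auto
      show ?thesis
        by (intro mult_mono[OF mult_mono[OF mult_mono[OF mult_mono[OF t1 t2] t3] order_refl] t4] mult_nonneg_nonneg zero_le_power) auto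
    qed
    also have "\<dots> = sqrt 2 * real k ^ 2 * 2 ^ (3 * k) * (3 * real k) ^ k * real k ^ d * real d ^ k"
    proof -
      have "(24::real) ^ k = (2 ^ 3 * 3) ^ k" by simp
      also have "\<dots> = 2 ^ (3 * k) * 3 ^ k" by (simp only: power_mult_distrib power_mult)
      finally have e24: "(24::real) ^ k = 2 ^ (3 * k) * 3 ^ k" .
      have r3: "u * v * (w * x) * y * z = u * w * (x * z) * v * y" for u v w x y z :: real by simp
      show ?thesis unfolding e24 power_mult_distrib[of 3] by (rule r3)
    qed
    finally have fin: "2 powr (real d / 4) * (1 + 25 / 2 ^ d) * (1 + real d) ^ k * (4 * (2 * real k ^ m) * (8 * sqrt 2) ^ d)
      \<le> sqrt 2 * real k ^ 2 * 2 ^ (3 * k) * (3 * real k) ^ k * real k ^ d * real d ^ k" .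
    have D: "0 < 4 * (2 * real k ^ m) * (8 * sqrt 2) ^ d" using K by simp
    from fin have "2 powr (real d / 4) * (1 + 25 / 2 ^ d) * (1 + real d) ^ k
      \<le> sqrt 2 * real k ^ 2 * 2 ^ (3 * k) * (3 * real k) ^ k * real k ^ d * real d ^ k / (4 * (2 * real k ^ m) * (8 * sqrt 2) ^ d)"
      unfolding pos_le_divide_eq[OF D] .
    from this low' show ?thesis unfolding k_def[symmetric] by (rule order_trans)
  qed
qed

section \<open>Derivatives with multi-indices and powers of the Laplacian\<close>

lemma foldr_dir_deriv_cmult:
  assumes f: "smooth_fun f" and vs: "set vs \<subseteq> Basis"
  shows "foldr dir_deriv vs (\<lambda>z. c * f z) = (\<lambda>z. c * foldr dir_deriv vs f z)"
  using vs
proof (induction vs)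
  case (Cons v vs)
  have F: "smooth_fun (foldr dir_deriv vs f)" using Cons.prems by (intro smooth_deriv[OF f]) auto
  have "dir_deriv v (\<lambda>z. c * foldr dir_deriv vs f z) z = c * dir_deriv v (foldr dir_deriv vs f) z" for z
    using dir_deriv_eqI[OF has_derivative_mult_right[OF smooth_has_derivative[OF F]]] by (simp add: dir_deriv_def)
  then show ?case using Cons by simp
qed simp

lemma schwartz_cmult:
  assumes f: "schwartz_fun f"
  shows "schwartz_fun (\<lambda>z. c * f z)"
proof -
  note sf = schwartz_smooth[OF f]
  show ?thesis
    unfolding schwartz_fun_def smooth_fun_def
  proof (intro conjI allI impI)
    fix vs z assume vs: "set vs \<subseteq> (Basis :: 'a set)"
    show "foldr dir_deriv vs (\<lambda>z. c * f z) differentiable (at z)"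
      unfolding foldr_dir_deriv_cmult[OF sf vs] using smooth_differentiable[OF sf vs] by (intro differentiable_mult) auto
  next
    fix N vs assume vs: "set vs \<subseteq> (Basis :: 'a set)"
    obtain C where C: "\<And>z. norm (foldr dir_deriv vs f z) * (1 + norm z) ^ N \<le> C"
      using schwartz_decay[OF schwartz_deriv[OF f vs]] by metis
    have "norm ((1 + norm z) ^ N *\<^sub>R foldr dir_deriv vs (\<lambda>z. c * f z) z) \<le> norm c * C" for z
      unfolding foldr_dir_deriv_cmult[OF sf vs]
      using mult_left_mono[OF C[of z] norm_ge_zero[of c]]
      by (simp add: norm_mult abs_of_nonneg add_nonneg_nonneg mult_ac)
    then show "bounded (range (\<lambda>z. (1 + norm z) ^ N *\<^sub>R foldr dir_deriv vs (\<lambda>z. c * f z) z))"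
      unfolding bounded_iff by blast
  qed
qed

definition D_list :: "'a::euclidean_space list \<Rightarrow> ('a \<Rightarrow> complex) \<Rightarrow> 'a \<Rightarrow> complex" where
  "D_list vs f z = (- \<i>) ^ length vs * foldr dir_deriv vs f z"

lemma foldr_D_list:
  assumes f: "smooth_fun f" and vs: "set vs \<subseteq> Basis"
  shows "foldr (\<lambda>v f z. - \<i> * dir_deriv v f z) vs f = D_list vs f"
  using vs
proof (induction vs)
  case (Cons v vs)
  have vs: "set vs \<subseteq> Basis" and v: "v \<in> Basis" using Cons.prems by auto
  have F: "smooth_fun (foldr dir_deriv vs f)" using vs by (intro smooth_deriv[OF f])
  have "foldr (\<lambda>v f z. - \<i> * dir_deriv v f z) (v # vs) f = (\<lambda>z. - \<i> * dir_deriv v (\<lambda>z. (- \<i>) ^ length vs * foldr dir_deriv vs f z) z)"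
    using Cons.IH[OF vs] by (simp add: D_list_def[abs_def])
  also have "\<dots> = D_list (v # vs) f"
    using foldr_dir_deriv_cmult[OF F, of "[v]"] v by (simp add: D_list_def[abs_def] mult.assoc)
  finally show ?case .
qed (simp add: D_list_def[abs_def])

lemma schwartz_D_list: "schwartz_fun f \<Longrightarrow> set vs \<subseteq> Basis \<Longrightarrow> schwartz_fun (D_list vs f)"
  unfolding D_list_def[abs_def] by (intro schwartz_cmult schwartz_deriv)

lemma FT_D_list:
  fixes f :: "'a::euclidean_space \<Rightarrow> complex"
  assumes f: "schwartz_fun f" and vs: "set vs \<subseteq> Basis"
  shows "(\<integral>x. D_list vs f x * cis (p \<bullet> x) \<partial>lborel) = of_real (\<Prod>v\<leftarrow>vs. - (p \<bullet> v)) * (\<integral>x. f x * cis (p \<bullet> x) \<partial>lborel)"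
proof -
  have pr: "(- \<i>) ^ length vs * (\<Prod>v\<leftarrow>vs. - \<i> * of_real (p \<bullet> v)) = of_real (\<Prod>v\<leftarrow>vs. - (p \<bullet> v))"
    by (induction vs) (auto simp: mult_ac)
  show ?thesis
    unfolding D_list_def mult.assoc integral_mult_right_zero FT_derivs[OF assms] pr[symmetric] ..
qed

definition index_word :: "('n::finite \<Rightarrow> nat) \<Rightarrow> 'n list" where
  "index_word \<alpha> = concat (map (\<lambda>i. replicate (\<alpha> i) i) coords)"

lemma coords: "distinct (coords :: 'n::finite list)" "set (coords :: 'n list) = UNIV"
proof -
  have "\<exists>is::'n list. distinct is \<and> set is = UNIV"
    using finite_distinct_list[of "UNIV :: 'n set"] by auto
  then have "distinct (coords :: 'n list) \<and> set (coords :: 'n list) = UNIV"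
    unfolding coords_def by (rule someI_ex)
  then show "distinct (coords :: 'n list)" "set (coords :: 'n list) = UNIV" by auto
qed

lemma foldr_replicate_funpow: "foldr g (replicate n i) = g i ^^ n"
  by (induction n) auto

lemma foldr_index_word: "foldr (\<lambda>i. g i ^^ \<alpha> i) coords a = foldr g (index_word \<alpha>) a"
proof -
  have "foldr (\<lambda>i. g i ^^ \<alpha> i) is a = foldr g (concat (map (\<lambda>i. replicate (\<alpha> i) i) is)) a" for "is"
    by (induction "is") (auto simp: foldr_replicate_funpow)
  then show ?thesis by (simp add: index_word_def)
qed

lemma prod_index_word:
  fixes h :: "'n::finite \<Rightarrow> 'b::comm_monoid_mult"
  shows "(\<Prod>i\<leftarrow>index_word \<alpha>. h i) = (\<Prod>i\<in>UNIV. h i ^ \<alpha> i)"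
proof -
  have "(\<Prod>i\<leftarrow>concat (map (\<lambda>i. replicate (\<alpha> i) i) is). h i) = (\<Prod>i\<leftarrow>is. h i ^ \<alpha> i)" for "is"
    by (induction "is") (auto simp: prod_list_replicate)
  then show ?thesis
    using prod.distinct_set_conv_list[OF coords(1)[where 'n='n], of "\<lambda>i. h i ^ \<alpha> i"] coords(2)[where 'n='n]
    by (simp add: index_word_def)
qed

definition axes :: "('n::finite \<Rightarrow> nat) \<Rightarrow> (real ^ 'n) list" where
  "axes \<alpha> = map (\<lambda>i. axis i 1) (index_word \<alpha>)"

lemma axes_Basis: "set (axes \<alpha>) \<subseteq> Basis"
  by (auto simp: axes_def Basis_vec_def)

lemma pair_Basis: "set vs \<subseteq> Basis \<Longrightarrow> set (map (\<lambda>v. (v, 0)) vs) \<subseteq> Basis"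
  "set vs \<subseteq> Basis \<Longrightarrow> set (map (\<lambda>v. (0, v)) vs) \<subseteq> Basis"
  by (auto simp: Basis_prod_def)

lemma D_x_eq:
  assumes "smooth_fun a"
  shows "D_x \<alpha> a = D_list (map (\<lambda>v. (v, 0)) (axes \<alpha>)) a"
  unfolding foldr_D_list[OF assms pair_Basis(1)[OF axes_Basis], symmetric] D_x_def foldr_index_word
  by (simp add: axes_def foldr_map o_def)

lemma D_xi_eq:
  assumes "smooth_fun a"
  shows "D_xi \<beta> a = D_list (map (\<lambda>v. (0, v)) (axes \<beta>)) a"
  unfolding foldr_D_list[OF assms pair_Basis(2)[OF axes_Basis], symmetric] D_xi_def foldr_index_word
  by (simp add: axes_def foldr_map o_def)

lemma schwartz_D_x: "schwartz_fun a \<Longrightarrow> schwartz_fun (D_x \<alpha> a)"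
  by (simp only: D_x_eq schwartz_smooth schwartz_D_list pair_Basis axes_Basis)

lemma schwartz_D_xi: "schwartz_fun a \<Longrightarrow> schwartz_fun (D_xi \<alpha> a)"
  by (simp only: D_xi_eq schwartz_smooth schwartz_D_list pair_Basis axes_Basis)

lemma slice_x:
  fixes a :: "'a::euclidean_space \<times> 'a \<Rightarrow> complex"
  assumes a: "schwartz_fun a"
  shows "schwartz_fun (\<lambda>X. a (X, \<xi>))"
    and "set vs \<subseteq> Basis \<Longrightarrow> D_list vs (\<lambda>X. a (X, \<xi>)) X = D_list (map (\<lambda>v. (v, 0)) vs) a (X, \<xi>)"
proof -
  have S: "bounded_linear (\<lambda>x::'a. (x, 0::'a))"
    by (rule bounded_linear_Pair) (auto intro: bounded_linear_ident bounded_linear_zero)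
  have z: "(0, \<xi>) + (x, 0) = (x, \<xi>)" for x :: 'a by simp
  have c: "(v, 0) = 1 *\<^sub>R (v, 0)" for v :: 'a by simp
  have J: "(v, 0) \<in> Basis" if "v \<in> Basis" for v :: 'a using that by (auto simp: Basis_prod_def)
  show "schwartz_fun (\<lambda>X. a (X, \<xi>))"
  proof -
    have "schwartz_fun (\<lambda>x. a ((0, \<xi>) + (x, 0)))"
      by (rule schwartz_affine[OF a S c J, where K = 1]) (simp_all add: z norm_fst_le)
    then show ?thesis by (simp only: z)
  qed
  show "set vs \<subseteq> Basis \<Longrightarrow> D_list vs (\<lambda>X. a (X, \<xi>)) X = D_list (map (\<lambda>v. (v, 0)) vs) a (X, \<xi>)"
    using foldr_dir_deriv_affine[OF schwartz_smooth[OF a] S c J, of vs "(0, \<xi>)"] by (simp add: z D_list_def map_replicate_const)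
qed

lemma slice_xi:
  fixes a :: "'a::euclidean_space \<times> 'a \<Rightarrow> complex"
  assumes a: "schwartz_fun a"
  shows "schwartz_fun (\<lambda>\<xi>. a (X, \<xi>))"
    and "set vs \<subseteq> Basis \<Longrightarrow> D_list vs (\<lambda>\<xi>. a (X, \<xi>)) \<xi> = D_list (map (\<lambda>v. (0, v)) vs) a (X, \<xi>)"
proof -
  have S: "bounded_linear (\<lambda>x::'a. (0::'a, x))"
    by (rule bounded_linear_Pair) (auto intro: bounded_linear_ident bounded_linear_zero)
  have z: "(X, 0) + (0, x) = (X, x)" for x :: 'a by simp
  have c: "(0, v) = 1 *\<^sub>R (0, v)" for v :: 'a by simp
  have J: "(0, v) \<in> Basis" if "v \<in> Basis" for v :: 'a using that by (auto simp: Basis_prod_def)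
  show "schwartz_fun (\<lambda>\<xi>. a (X, \<xi>))"
  proof -
    have "schwartz_fun (\<lambda>x. a ((X, 0) + (0, x)))"
      by (rule schwartz_affine[OF a S c J, where K = 1]) (simp_all add: z norm_snd_le)
    then show ?thesis by (simp only: z)
  qed
  show "set vs \<subseteq> Basis \<Longrightarrow> D_list vs (\<lambda>\<xi>. a (X, \<xi>)) \<xi> = D_list (map (\<lambda>v. (0, v)) vs) a (X, \<xi>)"
    using foldr_dir_deriv_affine[OF schwartz_smooth[OF a] S c J, of vs "(X, 0)"] by (simp add: z D_list_def map_replicate_const)
qed

lemma even_symbol:
  fixes p :: "real ^ 'n::finite"
  shows "(\<Prod>v\<leftarrow>axes (\<lambda>i. 2 * \<gamma> i). - (p \<bullet> v)) = (\<Prod>i\<in>UNIV. ((p $ i)\<^sup>2) ^ \<gamma> i)"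
proof -
  have "(\<Prod>v\<leftarrow>axes (\<lambda>i. 2 * \<gamma> i). - (p \<bullet> v)) = (\<Prod>i\<leftarrow>index_word (\<lambda>i. 2 * \<gamma> i). - (p $ i))"
    by (simp add: axes_def o_def inner_axis)
  also have "\<dots> = (\<Prod>i\<in>UNIV. (- (p $ i)) ^ (2 * \<gamma> i))" by (rule prod_index_word)
  also have "\<dots> = (\<Prod>i\<in>UNIV. ((p $ i)\<^sup>2) ^ \<gamma> i)" by (simp add: power_mult)
  finally show ?thesis .
qed

lemma FT_D_x:
  fixes a :: "(real ^ 'n::finite) \<times> (real ^ 'n) \<Rightarrow> complex"
  assumes a: "schwartz_fun a"
  shows "(\<integral>X. D_x (\<lambda>i. 2 * \<gamma> i) a (X, \<xi>) * cis (p \<bullet> X) \<partial>lborel)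
    = of_real (\<Prod>i\<in>UNIV. ((p $ i)\<^sup>2) ^ \<gamma> i) * (\<integral>X. a (X, \<xi>) * cis (p \<bullet> X) \<partial>lborel)"
  unfolding D_x_eq[OF schwartz_smooth[OF a]] slice_x(2)[OF a axes_Basis, symmetric]
    FT_D_list[OF slice_x(1)[OF a] axes_Basis] even_symbol ..

lemma FT_D_xi:
  fixes a :: "(real ^ 'n::finite) \<times> (real ^ 'n) \<Rightarrow> complex"
  assumes a: "schwartz_fun a"
  shows "(\<integral>\<xi>. D_xi (\<lambda>i. 2 * \<gamma> i) a (X, \<xi>) * cis (p \<bullet> \<xi>) \<partial>lborel)
    = of_real (\<Prod>i\<in>UNIV. ((p $ i)\<^sup>2) ^ \<gamma> i) * (\<integral>\<xi>. a (X, \<xi>) * cis (p \<bullet> \<xi>) \<partial>lborel)"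
  unfolding D_xi_eq[OF schwartz_smooth[OF a]] slice_xi(2)[OF a axes_Basis, symmetric]
    FT_D_list[OF slice_xi(1)[OF a] axes_Basis] even_symbol ..

text \<open>Expanding \<open>(1 + \<Sum>\<^sub>i p\<^sub>i\<^sup>2)\<^sup>m\<close> factor by factor, each of the \<open>m\<close> factors contributes either \<open>1\<close> (\<open>None\<close>) or some \<open>p\<^sub>i\<^sup>2\<close> (\<open>Some i\<close>). All
\<open>(1 + d)\<^sup>m\<close> words have coefficient \<open>1\<close>, which makes the supremum bound on \<open>b\<close> immediate.\<close>

definition laplace_words :: "nat \<Rightarrow> (nat \<Rightarrow> 'n option) set" where
  "laplace_words m = PiE {..<m} (\<lambda>_. UNIV)"

definition occurrences :: "nat \<Rightarrow> (nat \<Rightarrow> 'n option) \<Rightarrow> 'n \<Rightarrow> nat" where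
  "occurrences m F i = card {j \<in> {..<m}. F j = Some i}"

lemma finite_laplace_words: "finite (laplace_words m :: (nat \<Rightarrow> 'n::finite option) set)"
  unfolding laplace_words_def by (intro finite_PiE) auto

lemma card_laplace_words: "card (laplace_words m :: (nat \<Rightarrow> 'n::finite option) set) = (1 + CARD('n)) ^ m"
  unfolding laplace_words_def by (subst card_PiE) (auto simp: card_UNIV_option)

lemma occurrences_deg: "midx_deg (\<lambda>i. 2 * occurrences m F i) \<le> 2 * m" for F :: "nat \<Rightarrow> 'n::finite option"
proof -
  have "(\<Sum>i\<in>UNIV. occurrences m F i) = card (\<Union>i\<in>UNIV. {j \<in> {..<m}. F j = Some i})"
    unfolding occurrences_def by (rule card_UN_disjoint[symmetric]) auto
  also have "\<dots> \<le> card {..<m}" by (intro card_mono) auto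
  finally show ?thesis by (simp add: midx_deg_def sum_distrib_left[symmetric])
qed

lemma laplace_words_symbol:
  fixes p :: "real ^ 'n::finite"
  shows "(\<Sum>F\<in>laplace_words m. \<Prod>i\<in>UNIV. ((p $ i)\<^sup>2) ^ occurrences m F i) = (1 + (norm p)\<^sup>2) ^ m"
proof -
  define wt where "wt o' = (case o' of None \<Rightarrow> 1 | Some i \<Rightarrow> (p $ i)\<^sup>2)" for o'
  have "(\<Prod>i\<in>UNIV. ((p $ i)\<^sup>2) ^ occurrences m F i) = (\<Prod>j<m. wt (F j))" for F
  proof -
    have "(\<Prod>j<m. wt (F j)) = (\<Prod>j<m. \<Prod>i\<in>UNIV. if F j = Some i then (p $ i)\<^sup>2 else 1)"
    proof (rule prod.cong[OF refl])
      fix j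
      show "wt (F j) = (\<Prod>i\<in>UNIV. if F j = Some i then (p $ i)\<^sup>2 else 1)"
        by (cases "F j") (auto simp: wt_def)
    qed
    also have "\<dots> = (\<Prod>i\<in>UNIV. \<Prod>j<m. if F j = Some i then (p $ i)\<^sup>2 else 1)" by (rule prod.swap)
    also have "\<dots> = (\<Prod>i\<in>UNIV. ((p $ i)\<^sup>2) ^ occurrences m F i)"
      unfolding occurrences_def by (intro prod.cong refl) (simp add: prod.If_cases Int_def)
    finally show ?thesis ..
  qed
  then have "(\<Sum>F\<in>laplace_words m. \<Prod>i\<in>UNIV. ((p $ i)\<^sup>2) ^ occurrences m F i) = (\<Sum>F\<in>laplace_words m. \<Prod>j<m. wt (F j))" by simp
  also have "\<dots> = (\<Prod>j<m. \<Sum>o'\<in>UNIV. wt o')"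
    unfolding laplace_words_def by (rule prod_sum_PiE[symmetric]) auto
  also have "(\<Sum>o'\<in>UNIV. wt o') = 1 + (norm p)\<^sup>2"
    by (simp add: UNIV_option_conv sum.reindex wt_def norm_vec_def L2_set_def sum_nonneg)
  finally show ?thesis by simp
qed

text \<open>The symbol \<open>(1 - \<Delta>\<^sub>x)\<^sup>m a\<close>.\<close>

definition bessel_x :: "nat \<Rightarrow> ((real ^ 'n::finite) \<times> (real ^ 'n) \<Rightarrow> complex) \<Rightarrow> (real ^ 'n) \<times> (real ^ 'n) \<Rightarrow> complex" where
  "bessel_x m a z = (\<Sum>F\<in>laplace_words m. D_x (\<lambda>i. 2 * occurrences m F i) a z)"

text \<open>The symbol \<open>(1 - \<Delta>\<^sub>\<xi>)\<^sup>m (1 - \<Delta>\<^sub>x)\<^sup>m a\<close>, with the derivatives in the order used by the theorem.\<close>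

definition bessel_x_xi :: "nat \<Rightarrow> ((real ^ 'n::finite) \<times> (real ^ 'n) \<Rightarrow> complex) \<Rightarrow> (real ^ 'n) \<times> (real ^ 'n) \<Rightarrow> complex" where
  "bessel_x_xi m a z = (\<Sum>F\<in>laplace_words m. \<Sum>G\<in>laplace_words m. D_xi (\<lambda>i. 2 * occurrences m G i) (D_x (\<lambda>i. 2 * occurrences m F i) a) z)"

lemma schwartz_slice_cis:
  assumes "schwartz_fun a"
  shows "integrable lborel (\<lambda>X. a (X, \<xi>) * cis (p \<bullet> X))" "integrable lborel (\<lambda>\<xi>. a (X, \<xi>) * cis (p \<bullet> \<xi>))"
  by (intro integrable_mult_cis schwartz_integrable slice_x(1)[OF assms] slice_xi(1)[OF assms])+

lemma bessel_x_FT: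
  fixes a :: "(real ^ 'n::finite) \<times> (real ^ 'n) \<Rightarrow> complex"
  assumes a: "schwartz_fun a"
  shows "(\<integral>X. bessel_x m a (X, \<xi>) * cis (p \<bullet> X) \<partial>lborel) = of_real ((1 + (norm p)\<^sup>2) ^ m) * (\<integral>X. a (X, \<xi>) * cis (p \<bullet> X) \<partial>lborel)"
proof -
  have "(\<integral>X. bessel_x m a (X, \<xi>) * cis (p \<bullet> X) \<partial>lborel) = (\<Sum>F\<in>laplace_words m. \<integral>X. D_x (\<lambda>i. 2 * occurrences m F i) a (X, \<xi>) * cis (p \<bullet> X) \<partial>lborel)"
    unfolding bessel_x_def sum_distrib_right
    by (intro Bochner_Integration.integral_sum schwartz_slice_cis schwartz_D_x a)
  then show ?thesis
    unfolding FT_D_x[OF a] sum_distrib_right[symmetric] of_real_sum[symmetric] laplace_words_symbol .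
qed

lemma bessel_x_xi_FT:
  fixes a :: "(real ^ 'n::finite) \<times> (real ^ 'n) \<Rightarrow> complex"
  assumes a: "schwartz_fun a"
  shows "fourier_xi (bessel_x_xi m a) p X = of_real ((1 + (norm p)\<^sup>2) ^ m) * fourier_xi (bessel_x m a) p X"
proof -
  have "fourier_xi (bessel_x_xi m a) p X = (\<Sum>F\<in>laplace_words m. \<Sum>G\<in>laplace_words m. \<integral>\<xi>. D_xi (\<lambda>i. 2 * occurrences m G i) (D_x (\<lambda>i. 2 * occurrences m F i) a) (X, \<xi>) * cis (p \<bullet> \<xi>) \<partial>lborel)"
    unfolding fourier_xi_def bessel_x_xi_def sum_distrib_right
    by (subst Bochner_Integration.integral_sum, intro Bochner_Integration.integrable_sum schwartz_slice_cis schwartz_D_xi schwartz_D_x a,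
        intro sum.cong refl Bochner_Integration.integral_sum schwartz_slice_cis schwartz_D_xi schwartz_D_x a)
  also have "\<dots> = of_real ((1 + (norm p)\<^sup>2) ^ m) * (\<Sum>F\<in>laplace_words m. \<integral>\<xi>. D_x (\<lambda>i. 2 * occurrences m F i) a (X, \<xi>) * cis (p \<bullet> \<xi>) \<partial>lborel)"
    unfolding FT_D_xi[OF schwartz_D_x[OF a]] sum_distrib_right[symmetric] of_real_sum[symmetric] laplace_words_symbol sum_distrib_left[symmetric] ..
  also have "(\<Sum>F\<in>laplace_words m. \<integral>\<xi>. D_x (\<lambda>i. 2 * occurrences m F i) a (X, \<xi>) * cis (p \<bullet> \<xi>) \<partial>lborel) = fourier_xi (bessel_x m a) p X"
    unfolding fourier_xi_def bessel_x_def sum_distrib_right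
    by (intro Bochner_Integration.integral_sum[symmetric] schwartz_slice_cis schwartz_D_x a)
  finally show ?thesis .
qed

lemma schwartz_xi_decay:
  fixes a :: "'a::euclidean_space \<times> 'a \<Rightarrow> complex"
  assumes a: "schwartz_fun a"
  shows "\<exists>C. \<forall>X \<xi>. norm (a (X, \<xi>)) \<le> C * (1 / (1 + norm \<xi>) ^ (2 * DIM('a)))"
proof -
  obtain C where C: "0 \<le> C" "\<And>z. norm (a z) * (1 + norm z) ^ (2 * DIM('a)) \<le> C"
    using schwartz_decay[OF a] by metis
  have "norm (a (X, \<xi>)) \<le> C * (1 / (1 + norm \<xi>) ^ (2 * DIM('a)))" for X \<xi>
  proof -
    have "norm (a (X, \<xi>)) \<le> C * (1 / (1 + norm (X, \<xi>)) ^ (2 * DIM('a)))" by (rule decay_bound[OF C(2)])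
    also have "\<dots> \<le> C * (1 / (1 + norm \<xi>) ^ (2 * DIM('a)))"
      using norm_snd_le[of \<xi> X]
      by (intro mult_left_mono C(1) divide_left_mono power_mono mult_pos_pos zero_less_power add_pos_nonneg) auto
    finally show ?thesis .
  qed
  then show ?thesis by blast
qed

lemma sum_xi_decay:
  fixes a :: "'i \<Rightarrow> 'a::euclidean_space \<times> 'a \<Rightarrow> complex"
  assumes "finite I" "\<And>i. i \<in> I \<Longrightarrow> schwartz_fun (a i)"
  shows "\<exists>C>0. \<forall>X \<xi>. norm (\<Sum>i\<in>I. a i (X, \<xi>)) \<le> C * (1 / (1 + norm \<xi>) ^ (2 * DIM('a)))"
proof -
  define w where "w \<xi> = 1 / (1 + norm \<xi>) ^ (2 * DIM('a))" for \<xi> :: 'a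
  have w0: "0 \<le> w \<xi>" for \<xi> by (simp add: w_def add_nonneg_nonneg)
  obtain C where C: "\<And>i X \<xi>. i \<in> I \<Longrightarrow> norm (a i (X, \<xi>)) \<le> C i * w \<xi>"
    using schwartz_xi_decay[OF assms(2)] unfolding w_def by metis
  have "norm (\<Sum>i\<in>I. a i (X, \<xi>)) \<le> (1 + \<bar>\<Sum>i\<in>I. C i\<bar>) * w \<xi>" for X \<xi>
  proof -
    have "norm (\<Sum>i\<in>I. a i (X, \<xi>)) \<le> (\<Sum>i\<in>I. C i * w \<xi>)"
      by (rule order_trans[OF norm_sum sum_mono]) (rule C)
    also have "\<dots> = (\<Sum>i\<in>I. C i) * w \<xi>" by (simp add: sum_distrib_right)
    also have "\<dots> \<le> (1 + \<bar>\<Sum>i\<in>I. C i\<bar>) * w \<xi>" using w0 by (intro mult_right_mono) auto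
    finally show ?thesis .
  qed
  moreover have "0 < 1 + \<bar>\<Sum>i\<in>I. C i\<bar>" by linarith
  ultimately show ?thesis unfolding w_def by blast
qed

theorem weyl_bilinear:
  fixes a :: "(real ^ 'n::finite) \<times> (real ^ 'n) \<Rightarrow> complex"
  assumes a: "schwartz_fun a"
    and M: "\<And>\<alpha> \<beta> z. midx_deg \<alpha> \<le> cv_order CARD('n) \<Longrightarrow> midx_deg \<beta> \<le> cv_order CARD('n) \<Longrightarrow> norm (D_xi \<beta> (D_x \<alpha> a) z) \<le> M"
    and f: "integrable lborel f" and h: "integrable lborel h"
    and f2: "square_integrable f" and h2: "square_integrable h"
  shows "norm (\<integral>w. (f (snd w) * cnj (h (fst w))) * fourier_xi a (fst w - snd w) ((fst w + snd w) /\<^sub>R 2) \<partial>lborel)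
    \<le> (2 * pi) ^ CARD('n) * (cv_gamma CARD('n) * M * (L2_norm f * L2_norm h))"
proof -
  define d where "d = CARD('n)"
  define k where "k = d div 4"
  define m where "m = Suc k"
  have m2: "2 * m = cv_order d" by (simp add: m_def k_def cv_order_def)
  have d1: "1 \<le> d" unfolding d_def by (simp add: Suc_leI)
  define A b where "A = bessel_x m a" and "b = bessel_x_xi m a"
  have Dx: "schwartz_fun (D_x \<alpha> a)" for \<alpha> by (rule schwartz_D_x[OF a])
  have Dxi: "schwartz_fun (D_xi \<beta> (D_x \<alpha> a))" for \<alpha> \<beta> by (rule schwartz_D_xi[OF Dx])
  obtain Ca where Ca: "\<And>z. norm (a z) \<le> Ca" using schwartz_bounded[OF a] by metis
  define w where "w \<xi> = 1 / (1 + norm \<xi>) ^ (2 * DIM(real ^ 'n))" for \<xi> :: "real ^ 'n"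
  have wi: "integrable lborel w" unfolding w_def[abs_def] by (rule integrable_inverse_power)
  have w0: "0 < w \<xi>" for \<xi> by (simp add: w_def add_pos_nonneg)
  obtain CA where CA: "0 < CA" "\<And>X \<xi>. norm (A (X, \<xi>)) \<le> CA * w \<xi>"
    using sum_xi_decay[OF finite_laplace_words, of m "\<lambda>F. D_x (\<lambda>i. 2 * occurrences m F i) a"] Dx
    unfolding A_def bessel_x_def w_def by blast
  have b_alt: "b z = (\<Sum>q\<in>laplace_words m \<times> laplace_words m. D_xi (\<lambda>i. 2 * occurrences m (snd q) i) (D_x (\<lambda>i. 2 * occurrences m (fst q) i) a) z)" for z
    by (simp add: b_def bessel_x_xi_def sum.cartesian_product case_prod_beta')
  obtain Cb where Cb: "0 < Cb" "\<And>X \<xi>. norm (b (X, \<xi>)) \<le> Cb * w \<xi>"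
    using sum_xi_decay[OF finite_cartesian_product[OF finite_laplace_words finite_laplace_words], of m m
        "\<lambda>q. D_xi (\<lambda>i. 2 * occurrences m (snd q) i) (D_x (\<lambda>i. 2 * occurrences m (fst q) i) a)"] Dxi
    unfolding b_alt w_def by blast
  have bi: "integrable lborel b"
    unfolding b_alt by (intro Bochner_Integration.integrable_sum schwartz_integrable Dxi)
  have od: "midx_deg (\<lambda>i. 2 * occurrences m F i) \<le> cv_order CARD('n)" for F :: "nat \<Rightarrow> 'n option"
    using occurrences_deg[of m F] m2 by (simp add: d_def)
  have bB: "norm (b z) \<le> (1 + real d) ^ cv_order d * M" for z
  proof -
    have "norm (b z) \<le> (\<Sum>q\<in>(laplace_words m :: (nat \<Rightarrow> 'n option) set) \<times> (laplace_words m :: (nat \<Rightarrow> 'n option) set). M)"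
      unfolding b_alt
      by (rule order_trans[OF norm_sum sum_mono]) (intro M od)
    also have "\<dots> = real ((1 + d) ^ m * (1 + d) ^ m) * M"
      by (simp add: card_cartesian_product card_laplace_words d_def)
    also have "(1 + d) ^ m * (1 + d) ^ m = (1 + d) ^ cv_order d"
      unfolding m2[symmetric] by (simp add: power_add[symmetric] mult_2)
    finally show ?thesis by simp
  qed
  have id: "fourier_xi a t c = (\<integral>\<tau>. (\<integral>\<rho>. of_real (gaussian \<bar>\<rho>\<bar> t) * heat_avg \<tau> (fourier_xi b t) c \<partial>erlang_measure k) \<partial>erlang_measure k)" for t c
  proof (rule kernel_identity[where A=A and Ca=Ca and g="\<lambda>\<xi>. CA * w \<xi>"])
    show "integrable lborel (\<lambda>X. a (X, \<xi>))" for \<xi> by (intro schwartz_integrable slice_x a)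
    show "continuous_on UNIV (\<lambda>X. a (X, \<xi>))" for \<xi> by (intro smooth_continuous schwartz_smooth slice_x a)
    show "integrable lborel (\<lambda>X. A (X, \<xi>))" for \<xi>
      unfolding A_def bessel_x_def by (intro Bochner_Integration.integrable_sum schwartz_integrable slice_x Dx)
    show "continuous_on UNIV A"
      unfolding A_def bessel_x_def[abs_def] by (intro continuous_on_sum smooth_continuous schwartz_smooth Dx)
    show "(\<integral>X. A (X, \<xi>) * cis (p \<bullet> X) \<partial>lborel) = of_real ((1 + (norm p)\<^sup>2) ^ Suc k) * (\<integral>X. a (X, \<xi>) * cis (p \<bullet> X) \<partial>lborel)" for \<xi> p
      unfolding A_def m_def by (rule bessel_x_FT[OF a])
    show "fourier_xi b p X = of_real ((1 + (norm p)\<^sup>2) ^ Suc k) * fourier_xi A p X" for p X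
      unfolding A_def b_def m_def by (rule bessel_x_xi_FT[OF a])
  qed (use Ca CA wi w0 in auto)
  define I where "I = 2 powr (real d / 4) * (1 + 25 / 2 ^ d)"
  have I: "(\<integral>\<^sup>+\<tau>. \<integral>\<^sup>+\<rho>. ennreal ((1 + 1 / (16 * \<tau> * \<rho>)) powr (DIM(real ^ 'n) / 4)) \<partial>erlang_measure k \<partial>erlang_measure k) \<le> ennreal I"
    using smoothing_constant[of d] by (simp add: I_def k_def d_def)
  have I0: "0 \<le> I" by (simp add: I_def add_nonneg_nonneg)
  have L0: "0 \<le> L2_norm f * L2_norm h" by (simp add: L2_norm_def)
  have "norm (D_xi (\<lambda>_. 0) (D_x (\<lambda>_. 0) a) 0) \<le> M" by (rule M) (simp_all add: midx_deg_def)
  then have M0: "0 \<le> M" by (rule order_trans[OF norm_ge_zero])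
  have bg: "integrable lborel (\<lambda>\<xi>. Cb * w \<xi>)" using wi by simp
  have "norm (\<integral>w. (f (snd w) * cnj (h (fst w))) * fourier_xi a (fst w - snd w) ((fst w + snd w) /\<^sub>R 2) \<partial>lborel)
    \<le> ((1 + real d) ^ cv_order d * M) * (2 * pi) ^ DIM(real ^ 'n) * I * (L2_norm f * L2_norm h)"
    by (rule bilinear_estimate[OF id bi bB bg Cb(2) I I0 f h f2 h2])
  also have "\<dots> = (2 * pi) ^ d * ((I * (1 + real d) ^ cv_order d) * M * (L2_norm f * L2_norm h))"
    by (simp add: d_def mult_ac)
  also have "\<dots> \<le> (2 * pi) ^ d * (cv_gamma d * M * (L2_norm f * L2_norm h))"
    unfolding I_def by (intro mult_left_mono mult_right_mono constant_le_cv_gamma d1 M0 L0) auto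
  finally show ?thesis unfolding d_def .
qed

section \<open>From the bilinear estimate to the operator norm\<close>

text \<open>Half of the available decay is spent on integrability in \<open>\<xi>\<close>, the other half remains as decay in \<open>c\<close>.\<close>

lemma fourier_xi_decay:
  fixes a :: "'a::euclidean_space \<times> 'a \<Rightarrow> complex"
  assumes a: "schwartz_fun a"
  shows "\<exists>C\<ge>0. \<forall>t c. norm (fourier_xi a t c) \<le> C * (1 / (1 + norm c) ^ (2 * DIM('a)))"
proof -
  define N where "N = 2 * DIM('a)"
  define w where "w x = 1 / (1 + norm x) ^ N" for x :: 'a
  have w: "integrable lborel w" unfolding w_def[abs_def] N_def by (rule integrable_inverse_power)
  obtain C where C: "0 \<le> C" "\<And>z. norm (a z) * (1 + norm z) ^ (2 * N) \<le> C"
    using schwartz_decay[OF a] by metis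
  have pt: "norm (a (X, \<xi>)) \<le> C * w X * w \<xi>" for X \<xi>
  proof -
    have "norm (a (X, \<xi>)) \<le> C * (1 / (1 + norm (X, \<xi>)) ^ (2 * N))" by (rule decay_bound[OF C(2)])
    also have "\<dots> \<le> C * (1 / ((1 + norm X) ^ N * (1 + norm \<xi>) ^ N))"
    proof (intro mult_left_mono C(1) divide_left_mono)
      have "(1 + norm X) ^ N * (1 + norm \<xi>) ^ N \<le> (1 + norm (X, \<xi>)) ^ N * (1 + norm (X, \<xi>)) ^ N"
        using norm_fst_le[of X \<xi>] norm_snd_le[of \<xi> X] by (intro mult_mono power_mono) auto
      then show "(1 + norm X) ^ N * (1 + norm \<xi>) ^ N \<le> (1 + norm (X, \<xi>)) ^ (2 * N)"
        by (simp add: mult_2 power_add)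
    qed (auto intro!: mult_pos_pos zero_less_power add_pos_nonneg)
    finally show ?thesis by (simp add: w_def)
  qed
  have "norm (fourier_xi a t c) \<le> (C * (\<integral>\<xi>. w \<xi> \<partial>lborel)) * w c" for t c
  proof -
    have "norm (fourier_xi a t c) \<le> (\<integral>\<xi>. norm (a (c, \<xi>) * cis (t \<bullet> \<xi>)) \<partial>lborel)"
      unfolding fourier_xi_def by (rule integral_norm_bound)
    also have "\<dots> \<le> (\<integral>\<xi>. C * w c * w \<xi> \<partial>lborel)"
    proof (rule integral_mono')
      show "integrable lborel (\<lambda>\<xi>. C * w c * w \<xi>)" using w by simp
      show "norm (a (c, \<xi>) * cis (t \<bullet> \<xi>)) \<le> C * w c * w \<xi>" for \<xi> using pt by (simp add: norm_mult)
      show "0 \<le> C * w c * w \<xi>" for \<xi> using C(1) by (simp add: w_def add_nonneg_nonneg)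
    qed
    finally show ?thesis by (simp add: mult_ac)
  qed
  moreover have "0 \<le> C * (\<integral>\<xi>. w \<xi> \<partial>lborel)"
    using C(1) by (intro mult_nonneg_nonneg integral_nonneg_AE) (auto simp: w_def add_nonneg_nonneg)
  ultimately show ?thesis unfolding w_def N_def by blast
qed

definition cut_ball :: "nat \<Rightarrow> ('a::euclidean_space \<Rightarrow> complex) \<Rightarrow> 'a \<Rightarrow> complex" where
  "cut_ball n f x = indicator (cball 0 (real n)) x * f x"

lemma norm_cut_ball_le: "norm (cut_ball n f x) \<le> norm (f x)"
  by (auto simp: cut_ball_def indicator_def)

lemma cut_ball_measurable [measurable]:
  fixes f :: "'a::euclidean_space \<Rightarrow> complex"
  assumes [measurable]: "f \<in> borel_measurable borel"
  shows "cut_ball n f \<in> borel_measurable borel"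
proof -
  have [measurable]: "cball (0::'a) (real n) \<in> sets borel" by (intro borel_closed closed_cball)
  show ?thesis unfolding cut_ball_def[abs_def] by measurable
qed

lemma integrable_indicator_cball: "integrable lborel (indicator (cball c r) :: 'a::euclidean_space \<Rightarrow> real)"
  using emeasure_lborel_cball_finite[of c r] by (intro integrable_real_indicator) (auto simp: borel_closed)

lemma cut_ball_tendsto: "(\<lambda>n. cut_ball n f x) \<longlonglongrightarrow> f x"
proof (rule tendsto_eventually)
  obtain n0 where "norm x \<le> real n0" using real_arch_simple by blast
  then have "cut_ball n f x = f x" if "n0 \<le> n" for n
    using that by (simp add: cut_ball_def)
  then show "\<forall>\<^sub>F n in sequentially. cut_ball n f x = f x" by (auto simp: eventually_sequentially)
qed

lemma cut_ball_L2:
  fixes f :: "'a::euclidean_space \<Rightarrow> complex"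
  assumes "f \<in> borel_measurable borel" "square_integrable f"
  shows "integrable lborel (cut_ball n f)" "integrable lborel (\<lambda>x. (norm (cut_ball n f x))\<^sup>2)"
    "L2_norm (cut_ball n f) \<le> L2_norm f"
proof -
  note [measurable] = assms(1)
  have ball: "integrable lborel (\<lambda>x::'a. indicator (cball 0 (real n)) x :: real)"
    by (rule integrable_indicator_cball)
  show "integrable lborel (cut_ball n f)"
  proof (rule Bochner_Integration.integrable_bound[OF Bochner_Integration.integrable_add[OF ball assms(2)]])
    show "AE x in lborel. norm (cut_ball n f x) \<le> norm (indicator (cball 0 (real n)) x + (norm (f x))\<^sup>2)"
    proof (rule AE_I2)
      fix x
      have "2 * norm (f x) \<le> 1 + (norm (f x))\<^sup>2"
        using sum_squares_bound[of "norm (f x)" 1] by simp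
      then have "norm (f x) \<le> 1 + (norm (f x))\<^sup>2" using norm_ge_zero[of "f x"] by linarith
      then show "norm (cut_ball n f x) \<le> norm (indicator (cball 0 (real n)) x + (norm (f x))\<^sup>2)"
        by (auto simp: cut_ball_def indicator_def)
    qed
  qed measurable
  show i: "integrable lborel (\<lambda>x. (norm (cut_ball n f x))\<^sup>2)"
    by (rule Bochner_Integration.integrable_bound[OF assms(2)]) (auto intro!: power_mono norm_cut_ball_le)
  show "L2_norm (cut_ball n f) \<le> L2_norm f"
    unfolding L2_norm_def
    by (intro real_sqrt_le_mono integral_mono i assms(2) power_mono norm_cut_ball_le) auto
qed

lemma L2_norm_fatou:
  assumes [measurable]: "\<And>n. u n \<in> borel_measurable borel" "v \<in> borel_measurable borel"
    and lim: "\<And>x. (\<lambda>n. u n x) \<longlonglongrightarrow> v x" and B: "0 \<le> B"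
    and u: "\<And>n. integrable lborel (\<lambda>x. (norm (u n x))\<^sup>2)" "\<And>n. L2_norm (u n) \<le> B"
  shows "square_integrable v" "L2_norm v \<le> B"
proof -
  have "(\<integral>\<^sup>+x. ennreal ((norm (v x))\<^sup>2) \<partial>lborel) = (\<integral>\<^sup>+x. liminf (\<lambda>n. ennreal ((norm (u n x))\<^sup>2)) \<partial>lborel)"
    by (intro nn_integral_cong lim_imp_Liminf[symmetric] tendsto_ennrealI tendsto_intros lim) simp
  also have "\<dots> \<le> liminf (\<lambda>n. \<integral>\<^sup>+x. ennreal ((norm (u n x))\<^sup>2) \<partial>lborel)"
    by (rule nn_integral_liminf) measurable
  also have "\<dots> \<le> liminf (\<lambda>n. ennreal (B\<^sup>2))"
  proof (intro Liminf_mono always_eventually allI)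
    fix n
    have "(\<integral>\<^sup>+x. ennreal ((norm (u n x))\<^sup>2) \<partial>lborel) = ennreal ((L2_norm (u n))\<^sup>2)"
      by (subst nn_integral_eq_integral[OF u(1)]) (auto simp: L2_norm_def)
    also have "\<dots> \<le> ennreal (B\<^sup>2)"
      by (intro ennreal_leI power_mono u(2)) (auto simp: L2_norm_def)
    finally show "(\<integral>\<^sup>+x. ennreal ((norm (u n x))\<^sup>2) \<partial>lborel) \<le> ennreal (B\<^sup>2)" .
  qed
  finally have le: "(\<integral>\<^sup>+x. ennreal ((norm (v x))\<^sup>2) \<partial>lborel) \<le> ennreal (B\<^sup>2)" by (simp add: Liminf_const)
  show i: "square_integrable v"
    by (intro integrableI_nonneg) (auto intro!: order_le_less_trans[OF le])
  have "ennreal (\<integral>x. (norm (v x))\<^sup>2 \<partial>lborel) \<le> ennreal (B\<^sup>2)"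
    using le by (subst (asm) nn_integral_eq_integral[OF i]) auto
  then have "(\<integral>x. (norm (v x))\<^sup>2 \<partial>lborel) \<le> B\<^sup>2" by (simp add: ennreal_le_iff)
  then show "L2_norm v \<le> B" unfolding L2_norm_def using B by (intro real_le_lsqrt) auto
qed

text \<open>For \<open>f \<in> L\<^sup>1 \<inter> L\<^sup>2\<close> the image \<open>T f\<close> is bounded, and testing the bilinear estimate with the truncation of \<open>T f\<close> itself bounds the
norm of this truncation. For general \<open>f\<close> the truncations \<open>f\<^sub>n\<close> satisfy \<open>T f\<^sub>n \<rightarrow> T f\<close> pointwise, because the kernel decays in \<open>x + y\<close>
and is therefore square integrable in \<open>y\<close> for each \<open>x\<close>. Fatou's lemma concludes in both cases.\<close>

lemma weyl_L2_bound:
  fixes a :: "(real ^ 'n::finite) \<times> (real ^ 'n) \<Rightarrow> complex"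
  assumes a: "schwartz_fun a"
    and M: "\<And>\<alpha> \<beta> z. midx_deg \<alpha> \<le> cv_order CARD('n) \<Longrightarrow> midx_deg \<beta> \<le> cv_order CARD('n) \<Longrightarrow> norm (D_xi \<beta> (D_x \<alpha> a) z) \<le> M"
    and C0: "0 \<le> cv_gamma CARD('n) * M"
    and K: "\<And>x y. K x y = fourier_xi a (x - y) ((x + y) /\<^sub>R 2) / of_real ((2 * pi) ^ CARD('n))"
    and f: "L2_fun f"
  shows "L2_fun (\<lambda>x. \<integral>y. K x y * f y \<partial>lborel)"
    and "L2_norm (\<lambda>x. \<integral>y. K x y * f y \<partial>lborel) \<le> cv_gamma CARD('n) * M * L2_norm f"
proof -
  define C where "C = cv_gamma CARD('n) * M"
  define T where "T f x = (\<integral>y. K x y * f y \<partial>lborel)" for f x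
  have fm: "f \<in> borel_measurable borel" and f2: "square_integrable f"
    using f by (auto simp: L2_fun_def)
  have am: "a \<in> borel_measurable borel" by (rule smooth_measurable[OF schwartz_smooth[OF a]])
  define P where "P = (2 * pi) ^ CARD('n)"
  have P: "0 < P" by (simp add: P_def)
  have KP: "of_real P * K x y = fourier_xi a (x - y) ((x + y) /\<^sub>R 2)" for x y
    using P by (simp add: K P_def)
  have Km: "(\<lambda>p. K (fst p) (snd p)) \<in> borel_measurable borel"
  proof -
    have "(\<lambda>p::(real ^ 'n) \<times> (real ^ 'n). (fst p - snd p, (fst p + snd p) /\<^sub>R 2)) \<in> borel_measurable borel"
      by (intro borel_measurable_continuous_onI continuous_intros)
    from measurable_compose[OF this fourier_xi_measurable[OF am]]
    have [measurable]: "(\<lambda>p::(real ^ 'n) \<times> (real ^ 'n). fourier_xi a (fst p - snd p) ((fst p + snd p) /\<^sub>R 2)) \<in> borel_measurable borel" by simp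
    show ?thesis unfolding K by measurable
  qed
  have Kx [measurable]: "K x \<in> borel_measurable borel" for x
    using measurable_compose[OF _ Km, of "\<lambda>y. (x, y)" borel] by simp
  define w where "w x = 1 / (1 + norm x) ^ (2 * DIM(real ^ 'n))" for x :: "real ^ 'n"
  have w: "integrable lborel w" unfolding w_def[abs_def] by (rule integrable_inverse_power)
  have w1: "0 \<le> w x" "w x \<le> 1" for x
  proof -
    have t: "1 / t \<le> 1" if "1 \<le> t" for t :: real using that by simp
    show "w x \<le> 1" unfolding w_def by (rule t, rule one_le_power) simp
    show "0 \<le> w x" by (simp add: w_def add_nonneg_nonneg)
  qed
  obtain D where D: "0 \<le> D" "\<And>t c. norm (fourier_xi a t c) \<le> D * w c"
    using fourier_xi_decay[OF a] unfolding w_def by blast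
  have Kb: "norm (K x y) \<le> D / P * w ((x + y) /\<^sub>R 2)" for x y
  proof -
    have "P * norm (K x y) = norm (of_real P * K x y)"
      unfolding norm_mult norm_of_real using P by (simp only: abs_of_pos)
    also have "\<dots> \<le> D * w ((x + y) /\<^sub>R 2)" unfolding KP by (rule D(2))
    finally have "norm (K x y) * P \<le> D * w ((x + y) /\<^sub>R 2)" by (simp only: mult.commute)
    then have "norm (K x y) \<le> D * w ((x + y) /\<^sub>R 2) / P" unfolding pos_le_divide_eq[OF P] .
    then show ?thesis by (simp only: times_divide_eq_left)
  qed
  have Kb1: "norm (K x y) \<le> D / P" for x y
    using Kb[of x y] mult_left_mono[OF w1(2)[of "(x + y) /\<^sub>R 2"], of "D / P"] D(1) P by simp
  have Tm [measurable]: "T u \<in> borel_measurable borel" if [measurable]: "u \<in> borel_measurable borel" for u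
  proof -
    have "(\<lambda>p::(real ^ 'n) \<times> (real ^ 'n). K (fst p) (snd p) * u (snd p)) \<in> borel_measurable borel"
      using Km by measurable
    then have "T u \<in> borel_measurable lborel"
      unfolding T_def by (intro lborel.borel_measurable_lebesgue_integral) (simp add: lborel_prod case_prod_beta')
    then show ?thesis by simp
  qed
  have step1: "integrable lborel (\<lambda>x. (norm (T u x))\<^sup>2)" "L2_norm (T u) \<le> C * L2_norm u"
    if u: "integrable lborel u" and u2: "square_integrable u" for u
  proof -
    have um [measurable]: "u \<in> borel_measurable borel" using borel_measurable_integrable[OF u] by simp
    define B where "B = D / P * (\<integral>y. norm (u y) \<partial>lborel)"
    have TB: "norm (T u x) \<le> B" for x
    proof -
      have "norm (T u x) \<le> (\<integral>y. norm (K x y * u y) \<partial>lborel)" unfolding T_def by (rule integral_norm_bound)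
      also have "\<dots> \<le> (\<integral>y. D / P * norm (u y) \<partial>lborel)"
        by (rule integral_mono') (use u Kb1 D(1) P in \<open>auto simp: norm_mult simp del: times_divide_eq_left intro!: mult_right_mono\<close>)
      finally show ?thesis unfolding B_def by (simp only: integral_mult_right_zero)
    qed
    define g where "g n = cut_ball n (T u)" for n
    have g1: "integrable lborel (g n)" for n
    proof (rule Bochner_Integration.integrable_bound)
      show "integrable lborel (\<lambda>x::real ^ 'n. B * indicator (cball 0 (real n)) x)"
        by (intro integrable_mult_right integrable_indicator_cball)
      show "AE x in lborel. norm (g n x) \<le> norm (B * indicator (cball 0 (real n)) x)"
      proof (rule AE_I2)
        fix x show "norm (g n x) \<le> norm (B * indicator (cball 0 (real n)) x)"
          using TB[of x] by (auto simp: g_def cut_ball_def indicator_def)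
      qed
      show "g n \<in> borel_measurable lborel" by (simp add: g_def)
    qed
    have g2: "integrable lborel (\<lambda>x. (norm (g n x))\<^sup>2)" for n
    proof (rule Bochner_Integration.integrable_bound)
      show "integrable lborel (\<lambda>x. B * norm (g n x))" using g1 by simp
      show "AE x in lborel. norm ((norm (g n x))\<^sup>2) \<le> norm (B * norm (g n x))"
      proof (rule AE_I2)
        fix x
        have "norm (g n x) \<le> B" using norm_cut_ball_le[of n "T u" x] TB[of x] by (simp add: g_def)
        then have "norm (g n x) * norm (g n x) \<le> B * norm (g n x)" by (intro mult_right_mono) auto
        then show "norm ((norm (g n x))\<^sup>2) \<le> norm (B * norm (g n x))"
          by (simp add: power2_eq_square order_trans[OF _ abs_ge_self])
      qed
      show "(\<lambda>x. (norm (g n x))\<^sup>2) \<in> borel_measurable lborel" by (simp add: g_def)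
    qed
    have gb: "L2_norm (g n) \<le> C * L2_norm u" for n
    proof -
      have Hi: "integrable lborel (\<lambda>p. K (fst p) (snd p) * (cnj (g n (fst p)) * u (snd p)))"
      proof -
        have "integrable (lborel \<Otimes>\<^sub>M lborel) (\<lambda>(x, y). K x y * (cnj (g n x) * u y))"
        proof (rule integrable_pair_bounded[OF sigma_finite_lborel sigma_finite_lborel _ u _ Kb1])
          show "integrable lborel (\<lambda>x. cnj (g n x))" using g1 by simp
          show "(\<lambda>(x, y). K x y) \<in> borel_measurable (lborel \<Otimes>\<^sub>M lborel)" using Km by (simp add: lborel_prod case_prod_beta')
        qed
        then show ?thesis by (simp add: lborel_prod case_prod_beta')
      qed
      have "(\<integral>p. K (fst p) (snd p) * (cnj (g n (fst p)) * u (snd p)) \<partial>lborel) = (\<integral>x. cnj (g n x) * T u x \<partial>lborel)"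
        unfolding lborel_prod_integral[OF Hi] T_def integral_mult_right_zero[symmetric] by (simp add: mult_ac)
      also have "\<dots> = (\<integral>x. complex_of_real ((norm (g n x))\<^sup>2) \<partial>lborel)"
      proof (rule Bochner_Integration.integral_cong[OF refl])
        fix x
        show "cnj (g n x) * T u x = complex_of_real ((norm (g n x))\<^sup>2)"
          by (simp add: g_def cut_ball_def indicator_def complex_norm_square[symmetric] mult.commute del: of_real_power)
      qed
      also have "\<dots> = of_real ((L2_norm (g n))\<^sup>2)"
        unfolding integral_complex_of_real by (simp add: L2_norm_def)
      finally have e1: "(\<integral>p. K (fst p) (snd p) * (cnj (g n (fst p)) * u (snd p)) \<partial>lborel) = of_real ((L2_norm (g n))\<^sup>2)" .
      have "of_real P * (\<integral>p. K (fst p) (snd p) * (cnj (g n (fst p)) * u (snd p)) \<partial>lborel)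
        = (\<integral>p. (u (snd p) * cnj (g n (fst p))) * fourier_xi a (fst p - snd p) ((fst p + snd p) /\<^sub>R 2) \<partial>lborel)"
        unfolding integral_mult_right_zero[symmetric] KP[symmetric] by (simp add: mult_ac)
      then have "P * (L2_norm (g n))\<^sup>2 = norm (\<integral>p. (u (snd p) * cnj (g n (fst p))) * fourier_xi a (fst p - snd p) ((fst p + snd p) /\<^sub>R 2) \<partial>lborel)"
        unfolding e1 using P by (metis abs_of_nonneg less_imp_le mult_nonneg_nonneg norm_of_real of_real_mult zero_le_power2)
      also have "\<dots> \<le> P * (C * (L2_norm u * L2_norm (g n)))"
        unfolding P_def C_def by (rule weyl_bilinear[OF a M u g1 u2 g2])
      finally have "L2_norm (g n) * L2_norm (g n) \<le> (C * L2_norm u) * L2_norm (g n)"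
        using P by (simp add: power2_eq_square mult_ac)
      moreover have "0 \<le> L2_norm (g n)" "0 \<le> C * L2_norm u" using C0 by (auto simp: L2_norm_def C_def)
      ultimately show ?thesis by (cases "L2_norm (g n) = 0") (auto simp: mult_le_cancel_right)
    qed
    have Cu: "0 \<le> C * L2_norm u" using C0 by (simp add: C_def L2_norm_def)
    have gm: "g n \<in> borel_measurable borel" for n by (simp add: g_def)
    have gl: "(\<lambda>n. g n x) \<longlonglongrightarrow> T u x" for x unfolding g_def by (rule cut_ball_tendsto)
    show "integrable lborel (\<lambda>x. (norm (T u x))\<^sup>2)" "L2_norm (T u) \<le> C * L2_norm u"
      using L2_norm_fatou[OF gm Tm[OF um] gl Cu g2 gb] by auto
  qed
  have lim: "(\<lambda>n. T (cut_ball n f) x) \<longlonglongrightarrow> T f x" for x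
    unfolding T_def
  proof (rule integral_dominated_convergence[where w="\<lambda>y. D / P * (w ((1/2) *\<^sub>R x + (1/2) *\<^sub>R y) + (norm (f y))\<^sup>2)"])
    note fm [measurable]
    show "(\<lambda>y. K x y * f y) \<in> borel_measurable lborel" "(\<lambda>y. K x y * cut_ball n f y) \<in> borel_measurable lborel" for n
      by measurable
    show "integrable lborel (\<lambda>y. D / P * (w ((1/2) *\<^sub>R x + (1/2) *\<^sub>R y) + (norm (f y))\<^sup>2))"
      using lborel_integrable_affine[OF w, of "1/2" "(1/2) *\<^sub>R x"] f2 by (intro integrable_mult_right Bochner_Integration.integrable_add) auto
    show "AE y in lborel. (\<lambda>n. K x y * cut_ball n f y) \<longlonglongrightarrow> K x y * f y"
      by (intro AE_I2 tendsto_intros cut_ball_tendsto)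
    show "AE y in lborel. norm (K x y * cut_ball n f y) \<le> D / P * (w ((1/2) *\<^sub>R x + (1/2) *\<^sub>R y) + (norm (f y))\<^sup>2)" for n
    proof (rule AE_I2)
      fix y
      define v where "v = w ((1/2) *\<^sub>R x + (1/2) *\<^sub>R y)"
      have v: "0 \<le> v" "v \<le> 1" using w1 by (auto simp: v_def)
      have "v * v \<le> v * 1" using v by (intro mult_left_mono) auto
      then have "v * norm (f y) \<le> v + (norm (f y))\<^sup>2"
        using sum_squares_bound[of v "norm (f y)"] v zero_le_power2[of "norm (f y)"]
        unfolding power2_eq_square[of v] mult.assoc by linarith
      then have "D / P * (v * norm (f y)) \<le> D / P * (v + (norm (f y))\<^sup>2)"
        using D(1) P by (intro mult_left_mono) auto
      moreover have "norm (K x y) * norm (cut_ball n f y) \<le> D / P * v * norm (f y)"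
        using Kb[of x y] D(1) P v by (intro mult_mono norm_cut_ball_le) (auto simp: v_def scaleR_add_right)
      ultimately show "norm (K x y * cut_ball n f y) \<le> D / P * (w ((1/2) *\<^sub>R x + (1/2) *\<^sub>R y) + (norm (f y))\<^sup>2)"
        unfolding norm_mult v_def[symmetric] by (simp only: mult.assoc)
    qed
  qed
  note cf = cut_ball_L2[OF fm f2]
  have Cf: "0 \<le> C * L2_norm f" using C0 by (simp add: C_def L2_norm_def)
  have b: "L2_norm (T (cut_ball n f)) \<le> C * L2_norm f" for n
  proof -
    have "L2_norm (T (cut_ball n f)) \<le> C * L2_norm (cut_ball n f)" by (rule step1(2)[OF cf(1,2)])
    also have "\<dots> \<le> C * L2_norm f" using C0 by (intro mult_left_mono cf(3)) (simp add: C_def)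
    finally show ?thesis .
  qed
  note fin = L2_norm_fatou[OF Tm[OF cut_ball_measurable[OF fm]] Tm[OF fm] lim Cf step1(1)[OF cf(1,2)] b]
  show "L2_fun (\<lambda>x. \<integral>y. K x y * f y \<partial>lborel)"
    unfolding L2_fun_def using fin(1) Tm[OF fm] by (simp add: T_def[abs_def])
  show "L2_norm (\<lambda>x. \<integral>y. K x y * f y \<partial>lborel) \<le> cv_gamma CARD('n) * M * L2_norm f"
    using fin(2) by (simp add: T_def[abs_def] C_def)
qed

section \<open>Rescaling in the semiclassical parameter\<close>

definition dilate :: "real \<Rightarrow> ('a::euclidean_space \<times> 'a \<Rightarrow> complex) \<Rightarrow> 'a \<times> 'a \<Rightarrow> complex" where
  "dilate h a z = a (fst z, h *\<^sub>R snd z)"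

text \<open>The substitution \<open>\<xi> \<rightarrow> h\<xi>\<close> absorbs the parameter and the normalising power of \<open>h\<close>.\<close>

lemma weyl_kernel_eq:
  fixes a :: "(real ^ 'n::finite) \<times> (real ^ 'n) \<Rightarrow> complex"
  assumes h: "0 < h" and a: "a \<in> borel_measurable borel"
  shows "weyl_kernel h a x y = fourier_xi (dilate h a) (x - y) ((x + y) /\<^sub>R 2) / of_real ((2 * pi) ^ CARD('n))"
proof -
  note [measurable] = a
  have "(\<integral>\<xi>. a ((x + y) /\<^sub>R 2, \<xi>) * exp (\<i> * of_real (((x - y) \<bullet> \<xi>) / h)) \<partial>lborel)
    = (\<bar>h\<bar> ^ DIM(real ^ 'n)) *\<^sub>R (\<integral>\<xi>. a ((x + y) /\<^sub>R 2, 0 + h *\<^sub>R \<xi>) * exp (\<i> * of_real (((x - y) \<bullet> (0 + h *\<^sub>R \<xi>)) / h)) \<partial>lborel)"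
    using h by (intro lborel_integral_affine) auto
  also have "(\<integral>\<xi>. a ((x + y) /\<^sub>R 2, 0 + h *\<^sub>R \<xi>) * exp (\<i> * of_real (((x - y) \<bullet> (0 + h *\<^sub>R \<xi>)) / h)) \<partial>lborel) = fourier_xi (dilate h a) (x - y) ((x + y) /\<^sub>R 2)"
    using h by (simp add: fourier_xi_def dilate_def cis_conv_exp)
  finally show ?thesis
    using h unfolding weyl_kernel_def by (simp add: scaleR_conv_of_real power_mult_distrib)
qed

text \<open>Only derivatives in \<open>\<xi>\<close> produce powers of \<open>h\<close>, and these are at most \<open>1\<close>.\<close>

lemma dilate_derivs:
  fixes a :: "(real ^ 'n::finite) \<times> (real ^ 'n) \<Rightarrow> complex"
  assumes h: "0 < h" "h \<le> 1" and a: "schwartz_fun a"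
  shows "schwartz_fun (dilate h a)"
    and "norm (D_xi \<beta> (D_x \<alpha> (dilate h a)) z) \<le> norm (D_xi \<beta> (D_x \<alpha> a) (fst z, h *\<^sub>R snd z))"
proof -
  define S where "S z = (fst z, h *\<^sub>R snd z)" for z :: "(real ^ 'n) \<times> (real ^ 'n)"
  define c where "c v = (if fst v = 0 then h else 1)" for v :: "(real ^ 'n) \<times> (real ^ 'n)"
  have S: "bounded_linear S"
    unfolding S_def
    by (intro bounded_linear_Pair bounded_linear_fst bounded_linear_compose[OF bounded_linear_scaleR_right bounded_linear_snd])
  have SJ: "S v = c v *\<^sub>R id v" if "v \<in> Basis" for v
    using that by (auto simp: S_def c_def Basis_prod_def)
  have J: "id v \<in> Basis" if "v \<in> Basis" for v :: "(real ^ 'n) \<times> (real ^ 'n)" using that by simp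
  have K: "1 + norm z \<le> 1 / h * (1 + norm (0 + S z))" for z
  proof -
    have "(norm (h *\<^sub>R fst z))\<^sup>2 \<le> (norm (fst z))\<^sup>2"
      using h by (intro power_mono) (auto simp: mult_left_le_one_le)
    then have "norm (h *\<^sub>R z) \<le> norm (S z)"
      unfolding norm_prod_def S_def by (intro real_sqrt_le_mono) simp
    then have "h * (1 + norm z) \<le> 1 + norm (S z)" using h by (simp add: distrib_left add_mono)
    then show ?thesis using h by (simp add: pos_le_divide_eq mult.commute)
  qed
  have dS: "schwartz_fun (\<lambda>z. w (S z))" if w: "schwartz_fun w" for w :: "(real ^ 'n) \<times> (real ^ 'n) \<Rightarrow> complex"
  proof -
    have "schwartz_fun (\<lambda>z. w (0 + S z))" by (rule schwartz_affine[OF w S SJ J K])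
    then show ?thesis by simp
  qed
  have Dl: "D_list vs (\<lambda>z. w (S z)) z = of_real (\<Prod>v\<leftarrow>vs. c v) * D_list vs w (S z)"
    if w: "schwartz_fun w" and vs: "set vs \<subseteq> Basis" for w :: "(real ^ 'n) \<times> (real ^ 'n) \<Rightarrow> complex" and vs z
  proof -
    have "foldr dir_deriv vs (\<lambda>z. w (0 + S z)) = (\<lambda>z. of_real (\<Prod>v\<leftarrow>vs. c v) * foldr dir_deriv (map id vs) w (0 + S z))"
      by (rule foldr_dir_deriv_affine[OF schwartz_smooth[OF w] S SJ J vs])
    then show ?thesis by (simp add: D_list_def mult_ac)
  qed
  have dil: "dilate h a = (\<lambda>z. a (S z))" by (simp add: dilate_def[abs_def] S_def)
  show "schwartz_fun (dilate h a)" unfolding dil by (rule dS[OF a])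
  have 1: "D_x \<alpha> (dilate h a) = (\<lambda>z. D_x \<alpha> a (S z))"
  proof
    fix z
    have ne: "\<forall>v\<in>set (axes \<alpha>). v \<noteq> 0" using axes_Basis[of \<alpha>] nonzero_Basis by blast
    have "(\<Prod>v\<leftarrow>vs. c (v, 0)) = 1" if "\<forall>v\<in>set vs. v \<noteq> 0" for vs
      using that by (induction vs) (auto simp: c_def)
    then have "(\<Prod>v\<leftarrow>map (\<lambda>v. (v, 0)) (axes \<alpha>). c v) = 1" using ne by (simp add: o_def)
    then show "D_x \<alpha> (dilate h a) z = D_x \<alpha> a (S z)"
      unfolding dil D_x_eq[OF schwartz_smooth[OF dS[OF a]]] D_x_eq[OF schwartz_smooth[OF a]] Dl[OF a pair_Basis(1)[OF axes_Basis]] by simp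
  qed
  define w where "w = D_x \<alpha> a"
  have w: "schwartz_fun w" unfolding w_def by (rule schwartz_D_x[OF a])
  have "\<bar>\<Prod>v\<leftarrow>map (\<lambda>v. (0, v)) vs. c v\<bar> \<le> 1" for vs
    using h by (induction vs) (auto simp: c_def abs_mult intro!: mult_le_one)
  then have "norm (of_real (\<Prod>v\<leftarrow>map (\<lambda>v. (0, v)) (axes \<beta>). c v) * D_xi \<beta> w (S z)) \<le> 1 * norm (D_xi \<beta> w (S z))"
    unfolding norm_mult norm_of_real by (intro mult_right_mono) auto
  then show "norm (D_xi \<beta> (D_x \<alpha> (dilate h a)) z) \<le> norm (D_xi \<beta> (D_x \<alpha> a) (fst z, h *\<^sub>R snd z))"
    unfolding 1 w_def[symmetric] S_def[symmetric] D_xi_eq[OF schwartz_smooth[OF dS[OF w]]] D_xi_eq[OF schwartz_smooth[OF w]] Dl[OF w pair_Basis(2)[OF axes_Basis]]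
    by simp
qed

section \<open>The theorem\<close>

text \<open>A nonempty open set has positive measure, so for a continuous function the essential bound holds pointwise.\<close>

lemma norm_le_Linf:
  fixes u :: "'a::euclidean_space \<Rightarrow> complex"
  assumes uc: "continuous_on UNIV u" and L: "Linf_norm u \<le> ennreal M" and M0: "0 \<le> M"
  shows "norm (u z) \<le> M"
proof (rule ccontr)
  assume "\<not> norm (u z) \<le> M"
  define U where "U = {x. M < norm (u x)}"
  have z: "z \<in> U" using \<open>\<not> norm (u z) \<le> M\<close> by (simp add: U_def)
  have U: "open U" unfolding U_def by (intro open_Collect_less continuous_intros uc)
  have "AE x in lborel. ennreal (norm (u x)) \<le> Linf_norm u"
    unfolding Linf_norm_def by (rule esssup_AE)
  then have "AE x in lborel. x \<notin> U"
  proof eventually_elim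
    case (elim x)
    then have "ennreal (norm (u x)) \<le> ennreal M" using L by (rule order_trans)
    then show ?case using M0 by (simp add: U_def ennreal_le_iff)
  qed
  then have "emeasure lborel U = 0"
    using U by (subst (asm) AE_iff_measurable[where N=U]) (auto simp: borel_open)
  moreover obtain e where "0 < e" "ball z e \<subseteq> U" using U z open_contains_ball by blast
  ultimately have "emeasure lborel (ball z e) = 0"
    using emeasure_mono[of "ball z e" U lborel] U by (simp add: borel_open)
  then have "negligible (ball z e)"
    by (intro negligible_iff_null_sets[THEN iffD2] null_sets_completionI) (simp add: null_sets_def)
  then show False using open_not_negligible[of "ball z e"] \<open>0 < e\<close> by simp
qed

lemma finite_multi_indices: "finite {\<alpha> :: 'n::finite \<Rightarrow> nat. midx_deg \<alpha> \<le> k}"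
proof (rule finite_subset)
  show "{\<alpha> :: 'n \<Rightarrow> nat. midx_deg \<alpha> \<le> k} \<subseteq> PiE UNIV (\<lambda>_. {..k})"
  proof
    fix \<alpha> :: "'n \<Rightarrow> nat" assume "\<alpha> \<in> {\<alpha>. midx_deg \<alpha> \<le> k}"
    then have "(\<Sum>i\<in>UNIV. \<alpha> i) \<le> k" by (simp add: midx_deg_def)
    moreover have "\<alpha> i \<le> (\<Sum>i\<in>UNIV. \<alpha> i)" for i by (rule member_le_sum) auto
    ultimately have "\<alpha> i \<le> k" for i using order_trans by blast
    then show "\<alpha> \<in> PiE UNIV (\<lambda>_. {..k})" by auto
  qed
  show "finite (PiE (UNIV :: 'n set) (\<lambda>_. {..k}))" by (intro finite_PiE) auto
qed

lemma cv_gamma_pos: "1 \<le> d \<Longrightarrow> 0 < cv_gamma d"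
proof -
  assume d: "1 \<le> d"
  have "0 < 2 powr (real d / 4) * (1 + 25 / 2 ^ d) * (1 + real d) ^ cv_order d"
    by (intro mult_pos_pos zero_less_power add_pos_nonneg) auto
  then show ?thesis using constant_le_cv_gamma[OF d] by linarith
qed

lemma weyl_opnorm:
  fixes a :: "(real ^ 'n::finite) \<times> (real ^ 'n) \<Rightarrow> complex"
  assumes a: "schwartz_fun a" and h: "0 < h" "h \<le> 1"
  shows "L2_opnorm (Op_weyl h a)
    \<le> ennreal (cv_gamma CARD('n)) *
      Max {Linf_norm (D_xi \<beta> (D_x \<alpha> a)) | \<alpha> \<beta>.
             midx_deg \<beta> \<le> cv_order CARD('n) \<and> midx_deg \<alpha> \<le> cv_order CARD('n)}"
proof -
  define k where "k = cv_order CARD('n)"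
  define X where "X = {Linf_norm (D_xi \<beta> (D_x \<alpha> a)) | \<alpha> \<beta>. midx_deg \<beta> \<le> k \<and> midx_deg \<alpha> \<le> k}"
  have g: "0 < cv_gamma CARD('n)" by (rule cv_gamma_pos) (simp add: Suc_leI)
  have X: "finite X"
  proof -
    have "X = (\<lambda>(\<alpha>, \<beta>). Linf_norm (D_xi \<beta> (D_x \<alpha> a))) ` ({\<alpha>. midx_deg \<alpha> \<le> k} \<times> {\<beta>. midx_deg \<beta> \<le> k})"
      unfolding X_def by auto
    then show ?thesis using finite_multi_indices[where 'n='n, of k] by simp
  qed
  have "L2_opnorm (Op_weyl h a) \<le> ennreal (cv_gamma CARD('n)) * Max X"
  proof (cases "Max X = \<top>")
    case True
    then show ?thesis using g by (simp add: ennreal_mult_top)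
  next
    case False
    define M where "M = enn2real (Max X)"
    have M: "Max X = ennreal M" and M0: "0 \<le> M" using False by (auto simp: M_def less_top)
    have bd: "norm (D_xi \<beta> (D_x \<alpha> a) z) \<le> M" if "midx_deg \<alpha> \<le> k" "midx_deg \<beta> \<le> k" for \<alpha> \<beta> z
    proof (rule norm_le_Linf[where u = "D_xi \<beta> (D_x \<alpha> a)" and M = M, OF _ _ M0])
      show "continuous_on UNIV (D_xi \<beta> (D_x \<alpha> a))"
        by (intro smooth_continuous schwartz_smooth schwartz_D_xi schwartz_D_x a)
      show "Linf_norm (D_xi \<beta> (D_x \<alpha> a)) \<le> ennreal M"
        unfolding M[symmetric] by (rule Max_ge[OF X]) (use that in \<open>auto simp: X_def\<close>)
    qed
    have bd': "norm (D_xi \<beta> (D_x \<alpha> (dilate h a)) z) \<le> M" if "midx_deg \<alpha> \<le> k" "midx_deg \<beta> \<le> k" for \<alpha> \<beta> z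
      using dilate_derivs(2)[OF h a, of \<beta> \<alpha> z] bd[OF that] by (rule order_trans)
    have C0: "0 \<le> cv_gamma CARD('n) * M" using g M0 by simp
    have am: "a \<in> borel_measurable borel" by (rule smooth_measurable[OF schwartz_smooth[OF a]])
    have "L2_fun (Op_weyl h a f) \<and> L2_norm (Op_weyl h a f) \<le> cv_gamma CARD('n) * M * L2_norm f" if "L2_fun f" for f
      using weyl_L2_bound[OF dilate_derivs(1)[OF h a] bd'[unfolded k_def] C0 weyl_kernel_eq[OF h(1) am] that]
      unfolding Op_weyl_def by simp
    then have "L2_opnorm (Op_weyl h a) \<le> ennreal (cv_gamma CARD('n) * M)"
      unfolding L2_opnorm_def using C0 by (intro Inf_lower) auto
    also have "\<dots> = ennreal (cv_gamma CARD('n)) * Max X"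
      unfolding M using g M0 by (simp add: ennreal_mult)
    finally show ?thesis .
  qed
  then show ?thesis unfolding X_def k_def .
qed

theorem theoremC4:
  fixes a :: "(real ^ 'n::finite) \<times> (real ^ 'n) \<Rightarrow> complex"
  assumes "schwartz_fun a"
  shows "L2_opnorm (Op_weyl 1 a)
           \<le> ennreal (cv_gamma CARD('n)) *
             Max {Linf_norm (D_xi \<beta> (D_x \<alpha> a)) | \<alpha> \<beta>.
                    midx_deg \<beta> \<le> cv_order CARD('n) \<and> midx_deg \<alpha> \<le> cv_order CARD('n)}
       \<and> (\<forall>h::real. 0 < h \<and> h \<le> 1 \<longrightarrow>
            L2_opnorm (Op_weyl h a)
              \<le> ennreal (cv_gamma CARD('n)) *
                Max {Linf_norm (D_xi \<beta> (D_x \<alpha> a)) | \<alpha> \<beta>.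
                       midx_deg \<beta> \<le> cv_order CARD('n) \<and> midx_deg \<alpha> \<le> cv_order CARD('n)})"
  using weyl_opnorm[OF assms] by simp

end
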